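(* Let $A$ be a semilattice of groups. Up to identification of isomorphic groups and semigroups, there is a one-to-one correspondence between twisted partial actions of groups on $A$ and Sieben twisted module structures on $A$ over $E$-unitary inverse semigroups, given by $\Theta\mapsto\Lambda^\Theta$ and $\Lambda\mapsto\Theta^\Lambda$; that is: for every Sieben twisted $S$-module structure $\Lambda$ on $A$ with $S$ $E$-unitary there is an isomorphism $\nu:S\to E(A)*_{\theta}\mathcal G(S)$ (where $\Theta^\Lambda=(\theta,w)$) with $\Lambda=\Lambda^{\Theta^\Lambda}\circ\nu$, and for every twisted partial action $\Theta$ of a group $G$ on $A$ there is an isomorphism $\nu:G\to\mathcal G(E(A)*_\theta G)$ with $\Theta=\Theta^{\Lambda^\Theta}\circ\nu$. Moreover, equivalent twisted partial actions correspond to equivalent Sieben twisted modules (in both directions).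
   Context: A semilattice of groups is an inverse semigroup $A$ with central idempotents; $A_e=\{a: aa^{-1}=a^{-1}a=e\}$ for $e\in E(A)$. For an inverse semigroup $S$: $\sigma$ is the minimum group congruence, $\mathcal G(S)=S/\sigma$, $\sigma^\natural:S\to\mathcal G(S)$; $S$ is $E$-unitary if $e\le s$ with $e\in E(S)$ forces $s\in E(S)$. An endomorphism $\varphi$ of $A$ is relatively invertible if there are an endomorphism $\bar\varphi$ and $e_\varphi\in E(A)$ with $\bar\varphi(\varphi(a))=e_\varphi a$, $\varphi(\bar\varphi(a))=\varphi(e_\varphi)a$ for all $a$, $e_\varphi$ the identity of $\bar\varphi(A)$ and $\varphi(e_\varphi)$ the identity of $\varphi(A)$. A twisted $S$-module structure on $A$ is $\Lambda=(\alpha,\lambda,f)$ with $\alpha:E(S)\to E(A)$ an isomorphism, $s\mapsto\lambda_s$ a map from $S$ to relatively invertible endomorphisms, $f:S\times S\to A$ with $f(s,t)\in A_{\alpha(stt^{-1}s^{-1})}$, such that (i) $\lambda_e(a)=\alpha(e)a$ ($e\in E(S)$); (ii) $\lambda_s(\alpha(e))=\alpha(ses^{-1})$; (iii) $\lambda_s(\lambda_t(a))=f(s,t)\lambda_{st}(a)f(s,t)^{-1}$; (iv) $f(se,e)=\alpha(ses^{-1})$, $f(e,es)=\alpha(ess^{-1})$; (v) $\lambda_s(f(t,u))f(s,tu)=f(s,t)f(st,u)$. It is Sieben if $f(s,e)=\alpha(ses^{-1})$ and $f(e,s)=\alpha(ess^{-1})$ for all $s\in S,e\in E(S)$. Two structures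 $(\alpha,\lambda,f),(\alpha',\lambda',f')$ over $S$ are equivalent if $\alpha'=\alpha$ and there is $g:S\to A$ with $g(s)\in A_{\alpha(ss^{-1})}$, $\lambda'_s(a)=g(s)\lambda_s(a)g(s)^{-1}$ and $f'(s,t)g(st)=g(s)\lambda_s(g(t))f(s,t)$. For an isomorphism $\nu:S\to S'$ and a structure $\Lambda'$ over $S'$, $\Lambda'\circ\nu=(\alpha'\circ\nu|_{E(S)},\lambda'\circ\nu,f'\circ(\nu\times\nu))$. Multipliers and twisted partial actions: a multiplier of a semigroup $T$ is a pair $(L,R)$ of maps $T\to T$ with $L(st)=L(s)t$, $R(st)=sR(t)$, $sL(t)=R(s)t$, written $ws=L(s)$, $sw=R(s)$; they form a monoid $\mathcal M(T)$ with unit group $\mathcal U(\mathcal M(T))$. A twisted partial action of a group $G$ on $A$ is $\Theta=(\theta,w)$, $\theta_x:D_{x^{-1}}\to D_x$ isomorphisms of nonempty ideals, $w_{x,y}\in\mathcal U(\mathcal M(D_xD_{xy}))$, with (i) $D_x^2=D_x$, $D_xD_y=D_yD_x$; (ii) $D_1=A$, $\theta_1=\mathrm{id}$; (iii) $\theta_x(D_{x^{-1}}D_y)=D_xD_{xy}$; (iv) $\theta_x\theta_y(s)=w_{x,y}\theta_{xy}(s)w_{x,y}^{-1}$ for $s\in D_{y^{-1}}D_{y^{-1}x^{-1}}$; (v) $w_{1,x}=w_{x,1}=$ identity of $D_x$; (vi) $\theta_x(sw_{y,z})w_{x,yz}=\theta_x(s)w_{x,y}w_{xy,z}$ for $s\in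 D_{x^{-1}}D_yD_{yz}$. Two such, $(\theta,w)$ and $(\theta',w')$, are equivalent if $D'_x=D_x$ and there are $\varepsilon_x\in\mathcal U(\mathcal M(D_x))$ with $\theta'_x(s)=\varepsilon_x\theta_x(s)\varepsilon_x^{-1}$ ($s\in D_{x^{-1}}$) and $\theta'_x(s)w'_{x,y}\varepsilon_{xy}=\varepsilon_x\theta_x(s\varepsilon_y)w_{x,y}$ ($s\in D_{x^{-1}}D_y$). For an isomorphism $\nu:G\to G'$ and $\Theta'$ on $G'$, $\Theta'\circ\nu$ is given by $\theta'_{\nu(x)}$, $w'_{\nu(x),\nu(y)}$. Construction $\Theta^\Lambda$ (for $\Lambda$ Sieben over $E$-unitary $S$): for $x\in\mathcal G(S)$ (a $\sigma$-class), $D_x=\bigsqcup_{s\in x}A_{\alpha(ss^{-1})}$; for $a\in D_{x^{-1}}$, $\theta_x(a)=\lambda_s(a)$ where $s\in x$ is the unique element with $\alpha(s^{-1}s)=aa^{-1}$; for $a\in D_xD_{xy}$, $w_{x,y}a=f(s,s^{-1}t)a$, $aw_{x,y}=af(s,s^{-1}t)$ where $s\in x$, $t\in xy$ are the unique elements with $\alpha(ss^{-1})=\alpha(tt^{-1})=aa^{-1}$. This is a twisted partial action of $\mathcal G(S)$ on $A$. Construction $\Lambda^\Theta$ (for a twisted partial action $\Theta=(\theta,w)$ of $G$ on $A$): $\theta$ restricts to isomorphisms $E(D_{x^{-1}})\to E(D_x)$; $E(A)*_\theta G=\{e\delta_x: e\in E(D_x)\}$ with $e\delta_x\cdot f\delta_y=\theta_x(\theta_x^{-1}(e)f)\delta_{xy}$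 is an $E$-unitary inverse semigroup. Then $\Lambda^\Theta=(\alpha,\lambda,f)$ over $E(A)*_\theta G$ with $\alpha(e\delta_1)=e$, $\lambda_{e\delta_x}(a)=\theta_x(\theta_x^{-1}(e)a)$, $f(e\delta_x,e'\delta_y)=\theta_x(\theta_x^{-1}(e)e')w_{x,y}$; it is a Sieben twisted module structure. *)

theory Defs
  imports "HOL-Algebra.Group"
begin

definition sg_on :: "'a set \<Rightarrow> ('a \<Rightarrow> 'a \<Rightarrow> 'a) \<Rightarrow> bool" where
  "sg_on S m \<longleftrightarrow> (\<forall>a\<in>S. \<forall>b\<in>S. m a b \<in> S) \<and>
     (\<forall>a\<in>S. \<forall>b\<in>S. \<forall>c\<in>S. m (m a b) c = m a (m b c))"

definition idems :: "'a set \<Rightarrow> ('a \<Rightarrow> 'a \<Rightarrow> 'a) \<Rightarrow> 'a set" where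
  "idems S m = {e \<in> S. m e e = e}"

definition is_inverse_of :: "'a set \<Rightarrow> ('a \<Rightarrow> 'a \<Rightarrow> 'a) \<Rightarrow> 'a \<Rightarrow> 'a \<Rightarrow> bool" where
  "is_inverse_of S m a b \<longleftrightarrow> b \<in> S \<and> m (m a b) a = a \<and> m (m b a) b = b"

definition inverse_semigroup :: "'a set \<Rightarrow> ('a \<Rightarrow> 'a \<Rightarrow> 'a) \<Rightarrow> bool" where
  "inverse_semigroup S m \<longleftrightarrow> S \<noteq> {} \<and> sg_on S m \<and> (\<forall>a\<in>S. \<exists>!b. is_inverse_of S m a b)"

definition sinv :: "'a set \<Rightarrow> ('a \<Rightarrow> 'a \<Rightarrow> 'a) \<Rightarrow> 'a \<Rightarrow> 'a" where
  "sinv S m a = (THE b. is_inverse_of S m a b)"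

definition nat_le :: "'a set \<Rightarrow> ('a \<Rightarrow> 'a \<Rightarrow> 'a) \<Rightarrow> 'a \<Rightarrow> 'a \<Rightarrow> bool" where
  "nat_le S m s t \<longleftrightarrow> (\<exists>e\<in>idems S m. s = m e t)"

definition E_unitary :: "'a set \<Rightarrow> ('a \<Rightarrow> 'a \<Rightarrow> 'a) \<Rightarrow> bool" where
  "E_unitary S m \<longleftrightarrow> (\<forall>e\<in>idems S m. \<forall>s\<in>S. nat_le S m e s \<longrightarrow> s \<in> idems S m)"

definition sig_cls :: "'a set \<Rightarrow> ('a \<Rightarrow> 'a \<Rightarrow> 'a) \<Rightarrow> 'a \<Rightarrow> 'a set" where
  "sig_cls S m s = {t \<in> S. \<exists>e\<in>idems S m. m e s = m e t}"

definition maxgrp :: "'a set \<Rightarrow> ('a \<Rightarrow> 'a \<Rightarrow> 'a) \<Rightarrow> 'a set monoid" where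
  "maxgrp S m = \<lparr> carrier = sig_cls S m ` S,
      mult = (\<lambda>X Y. sig_cls S m (m (SOME s. s \<in> X) (SOME t. t \<in> Y))),
      one = sig_cls S m (SOME e. e \<in> idems S m) \<rparr>"

definition sg_iso :: "('a \<Rightarrow> 'c) \<Rightarrow> 'a set \<Rightarrow> ('a \<Rightarrow> 'a \<Rightarrow> 'a) \<Rightarrow> 'c set \<Rightarrow> ('c \<Rightarrow> 'c \<Rightarrow> 'c) \<Rightarrow> bool" where
  "sg_iso \<nu> S m T n \<longleftrightarrow> bij_betw \<nu> S T \<and> (\<forall>a\<in>S. \<forall>b\<in>S. \<nu> (m a b) = n (\<nu> a) (\<nu> b))"

definition semilattice_of_groups :: "'b set \<Rightarrow> ('b \<Rightarrow> 'b \<Rightarrow> 'b) \<Rightarrow> bool" where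
  "semilattice_of_groups A mA \<longleftrightarrow> inverse_semigroup A mA \<and>
     (\<forall>e\<in>idems A mA. \<forall>a\<in>A. mA e a = mA a e)"

definition Agrp :: "'b set \<Rightarrow> ('b \<Rightarrow> 'b \<Rightarrow> 'b) \<Rightarrow> 'b \<Rightarrow> 'b set" where
  "Agrp A mA e = {a \<in> A. mA a (sinv A mA a) = e \<and> mA (sinv A mA a) a = e}"

definition endo :: "'b set \<Rightarrow> ('b \<Rightarrow> 'b \<Rightarrow> 'b) \<Rightarrow> ('b \<Rightarrow> 'b) \<Rightarrow> bool" where
  "endo A mA \<phi> \<longleftrightarrow> (\<forall>a\<in>A. \<phi> a \<in> A) \<and> (\<forall>a\<in>A. \<forall>b\<in>A. \<phi> (mA a b) = mA (\<phi> a) (\<phi> b))"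

definition is_identity_of :: "'b set \<Rightarrow> ('b \<Rightarrow> 'b \<Rightarrow> 'b) \<Rightarrow> 'b \<Rightarrow> bool" where
  "is_identity_of X mA e \<longleftrightarrow> e \<in> X \<and> (\<forall>b\<in>X. mA e b = b \<and> mA b e = b)"

definition rel_invertible :: "'b set \<Rightarrow> ('b \<Rightarrow> 'b \<Rightarrow> 'b) \<Rightarrow> ('b \<Rightarrow> 'b) \<Rightarrow> bool" where
  "rel_invertible A mA \<phi> \<longleftrightarrow> endo A mA \<phi> \<and>
     (\<exists>\<phi>b e. endo A mA \<phi>b \<and> e \<in> idems A mA \<and>
        (\<forall>a\<in>A. \<phi>b (\<phi> a) = mA e a) \<and> (\<forall>a\<in>A. \<phi> (\<phi>b a) = mA (\<phi> e) a) \<and>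
        is_identity_of (\<phi>b ` A) mA e \<and> is_identity_of (\<phi> ` A) mA (\<phi> e))"

definition tms :: "'a set \<Rightarrow> ('a \<Rightarrow> 'a \<Rightarrow> 'a) \<Rightarrow> 'b set \<Rightarrow> ('b \<Rightarrow> 'b \<Rightarrow> 'b)
     \<Rightarrow> ('a \<Rightarrow> 'b) \<Rightarrow> ('a \<Rightarrow> 'b \<Rightarrow> 'b) \<Rightarrow> ('a \<Rightarrow> 'a \<Rightarrow> 'b) \<Rightarrow> bool" where
  "tms S m A mA \<alpha> lam f \<longleftrightarrow>
     bij_betw \<alpha> (idems S m) (idems A mA) \<and>
     (\<forall>e\<in>idems S m. \<forall>e'\<in>idems S m. \<alpha> (m e e') = mA (\<alpha> e) (\<alpha> e')) \<and>
     (\<forall>s\<in>S. rel_invertible A mA (lam s)) \<and>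
     (\<forall>s\<in>S. \<forall>t\<in>S. f s t \<in> Agrp A mA (\<alpha> (m (m (m s t) (sinv S m t)) (sinv S m s)))) \<and>
     (\<forall>e\<in>idems S m. \<forall>a\<in>A. lam e a = mA (\<alpha> e) a) \<and>
     (\<forall>s\<in>S. \<forall>e\<in>idems S m. lam s (\<alpha> e) = \<alpha> (m (m s e) (sinv S m s))) \<and>
     (\<forall>s\<in>S. \<forall>t\<in>S. \<forall>a\<in>A.
        lam s (lam t a) = mA (mA (f s t) (lam (m s t) a)) (sinv A mA (f s t))) \<and>
     (\<forall>s\<in>S. \<forall>e\<in>idems S m. f (m s e) e = \<alpha> (m (m s e) (sinv S m s)) \<and>
                             f e (m e s) = \<alpha> (m (m e s) (sinv S m s))) \<and>
     (\<forall>s\<in>S. \<forall>t\<in>S. \<forall>u\<in>S.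
        mA (lam s (f t u)) (f s (m t u)) = mA (f s t) (f (m s t) u))"

definition sieben_tms :: "'a set \<Rightarrow> ('a \<Rightarrow> 'a \<Rightarrow> 'a) \<Rightarrow> 'b set \<Rightarrow> ('b \<Rightarrow> 'b \<Rightarrow> 'b)
     \<Rightarrow> ('a \<Rightarrow> 'b) \<Rightarrow> ('a \<Rightarrow> 'b \<Rightarrow> 'b) \<Rightarrow> ('a \<Rightarrow> 'a \<Rightarrow> 'b) \<Rightarrow> bool" where
  "sieben_tms S m A mA \<alpha> lam f \<longleftrightarrow> tms S m A mA \<alpha> lam f \<and>
     (\<forall>s\<in>S. \<forall>e\<in>idems S m. f s e = \<alpha> (m (m s e) (sinv S m s)) \<and>
                             f e s = \<alpha> (m (m e s) (sinv S m s)))"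

definition tms_equiv :: "'a set \<Rightarrow> ('a \<Rightarrow> 'a \<Rightarrow> 'a) \<Rightarrow> 'b set \<Rightarrow> ('b \<Rightarrow> 'b \<Rightarrow> 'b)
     \<Rightarrow> ('a \<Rightarrow> 'b) \<Rightarrow> ('a \<Rightarrow> 'b \<Rightarrow> 'b) \<Rightarrow> ('a \<Rightarrow> 'a \<Rightarrow> 'b)
     \<Rightarrow> ('a \<Rightarrow> 'b) \<Rightarrow> ('a \<Rightarrow> 'b \<Rightarrow> 'b) \<Rightarrow> ('a \<Rightarrow> 'a \<Rightarrow> 'b) \<Rightarrow> bool" where
  "tms_equiv S m A mA \<alpha> lam f \<alpha>' lam' f' \<longleftrightarrow>
     (\<forall>e\<in>idems S m. \<alpha>' e = \<alpha> e) \<and>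
     (\<exists>g. \<forall>s\<in>S. g s \<in> Agrp A mA (\<alpha> (m s (sinv S m s))) \<and>
          (\<forall>a\<in>A. lam' s a = mA (mA (g s) (lam s a)) (sinv A mA (g s))) \<and>
          (\<forall>t\<in>S. mA (f' s t) (g (m s t)) = mA (mA (g s) (lam s (g t))) (f s t)))"

definition tms_comp_eq :: "'a set \<Rightarrow> ('a \<Rightarrow> 'a \<Rightarrow> 'a) \<Rightarrow> 'b set
     \<Rightarrow> ('a \<Rightarrow> 'b) \<Rightarrow> ('a \<Rightarrow> 'b \<Rightarrow> 'b) \<Rightarrow> ('a \<Rightarrow> 'a \<Rightarrow> 'b)
     \<Rightarrow> ('c \<Rightarrow> 'b) \<Rightarrow> ('c \<Rightarrow> 'b \<Rightarrow> 'b) \<Rightarrow> ('c \<Rightarrow> 'c \<Rightarrow> 'b) \<Rightarrow> ('a \<Rightarrow> 'c) \<Rightarrow> bool" where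
  "tms_comp_eq S m A \<alpha> lam f \<alpha>' lam' f' \<nu> \<longleftrightarrow>
     (\<forall>e\<in>idems S m. \<alpha> e = \<alpha>' (\<nu> e)) \<and>
     (\<forall>s\<in>S. \<forall>a\<in>A. lam s a = lam' (\<nu> s) a) \<and>
     (\<forall>s\<in>S. \<forall>t\<in>S. f s t = f' (\<nu> s) (\<nu> t))"

definition setprod :: "('b \<Rightarrow> 'b \<Rightarrow> 'b) \<Rightarrow> 'b set \<Rightarrow> 'b set \<Rightarrow> 'b set" where
  "setprod mA X Y = {mA a b | a b. a \<in> X \<and> b \<in> Y}"

definition is_ideal :: "'b set \<Rightarrow> ('b \<Rightarrow> 'b \<Rightarrow> 'b) \<Rightarrow> 'b set \<Rightarrow> bool" where
  "is_ideal A mA I \<longleftrightarrow> I \<subseteq> A \<and> I \<noteq> {} \<and> (\<forall>a\<in>A. \<forall>i\<in>I. mA a i \<in> I \<and> mA i a \<in> I)"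

text \<open>A multiplier w = (L,R) of T: \<open>w s = fst w s\<close>, \<open>s w = snd w s\<close>.\<close>
definition is_multiplier :: "'b set \<Rightarrow> ('b \<Rightarrow> 'b \<Rightarrow> 'b) \<Rightarrow> ('b \<Rightarrow> 'b) \<times> ('b \<Rightarrow> 'b) \<Rightarrow> bool" where
  "is_multiplier T mA w \<longleftrightarrow> (\<forall>s\<in>T. fst w s \<in> T \<and> snd w s \<in> T) \<and>
     (\<forall>s\<in>T. \<forall>t\<in>T. fst w (mA s t) = mA (fst w s) t \<and> snd w (mA s t) = mA s (snd w t) \<and>
                     mA s (fst w t) = mA (snd w s) t)"

text \<open>w' is the inverse of w in the monoid M(T) (product: L = L\<circ>L', R = R'\<circ>R; maps compared on T)\<close>
definition mult_inverse :: "'b set \<Rightarrow> ('b \<Rightarrow> 'b \<Rightarrow> 'b) \<Rightarrow> ('b \<Rightarrow> 'b) \<times> ('b \<Rightarrow> 'b)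
     \<Rightarrow> ('b \<Rightarrow> 'b) \<times> ('b \<Rightarrow> 'b) \<Rightarrow> bool" where
  "mult_inverse T mA w w' \<longleftrightarrow> is_multiplier T mA w \<and> is_multiplier T mA w' \<and>
     (\<forall>s\<in>T. fst w (fst w' s) = s \<and> fst w' (fst w s) = s \<and>
            snd w (snd w' s) = s \<and> snd w' (snd w s) = s)"

definition is_unit_multiplier :: "'b set \<Rightarrow> ('b \<Rightarrow> 'b \<Rightarrow> 'b) \<Rightarrow> ('b \<Rightarrow> 'b) \<times> ('b \<Rightarrow> 'b) \<Rightarrow> bool" where
  "is_unit_multiplier T mA w \<longleftrightarrow> (\<exists>w'. mult_inverse T mA w w')"

definition minv :: "'b set \<Rightarrow> ('b \<Rightarrow> 'b \<Rightarrow> 'b) \<Rightarrow> ('b \<Rightarrow> 'b) \<times> ('b \<Rightarrow> 'b) \<Rightarrow> ('b \<Rightarrow> 'b) \<times> ('b \<Rightarrow> 'b)" where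
  "minv T mA w = (SOME w'. mult_inverse T mA w w')"

definition tpa :: "'g monoid \<Rightarrow> 'b set \<Rightarrow> ('b \<Rightarrow> 'b \<Rightarrow> 'b) \<Rightarrow> ('g \<Rightarrow> 'b set)
     \<Rightarrow> ('g \<Rightarrow> 'b \<Rightarrow> 'b) \<Rightarrow> ('g \<Rightarrow> 'g \<Rightarrow> ('b \<Rightarrow> 'b) \<times> ('b \<Rightarrow> 'b)) \<Rightarrow> bool" where
  "tpa G A mA D \<theta> w \<longleftrightarrow> group G \<and>
     (\<forall>x\<in>carrier G. is_ideal A mA (D x) \<and>
        bij_betw (\<theta> x) (D (inv\<^bsub>G\<^esub> x)) (D x) \<and>
        (\<forall>a\<in>D (inv\<^bsub>G\<^esub> x). \<forall>b\<in>D (inv\<^bsub>G\<^esub> x). \<theta> x (mA a b) = mA (\<theta> x a) (\<theta> x b))) \<and>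
     (\<forall>x\<in>carrier G. \<forall>y\<in>carrier G.
        is_unit_multiplier (setprod mA (D x) (D (x \<otimes>\<^bsub>G\<^esub> y))) mA (w x y)) \<and>
     \<comment> \<open>(i)\<close>
     (\<forall>x\<in>carrier G. setprod mA (D x) (D x) = D x) \<and>
     (\<forall>x\<in>carrier G. \<forall>y\<in>carrier G. setprod mA (D x) (D y) = setprod mA (D y) (D x)) \<and>
     \<comment> \<open>(ii)\<close>
     D \<one>\<^bsub>G\<^esub> = A \<and> (\<forall>a\<in>A. \<theta> \<one>\<^bsub>G\<^esub> a = a) \<and>
     \<comment> \<open>(iii)\<close>
     (\<forall>x\<in>carrier G. \<forall>y\<in>carrier G.
        \<theta> x ` setprod mA (D (inv\<^bsub>G\<^esub> x)) (D y) = setprod mA (D x) (D (x \<otimes>\<^bsub>G\<^esub> y))) \<and>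
     \<comment> \<open>(iv)\<close>
     (\<forall>x\<in>carrier G. \<forall>y\<in>carrier G.
        \<forall>s\<in>setprod mA (D (inv\<^bsub>G\<^esub> y)) (D (inv\<^bsub>G\<^esub> y \<otimes>\<^bsub>G\<^esub> inv\<^bsub>G\<^esub> x)).
          \<theta> x (\<theta> y s) =
            snd (minv (setprod mA (D x) (D (x \<otimes>\<^bsub>G\<^esub> y))) mA (w x y))
                (fst (w x y) (\<theta> (x \<otimes>\<^bsub>G\<^esub> y) s))) \<and>
     \<comment> \<open>(v)\<close>
     (\<forall>x\<in>carrier G. \<forall>a\<in>D x. fst (w \<one>\<^bsub>G\<^esub> x) a = a \<and> snd (w \<one>\<^bsub>G\<^esub> x) a = a \<and>
                              fst (w x \<one>\<^bsub>G\<^esub>) a = a \<and> snd (w x \<one>\<^bsub>G\<^esub>) a = a) \<and>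
     \<comment> \<open>(vi)\<close>
     (\<forall>x\<in>carrier G. \<forall>y\<in>carrier G. \<forall>z\<in>carrier G.
        \<forall>s\<in>setprod mA (setprod mA (D (inv\<^bsub>G\<^esub> x)) (D y)) (D (y \<otimes>\<^bsub>G\<^esub> z)).
          snd (w x (y \<otimes>\<^bsub>G\<^esub> z)) (\<theta> x (snd (w y z) s)) =
          snd (w (x \<otimes>\<^bsub>G\<^esub> y) z) (snd (w x y) (\<theta> x s)))"

definition tpa_equiv :: "'g monoid \<Rightarrow> 'b set \<Rightarrow> ('b \<Rightarrow> 'b \<Rightarrow> 'b)
     \<Rightarrow> ('g \<Rightarrow> 'b set) \<Rightarrow> ('g \<Rightarrow> 'b \<Rightarrow> 'b) \<Rightarrow> ('g \<Rightarrow> 'g \<Rightarrow> ('b \<Rightarrow> 'b) \<times> ('b \<Rightarrow> 'b))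
     \<Rightarrow> ('g \<Rightarrow> 'b set) \<Rightarrow> ('g \<Rightarrow> 'b \<Rightarrow> 'b) \<Rightarrow> ('g \<Rightarrow> 'g \<Rightarrow> ('b \<Rightarrow> 'b) \<times> ('b \<Rightarrow> 'b)) \<Rightarrow> bool" where
  "tpa_equiv G A mA D \<theta> w D' \<theta>' w' \<longleftrightarrow>
     (\<forall>x\<in>carrier G. D' x = D x) \<and>
     (\<exists>\<epsilon>. \<forall>x\<in>carrier G. is_unit_multiplier (D x) mA (\<epsilon> x) \<and>
        (\<forall>s\<in>D (inv\<^bsub>G\<^esub> x). \<theta>' x s = snd (minv (D x) mA (\<epsilon> x)) (fst (\<epsilon> x) (\<theta> x s))) \<and>
        (\<forall>y\<in>carrier G. \<forall>s\<in>setprod mA (D (inv\<^bsub>G\<^esub> x)) (D y).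
           snd (\<epsilon> (x \<otimes>\<^bsub>G\<^esub> y)) (snd (w' x y) (\<theta>' x s)) =
           snd (w x y) (fst (\<epsilon> x) (\<theta> x (snd (\<epsilon> y) s)))))"

definition tpa_comp_eq :: "'g monoid \<Rightarrow> ('b \<Rightarrow> 'b \<Rightarrow> 'b)
     \<Rightarrow> ('g \<Rightarrow> 'b set) \<Rightarrow> ('g \<Rightarrow> 'b \<Rightarrow> 'b) \<Rightarrow> ('g \<Rightarrow> 'g \<Rightarrow> ('b \<Rightarrow> 'b) \<times> ('b \<Rightarrow> 'b))
     \<Rightarrow> ('h \<Rightarrow> 'b set) \<Rightarrow> ('h \<Rightarrow> 'b \<Rightarrow> 'b) \<Rightarrow> ('h \<Rightarrow> 'h \<Rightarrow> ('b \<Rightarrow> 'b) \<times> ('b \<Rightarrow> 'b))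
     \<Rightarrow> ('g \<Rightarrow> 'h) \<Rightarrow> bool" where
  "tpa_comp_eq G mA D \<theta> w D' \<theta>' w' \<nu> \<longleftrightarrow>
     (\<forall>x\<in>carrier G. D x = D' (\<nu> x) \<and>
        (\<forall>a\<in>D (inv\<^bsub>G\<^esub> x). \<theta> x a = \<theta>' (\<nu> x) a) \<and>
        (\<forall>y\<in>carrier G. \<forall>a\<in>setprod mA (D x) (D (x \<otimes>\<^bsub>G\<^esub> y)).
           fst (w x y) a = fst (w' (\<nu> x) (\<nu> y)) a \<and> snd (w x y) a = snd (w' (\<nu> x) (\<nu> y)) a))"

definition thD :: "'a set \<Rightarrow> ('a \<Rightarrow> 'a \<Rightarrow> 'a) \<Rightarrow> 'b set \<Rightarrow> ('b \<Rightarrow> 'b \<Rightarrow> 'b)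
     \<Rightarrow> ('a \<Rightarrow> 'b) \<Rightarrow> 'a set \<Rightarrow> 'b set" where
  "thD S m A mA \<alpha> X = (\<Union>s\<in>X. Agrp A mA (\<alpha> (m s (sinv S m s))))"

definition thTheta :: "'a set \<Rightarrow> ('a \<Rightarrow> 'a \<Rightarrow> 'a) \<Rightarrow> 'b set \<Rightarrow> ('b \<Rightarrow> 'b \<Rightarrow> 'b)
     \<Rightarrow> ('a \<Rightarrow> 'b) \<Rightarrow> ('a \<Rightarrow> 'b \<Rightarrow> 'b) \<Rightarrow> 'a set \<Rightarrow> 'b \<Rightarrow> 'b" where
  "thTheta S m A mA \<alpha> lam X a =
     lam (THE s. s \<in> X \<and> \<alpha> (m (sinv S m s) s) = mA a (sinv A mA a)) a"

definition pick_r :: "'a set \<Rightarrow> ('a \<Rightarrow> 'a \<Rightarrow> 'a) \<Rightarrow> 'b set \<Rightarrow> ('b \<Rightarrow> 'b \<Rightarrow> 'b)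
     \<Rightarrow> ('a \<Rightarrow> 'b) \<Rightarrow> 'a set \<Rightarrow> 'b \<Rightarrow> 'a" where
  "pick_r S m A mA \<alpha> X a = (THE s. s \<in> X \<and> \<alpha> (m s (sinv S m s)) = mA a (sinv A mA a))"

definition thW :: "'a set \<Rightarrow> ('a \<Rightarrow> 'a \<Rightarrow> 'a) \<Rightarrow> 'b set \<Rightarrow> ('b \<Rightarrow> 'b \<Rightarrow> 'b)
     \<Rightarrow> ('a \<Rightarrow> 'b) \<Rightarrow> ('a \<Rightarrow> 'a \<Rightarrow> 'b) \<Rightarrow> 'a set \<Rightarrow> 'a set \<Rightarrow> ('b \<Rightarrow> 'b) \<times> ('b \<Rightarrow> 'b)" where
  "thW S m A mA \<alpha> f X Y =
     (let c = (\<lambda>a. f (pick_r S m A mA \<alpha> X a)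
                     (m (sinv S m (pick_r S m A mA \<alpha> X a))
                        (pick_r S m A mA \<alpha> (X \<otimes>\<^bsub>maxgrp S m\<^esub> Y) a)))
      in (\<lambda>a. mA (c a) a, \<lambda>a. mA a (c a)))"

text \<open>E(A) *_\<theta> G: pairs (e,x) standing for e\<delta>_x\<close>
definition cross_car :: "'g monoid \<Rightarrow> ('b \<Rightarrow> 'b \<Rightarrow> 'b) \<Rightarrow> ('g \<Rightarrow> 'b set) \<Rightarrow> ('b \<times> 'g) set" where
  "cross_car G mA D = {(e, x). x \<in> carrier G \<and> e \<in> idems (D x) mA}"

definition theta_inv :: "'g monoid \<Rightarrow> ('g \<Rightarrow> 'b set) \<Rightarrow> ('g \<Rightarrow> 'b \<Rightarrow> 'b) \<Rightarrow> 'g \<Rightarrow> 'b \<Rightarrow> 'b" where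
  "theta_inv G D \<theta> x = the_inv_into (D (inv\<^bsub>G\<^esub> x)) (\<theta> x)"

definition cross_mult :: "'g monoid \<Rightarrow> ('b \<Rightarrow> 'b \<Rightarrow> 'b) \<Rightarrow> ('g \<Rightarrow> 'b set) \<Rightarrow> ('g \<Rightarrow> 'b \<Rightarrow> 'b)
     \<Rightarrow> 'b \<times> 'g \<Rightarrow> 'b \<times> 'g \<Rightarrow> 'b \<times> 'g" where
  "cross_mult G mA D \<theta> p q =
     (\<theta> (snd p) (mA (theta_inv G D \<theta> (snd p) (fst p)) (fst q)), snd p \<otimes>\<^bsub>G\<^esub> snd q)"

definition lmAlpha :: "'b \<times> 'g \<Rightarrow> 'b" where
  "lmAlpha p = fst p"

definition lmLam :: "'g monoid \<Rightarrow> ('b \<Rightarrow> 'b \<Rightarrow> 'b) \<Rightarrow> ('g \<Rightarrow> 'b set) \<Rightarrow> ('g \<Rightarrow> 'b \<Rightarrow> 'b)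
     \<Rightarrow> 'b \<times> 'g \<Rightarrow> 'b \<Rightarrow> 'b" where
  "lmLam G mA D \<theta> p a = \<theta> (snd p) (mA (theta_inv G D \<theta> (snd p) (fst p)) a)"

definition lmF :: "'g monoid \<Rightarrow> ('b \<Rightarrow> 'b \<Rightarrow> 'b) \<Rightarrow> ('g \<Rightarrow> 'b set) \<Rightarrow> ('g \<Rightarrow> 'b \<Rightarrow> 'b)
     \<Rightarrow> ('g \<Rightarrow> 'g \<Rightarrow> ('b \<Rightarrow> 'b) \<times> ('b \<Rightarrow> 'b)) \<Rightarrow> 'b \<times> 'g \<Rightarrow> 'b \<times> 'g \<Rightarrow> 'b" where
  "lmF G mA D \<theta> w p q =
     snd (w (snd p) (snd q)) (\<theta> (snd p) (mA (theta_inv G D \<theta> (snd p) (fst p)) (fst q)))"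

end

theory Submission
  imports Defs
begin

text \<open>
  In a semilattice of groups every element \<open>a\<close> sits in the group at the central idempotent
  \<open>ran a = a a\<^sup>-\<^sup>1\<close>, so products of ideals are intersections.  The multipliers of a group are its
  translations, hence a unit multiplier of an ideal is a choice of an element in the group at each
  idempotent of the ideal, compatible with restriction; a twist \<open>w\<close> is a family of such choices.

  In an \<open>E\<close>-unitary semigroup an element is determined by its \<open>\<sigma>\<close>-class \<open>x\<close> together with \<open>s s\<^sup>-\<^sup>1\<close>,
  so \<open>s\<close> may be replaced by the pair \<open>(\<alpha> (s s\<^sup>-\<^sup>1), x)\<close>.  The Sieben condition gives
  \<open>\<lambda>\<^bsub>s e\<^esub>(a) = \<lambda>\<^sub>s(\<alpha>(e) a)\<close> and \<open>f(s e, t) = f(s, e t)\<close>, so \<open>\<lambda>\<close> and \<open>f\<close> are determined by their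
  values where domains and ranges match, and these are the values of \<open>\<theta>\<close> and \<open>w\<close>.  Conversely, on
  idempotents the twist acts trivially, so \<open>\<theta>\<close> restricts to a genuine partial action of \<open>G\<close> on
  \<open>E(A)\<close>, and the composition law \<open>\<lambda>\<^sub>p \<lambda>\<^sub>q = f(p, q) \<lambda>\<^bsub>p q\<^esub> f(p, q)\<^sup>-\<^sup>1\<close> specialises there to
  associativity of \<open>E(A) *\<^sub>\<theta> G\<close>.
\<close>

section \<open>Inverse semigroups\<close>

lemma inverse_semigroupI:
  assumes nonempty: "S \<noteq> {}" and sg_on: "sg_on S m"
    and regular: "\<And>a. a \<in> S \<Longrightarrow> \<exists>b. is_inverse_of S m a b"
    and idem_comm: "\<And>e f. e \<in> idems S m \<Longrightarrow> f \<in> idems S m \<Longrightarrow> m e f = m f e"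
  shows "inverse_semigroup S m"
proof -
  have closed: "m a b \<in> S" if "a \<in> S" "b \<in> S" for a b
    using sg_on that by (simp add: sg_on_def)
  have assoc: "m (m a b) c = m a (m b c)" if "a \<in> S" "b \<in> S" "c \<in> S" for a b c
    using sg_on that by (simp add: sg_on_def)
  have "b = c" if a: "a \<in> S" and b: "is_inverse_of S m a b" and c: "is_inverse_of S m a c" for a b c
  proof -
    have mem: "b \<in> S" "c \<in> S" using b c by (auto simp: is_inverse_of_def)
    have cancel: "m a (m b a) = a" "m b (m a b) = b" "m a (m c a) = a" "m c (m a c) = c"
      using a b c mem by (auto simp: is_inverse_of_def assoc)
    have idem: "m a b \<in> idems S m" "m a c \<in> idems S m" "m b a \<in> idems S m" "m c a \<in> idems S m"
      using a mem cancel by (auto simp: idems_def assoc closed)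
    have "b = m b (m (m a c) (m a b))" using a mem cancel by (metis assoc closed)
    also have "\<dots> = m b (m (m a b) (m a c))" using idem_comm idem by simp
    also have "\<dots> = m b (m a c)" using a mem cancel by (metis assoc closed)
    also have "\<dots> = m (m (m b a) (m c a)) c" using a mem cancel by (metis assoc closed)
    also have "\<dots> = m (m (m c a) (m b a)) c" using idem_comm idem by simp
    also have "\<dots> = m c (m a c)" using a mem cancel by (metis assoc closed)
    finally show ?thesis using cancel by simp
  qed
  then show ?thesis unfolding inverse_semigroup_def using nonempty sg_on regular by metis
qed

locale inv_semigroup =
  fixes S :: "'a set" and m :: "'a \<Rightarrow> 'a \<Rightarrow> 'a" (infixl "\<cdot>" 70)
  assumes inverse_semigroup: "inverse_semigroup S m"
begin

abbreviation inverse :: "'a \<Rightarrow> 'a" where "inverse \<equiv> sinv S m"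
abbreviation E :: "'a set" where "E \<equiv> idems S m"

definition ran :: "'a \<Rightarrow> 'a" where "ran a = a \<cdot> inverse a"
definition dom :: "'a \<Rightarrow> 'a" where "dom a = inverse a \<cdot> a"

lemma closed [simp, intro]: "a \<in> S \<Longrightarrow> b \<in> S \<Longrightarrow> a \<cdot> b \<in> S"
  using inverse_semigroup by (simp add: inverse_semigroup_def sg_on_def)

lemma assoc: "a \<in> S \<Longrightarrow> b \<in> S \<Longrightarrow> c \<in> S \<Longrightarrow> a \<cdot> b \<cdot> c = a \<cdot> (b \<cdot> c)"
  using inverse_semigroup by (simp add: inverse_semigroup_def sg_on_def)

lemma nonempty: "S \<noteq> {}"
  using inverse_semigroup by (simp add: inverse_semigroup_def)

lemma is_inverse_of_inverse: "a \<in> S \<Longrightarrow> is_inverse_of S m a (inverse a)"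
  using inverse_semigroup unfolding inverse_semigroup_def sinv_def by (metis theI')

lemma inverse_closed [simp, intro]: "a \<in> S \<Longrightarrow> inverse a \<in> S"
  using is_inverse_of_inverse by (auto simp: is_inverse_of_def)

lemma mult_inverse_mult: "a \<in> S \<Longrightarrow> a \<cdot> inverse a \<cdot> a = a"
  using is_inverse_of_inverse by (auto simp: is_inverse_of_def)

lemma inverse_mult_inverse: "a \<in> S \<Longrightarrow> inverse a \<cdot> a \<cdot> inverse a = inverse a"
  using is_inverse_of_inverse by (auto simp: is_inverse_of_def)

lemma inverse_eqI:
  assumes "a \<in> S" "b \<in> S" "a \<cdot> b \<cdot> a = a" "b \<cdot> a \<cdot> b = b"
  shows "inverse a = b"
proof -
  have "is_inverse_of S m a b" using assms by (simp add: is_inverse_of_def)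
  then show ?thesis
    using is_inverse_of_inverse[of a] assms(1) inverse_semigroup
    unfolding inverse_semigroup_def by blast
qed

lemma inverse_inverse [simp]: "a \<in> S \<Longrightarrow> inverse (inverse a) = a"
  by (rule inverse_eqI) (simp_all add: mult_inverse_mult inverse_mult_inverse)

lemma idem_closed [simp, intro]: "e \<in> E \<Longrightarrow> e \<in> S"
  by (simp add: idems_def)

lemma idem_mult_self [simp]: "e \<in> E \<Longrightarrow> e \<cdot> e = e"
  unfolding idems_def by blast

lemma idemI: "e \<in> S \<Longrightarrow> e \<cdot> e = e \<Longrightarrow> e \<in> E"
  unfolding idems_def by blast

lemma idem_mult_left [simp]: "e \<in> E \<Longrightarrow> a \<in> S \<Longrightarrow> e \<cdot> (e \<cdot> a) = e \<cdot> a"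
  by (simp flip: assoc)

lemma inverse_idem [simp]: "e \<in> E \<Longrightarrow> inverse e = e"
  by (rule inverse_eqI) simp_all

lemma idem_mult_idem [simp, intro]:
  assumes e: "e \<in> E" and f: "f \<in> E"
  shows "e \<cdot> f \<in> E"
proof -
  define x where "x = inverse (e \<cdot> f)"
  have mem: "e \<in> S" "f \<in> S" "x \<in> S" using e f by (auto simp: x_def)
  have efxef: "e \<cdot> (f \<cdot> (x \<cdot> (e \<cdot> f))) = e \<cdot> f"
    using mult_inverse_mult[of "e \<cdot> f"] mem by (simp add: x_def[symmetric] assoc)
  have xefx: "x \<cdot> (e \<cdot> (f \<cdot> x)) = x"
    using inverse_mult_inverse[of "e \<cdot> f"] mem by (simp add: x_def[symmetric] assoc)
  then have xefx_left: "x \<cdot> (e \<cdot> (f \<cdot> (x \<cdot> a))) = x \<cdot> a" if "a \<in> S" for a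
    using that mem by (metis assoc closed)
  \<comment> \<open>\<open>f x e\<close> is a second inverse of \<open>e f\<close>; uniqueness of inverses makes \<open>x\<close> idempotent.\<close>
  have "inverse (e \<cdot> f) = f \<cdot> x \<cdot> e"
    by (rule inverse_eqI) (use e f mem efxef xefx_left in \<open>simp_all add: assoc\<close>)
  then have "x = f \<cdot> x \<cdot> e" by (simp add: x_def)
  then have "f \<cdot> x = x" "x \<cdot> e = x"
    using e f mem by (metis assoc closed idem_mult_self)+
  then have "x \<cdot> x = x \<cdot> (e \<cdot> (f \<cdot> x))" using mem by (metis assoc)
  then have "x \<in> E" using xefx mem by (intro idemI) simp_all
  moreover have "inverse x = e \<cdot> f" using mem by (simp add: x_def)
  ultimately show ?thesis by simp
qed

lemma idem_comm:
  assumes e: "e \<in> E" and f: "f \<in> E"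
  shows "e \<cdot> f = f \<cdot> e"
proof -
  have mem: "e \<in> S" "f \<in> S" using e f by auto
  have idem: "e \<cdot> (f \<cdot> (e \<cdot> f)) = e \<cdot> f" "f \<cdot> (e \<cdot> (f \<cdot> e)) = f \<cdot> e"
    using idem_mult_self[OF idem_mult_idem[OF e f]] idem_mult_self[OF idem_mult_idem[OF f e]] mem
    by (simp_all add: assoc del: idem_mult_idem)
  have "inverse (e \<cdot> f) = f \<cdot> e"
  proof (rule inverse_eqI)
    show "e \<cdot> f \<cdot> (f \<cdot> e) \<cdot> (e \<cdot> f) = e \<cdot> f" using e f mem idem(1) by (simp add: assoc)
    show "f \<cdot> e \<cdot> (e \<cdot> f) \<cdot> (f \<cdot> e) = f \<cdot> e" using e f mem idem(2) by (simp add: assoc)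
  qed (use mem in auto)
  then show ?thesis using e f by simp
qed

lemma idem_left_comm: "e \<in> E \<Longrightarrow> f \<in> E \<Longrightarrow> a \<in> S \<Longrightarrow> e \<cdot> (f \<cdot> a) = f \<cdot> (e \<cdot> a)"
  by (metis assoc idem_closed idem_comm)

lemma ran_mem_E [simp, intro]: "a \<in> S \<Longrightarrow> ran a \<in> E"
  unfolding ran_def by (intro idemI) (simp_all add: mult_inverse_mult flip: assoc)

lemma dom_mem_E [simp, intro]: "a \<in> S \<Longrightarrow> dom a \<in> E"
  unfolding dom_def by (intro idemI) (simp_all add: inverse_mult_inverse flip: assoc)

lemma ran_mult_self [simp]: "a \<in> S \<Longrightarrow> ran a \<cdot> a = a"
  by (simp add: ran_def mult_inverse_mult)

lemma mult_dom_self [simp]: "a \<in> S \<Longrightarrow> a \<cdot> dom a = a"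
  by (simp add: dom_def mult_inverse_mult flip: assoc)

lemma ran_idem [simp]: "e \<in> E \<Longrightarrow> ran e = e"
  by (simp add: ran_def)

lemma dom_idem [simp]: "e \<in> E \<Longrightarrow> dom e = e"
  by (simp add: dom_def)

lemma ran_inverse [simp]: "a \<in> S \<Longrightarrow> ran (inverse a) = dom a"
  by (simp add: ran_def dom_def)

lemma dom_inverse [simp]: "a \<in> S \<Longrightarrow> dom (inverse a) = ran a"
  by (simp add: ran_def dom_def)

lemma inverse_mult:
  assumes a: "a \<in> S" and b: "b \<in> S"
  shows "inverse (a \<cdot> b) = inverse b \<cdot> inverse a"
proof (rule inverse_eqI)
  have "a \<cdot> b \<cdot> (inverse b \<cdot> inverse a) \<cdot> (a \<cdot> b) = a \<cdot> (ran b \<cdot> (dom a \<cdot> b))"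
    using a b by (simp add: ran_def dom_def assoc)
  also have "\<dots> = a \<cdot> dom a \<cdot> (ran b \<cdot> b)"
    using a b by (simp add: idem_left_comm[of "ran b" "dom a" b] assoc del: mult_dom_self)
  finally show "a \<cdot> b \<cdot> (inverse b \<cdot> inverse a) \<cdot> (a \<cdot> b) = a \<cdot> b" using a b by simp
  have "inverse b \<cdot> inverse a \<cdot> (a \<cdot> b) \<cdot> (inverse b \<cdot> inverse a)
      = inverse b \<cdot> (dom a \<cdot> (ran b \<cdot> inverse a))"
    using a b by (simp add: ran_def dom_def assoc)
  also have "\<dots> = (inverse b \<cdot> ran b) \<cdot> (dom a \<cdot> inverse a)"
    using a b by (simp add: idem_left_comm[of "dom a" "ran b" "inverse a"] assoc)
  also have "\<dots> = inverse b \<cdot> inverse a"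
    using a b mult_dom_self[of "inverse b"] ran_mult_self[of "inverse a"] by simp
  finally show "inverse b \<cdot> inverse a \<cdot> (a \<cdot> b) \<cdot> (inverse b \<cdot> inverse a) = inverse b \<cdot> inverse a" .
qed (use a b in auto)

lemma conj_ran: "a \<in> S \<Longrightarrow> b \<in> S \<Longrightarrow> a \<cdot> ran b \<cdot> inverse a = ran (a \<cdot> b)"
  by (simp add: ran_def inverse_mult assoc)

lemma conj_idem: "a \<in> S \<Longrightarrow> e \<in> E \<Longrightarrow> a \<cdot> e \<cdot> inverse a = ran (a \<cdot> e)"
  using conj_ran[of a e] by simp

lemma conj_idem_mult:
  assumes "a \<in> S" "e \<in> E"
  shows "ran (a \<cdot> e) \<cdot> a = a \<cdot> e"
proof -
  have "ran (a \<cdot> e) \<cdot> a = a \<cdot> (e \<cdot> dom a)"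
    using assms by (simp add: dom_def assoc flip: conj_idem)
  also have "\<dots> = a \<cdot> e"
    using assms by (simp add: idem_comm[of e "dom a"] flip: assoc)
  finally show ?thesis .
qed

lemma ran_idem_mult:
  assumes "a \<in> S" "e \<in> E"
  shows "ran (e \<cdot> a) = e \<cdot> ran a"
proof -
  have "ran (e \<cdot> a) = e \<cdot> (ran a \<cdot> e)" using assms by (simp add: assoc flip: conj_ran)
  also have "\<dots> = e \<cdot> ran a" using assms by (simp add: idem_comm[of "ran a" e])
  finally show ?thesis .
qed

lemma dom_mult_idem:
  assumes "a \<in> S" "e \<in> E"
  shows "dom (a \<cdot> e) = dom a \<cdot> e"
  using ran_idem_mult[of "inverse a" e] ran_inverse[of "a \<cdot> e"] assms
  by (simp add: inverse_mult idem_comm)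

lemma ran_mult_ran: "a \<in> S \<Longrightarrow> b \<in> S \<Longrightarrow> ran (a \<cdot> ran b) = ran (a \<cdot> b)"
  by (simp flip: conj_ran)

lemma ran_mult_composable: "a \<in> S \<Longrightarrow> b \<in> S \<Longrightarrow> dom a = ran b \<Longrightarrow> ran (a \<cdot> b) = ran a"
  by (metis mult_dom_self ran_mult_ran)

lemma dom_mult_composable: "a \<in> S \<Longrightarrow> b \<in> S \<Longrightarrow> dom a = ran b \<Longrightarrow> dom (a \<cdot> b) = dom b"
  using ran_mult_composable[of "inverse b" "inverse a"] ran_inverse[of "a \<cdot> b"]
  by (simp add: inverse_mult)

lemma ran_mult_ran_mult [simp]: "a \<in> S \<Longrightarrow> b \<in> S \<Longrightarrow> ran a \<cdot> ran (a \<cdot> b) = ran (a \<cdot> b)"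
  using ran_idem_mult[of "a \<cdot> b" "ran a"] by (simp flip: assoc)

subsection \<open>The minimum group congruence\<close>

abbreviation cls :: "'a \<Rightarrow> 'a set" where "cls \<equiv> sig_cls S m"
abbreviation G :: "'a set monoid" where "G \<equiv> maxgrp S m"

lemma mem_cls_iff: "t \<in> cls s \<longleftrightarrow> t \<in> S \<and> (\<exists>e\<in>E. e \<cdot> s = e \<cdot> t)"
  by (simp add: sig_cls_def)

lemma mem_cls_self [simp, intro]: "s \<in> S \<Longrightarrow> s \<in> cls s"
  using ran_mem_E by (auto simp: mem_cls_iff)

lemma cls_sym: "s \<in> S \<Longrightarrow> t \<in> cls s \<Longrightarrow> s \<in> cls t"
  unfolding mem_cls_iff by metis

lemma cls_trans:
  assumes "s \<in> S" "t \<in> cls s" "u \<in> cls t"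
  shows "u \<in> cls s"
proof -
  obtain e f where ef: "e \<in> E" "f \<in> E" "e \<cdot> s = e \<cdot> t" "f \<cdot> t = f \<cdot> u" "t \<in> S" "u \<in> S"
    using assms by (auto simp: mem_cls_iff)
  have "f \<cdot> e \<cdot> s = f \<cdot> (e \<cdot> t)" using ef assms(1) by (simp add: assoc)
  also have "\<dots> = e \<cdot> (f \<cdot> t)" using ef by (simp add: idem_left_comm)
  also have "\<dots> = f \<cdot> e \<cdot> u" using ef by (simp add: idem_left_comm[of e f] assoc)
  finally show ?thesis using ef by (auto simp: mem_cls_iff)
qed

lemma cls_eq_iff: "s \<in> S \<Longrightarrow> t \<in> S \<Longrightarrow> cls t = cls s \<longleftrightarrow> t \<in> cls s"
  by (metis cls_sym cls_trans mem_cls_iff mem_cls_self subsetI subset_antisym)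

lemma cls_eqI: "s \<in> S \<Longrightarrow> t \<in> S \<Longrightarrow> e \<in> E \<Longrightarrow> e \<cdot> s = e \<cdot> t \<Longrightarrow> cls t = cls s"
  by (auto simp: cls_eq_iff mem_cls_iff)

lemma cls_mult_cong:
  assumes "s \<in> S" "t \<in> S" "s' \<in> S" "t' \<in> S" and "cls s' = cls s" "cls t' = cls t"
  shows "cls (s' \<cdot> t') = cls (s \<cdot> t)"
proof -
  obtain e f where e: "e \<in> E" "e \<cdot> s = e \<cdot> s'" and f: "f \<in> E" "f \<cdot> t = f \<cdot> t'"
    using assms by (auto simp: cls_eq_iff mem_cls_iff)
  have "e \<cdot> (s \<cdot> t) = e \<cdot> (s' \<cdot> t)" using e assms by (simp flip: assoc)
  then have left: "cls (s' \<cdot> t) = cls (s \<cdot> t)" using e assms by (intro cls_eqI) auto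
  have "ran (s' \<cdot> f) \<cdot> (s' \<cdot> r) = s' \<cdot> (f \<cdot> r)" if "r \<in> S" for r
  proof -
    have "ran (s' \<cdot> f) \<cdot> (s' \<cdot> r) = ran (s' \<cdot> f) \<cdot> s' \<cdot> r" using f assms that by (simp add: assoc)
    also have "\<dots> = s' \<cdot> (f \<cdot> r)" using f assms that by (simp only: conj_idem_mult assoc idem_closed)
    finally show ?thesis .
  qed
  then have "ran (s' \<cdot> f) \<cdot> (s' \<cdot> t) = ran (s' \<cdot> f) \<cdot> (s' \<cdot> t')"
    using f assms by simp
  then have "cls (s' \<cdot> t') = cls (s' \<cdot> t)" using f assms by (intro cls_eqI) auto
  with left show ?thesis by simp
qed

lemma idem_mult_cls [simp]: "s \<in> S \<Longrightarrow> e \<in> E \<Longrightarrow> cls (e \<cdot> s) = cls s"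
  by (rule cls_eqI[of _ _ e]) auto

lemma mult_idem_cls [simp]: "s \<in> S \<Longrightarrow> e \<in> E \<Longrightarrow> cls (s \<cdot> e) = cls s"
  using idem_mult_cls[of s "ran (s \<cdot> e)"] by (simp add: conj_idem_mult)

lemma idem_cls_eq: "e \<in> E \<Longrightarrow> f \<in> E \<Longrightarrow> cls e = cls f"
  by (metis idem_closed idem_mult_cls mult_idem_cls)

lemma carrier_G: "carrier G = cls ` S"
  by (simp add: maxgrp_def)

lemma cls_carrier [simp, intro]: "s \<in> S \<Longrightarrow> cls s \<in> carrier G"
  by (simp add: carrier_G)

lemma mem_class_iff:
  assumes "x \<in> carrier G"
  shows "s \<in> x \<longleftrightarrow> s \<in> S \<and> x = cls s"
proof -
  obtain r where "r \<in> S" "x = cls r" using assms by (auto simp: carrier_G)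
  then show ?thesis using cls_eq_iff[of r s] mem_cls_iff[of s r] by auto
qed

lemma cls_mult_cls [simp]:
  assumes s: "s \<in> S" and t: "t \<in> S"
  shows "cls s \<otimes>\<^bsub>G\<^esub> cls t = cls (s \<cdot> t)"
proof -
  define s' t' where "s' = (SOME s'. s' \<in> cls s)" and "t' = (SOME t'. t' \<in> cls t)"
  have "s' \<in> cls s" "t' \<in> cls t" using s t unfolding s'_def t'_def by (auto intro: someI)
  then have "cls (s' \<cdot> t') = cls (s \<cdot> t)"
    using s t by (intro cls_mult_cong) (auto simp: mem_cls_iff cls_eq_iff)
  then show ?thesis by (simp add: maxgrp_def s'_def t'_def)
qed

lemma idem_exists: "\<exists>e. e \<in> E"
  using nonempty ran_mem_E by blast

lemma one_eq_cls: "e \<in> E \<Longrightarrow> \<one>\<^bsub>G\<^esub> = cls e"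
  unfolding maxgrp_def using idem_cls_eq[OF someI_ex[OF idem_exists]] by simp

lemma cls_inverse_mult_cls: "s \<in> S \<Longrightarrow> cls (inverse s) \<otimes>\<^bsub>G\<^esub> cls s = \<one>\<^bsub>G\<^esub>"
  by (simp add: one_eq_cls[of "dom s"]) (simp add: dom_def)

lemma group_maxgrp: "group G"
proof (rule groupI)
  obtain e where e: "e \<in> E" using idem_exists by blast
  show "\<one>\<^bsub>G\<^esub> \<in> carrier G" using e by (auto simp: one_eq_cls)
  show "x \<otimes>\<^bsub>G\<^esub> y \<in> carrier G" if "x \<in> carrier G" "y \<in> carrier G" for x y
    using that by (auto simp: carrier_G)
  show "x \<otimes>\<^bsub>G\<^esub> y \<otimes>\<^bsub>G\<^esub> z = x \<otimes>\<^bsub>G\<^esub> (y \<otimes>\<^bsub>G\<^esub> z)"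
    if "x \<in> carrier G" "y \<in> carrier G" "z \<in> carrier G" for x y z
    using that by (auto simp: carrier_G assoc)
  show "\<one>\<^bsub>G\<^esub> \<otimes>\<^bsub>G\<^esub> x = x" if "x \<in> carrier G" for x
    using that e by (auto simp: carrier_G one_eq_cls[OF e])
  show "\<exists>y\<in>carrier G. y \<otimes>\<^bsub>G\<^esub> x = \<one>\<^bsub>G\<^esub>" if "x \<in> carrier G" for x
    using that cls_inverse_mult_cls unfolding carrier_G by blast
qed

sublocale G: group G
  by (rule group_maxgrp)

lemma inv_cls [simp]: "s \<in> S \<Longrightarrow> inv\<^bsub>G\<^esub> cls s = cls (inverse s)"
  by (rule G.inv_equality) (simp_all add: cls_inverse_mult_cls del: cls_mult_cls)

end

subsection \<open>\<open>E\<close>-unitary inverse semigroups\<close>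

locale E_unitary_semigroup = inv_semigroup +
  assumes E_unitary: "E_unitary S m"
begin

lemma inverse_mult_mem_E:
  assumes s: "s \<in> S" and t: "t \<in> S" and cls: "cls s = cls t"
  shows "inverse s \<cdot> t \<in> E"
proof -
  obtain e where e: "e \<in> E" "e \<cdot> s = e \<cdot> t"
    using s t cls by (metis cls_eq_iff mem_cls_iff)
  define f where "f = ran (inverse s \<cdot> e)"
  have f: "f \<in> E" using s e by (simp add: f_def)
  have f_mult: "f \<cdot> (inverse s \<cdot> a) = inverse s \<cdot> (e \<cdot> a)" if "a \<in> S" for a
  proof -
    have "f \<cdot> (inverse s \<cdot> a) = f \<cdot> inverse s \<cdot> a" using s that f by (simp add: assoc)
    then show ?thesis using s e that by (simp add: f_def conj_idem_mult assoc)
  qed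
  have "f = inverse s \<cdot> (e \<cdot> s)" using conj_idem[of "inverse s" e] s e by (simp add: f_def assoc)
  also have "\<dots> = f \<cdot> (inverse s \<cdot> t)" using f_mult e t by simp
  finally have "nat_le S m f (inverse s \<cdot> t)" using f by (auto simp: nat_le_def)
  then show ?thesis
    using E_unitary f closed[OF inverse_closed[OF s] t] unfolding E_unitary_def by blast
qed

lemma eq_if_cls_ran_eq:
  assumes s: "s \<in> S" and t: "t \<in> S" and cls: "cls s = cls t" and ran: "ran s = ran t"
  shows "s = t"
proof -
  define p where "p = inverse s \<cdot> t"
  have p: "p \<in> E" using s t cls by (simp add: p_def inverse_mult_mem_E)
  have "s \<cdot> p = ran s \<cdot> t" using s t by (simp add: p_def ran_def assoc)
  then have "t = s \<cdot> p" using ran t by simp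
  then have "ran t \<cdot> s = t" using s p by (simp add: conj_idem_mult)
  then show ?thesis using s ran by (metis ran_mult_self)
qed

lemma eq_if_cls_dom_eq:
  assumes "s \<in> S" "t \<in> S" "cls s = cls t" "dom s = dom t"
  shows "s = t"
proof -
  have "cls (inverse s) = cls (inverse t)" using assms by (metis inv_cls)
  then have "inverse s = inverse t" using assms by - (rule eq_if_cls_ran_eq, simp_all)
  then show ?thesis using assms by (metis inverse_inverse)
qed

lemma mult_dom_commute:
  assumes "s \<in> S" "t \<in> S" "cls s = cls t"
  shows "s \<cdot> dom t = t \<cdot> dom s"
  using assms by - (rule eq_if_cls_dom_eq, simp_all add: dom_mult_idem idem_comm)

lemma ran_mult_commute:
  assumes "s \<in> S" "t \<in> S" "cls s = cls t"
  shows "ran t \<cdot> s = ran s \<cdot> t"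
  using assms by - (rule eq_if_cls_ran_eq, simp_all add: ran_idem_mult idem_comm)

lemma mult_dom_eq_ran_mult:
  assumes "s \<in> S" "t \<in> S" "cls s = cls t"
  shows "s \<cdot> dom t = ran t \<cdot> s"
proof -
  have "s \<cdot> dom t = ran t \<cdot> t \<cdot> dom s" using assms by (simp add: mult_dom_commute[of s t])
  also have "\<dots> = ran t \<cdot> (s \<cdot> dom t)"
    using assms by (simp only: assoc mult_dom_commute[of s t] dom_mem_E ran_mem_E idem_closed)
  also have "\<dots> = ran s \<cdot> t \<cdot> dom t"
    using assms by (simp only: ran_mult_commute[of s t] dom_mem_E ran_mem_E idem_closed flip: assoc)
  also have "\<dots> = ran t \<cdot> s" using assms by (simp add: ran_mult_commute[of s t] assoc)
  finally show ?thesis .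
qed

end

section \<open>Semilattices of groups\<close>

locale clifford_semigroup = inv_semigroup A mA
  for A :: "'b set" and mA :: "'b \<Rightarrow> 'b \<Rightarrow> 'b" (infixl "\<odot>" 70) +
  assumes idem_central: "e \<in> E \<Longrightarrow> a \<in> A \<Longrightarrow> e \<odot> a = a \<odot> e"
begin

lemma idem_central_left: "e \<in> E \<Longrightarrow> a \<in> A \<Longrightarrow> b \<in> A \<Longrightarrow> a \<odot> (e \<odot> b) = e \<odot> (a \<odot> b)"
  by (metis assoc idem_central idem_closed)

lemma dom_eq_ran [simp]:
  assumes a: "a \<in> A"
  shows "dom a = ran a"
proof -
  have "ran a = a \<odot> dom a \<odot> inverse a" using a by (simp add: ran_def)
  also have "\<dots> = dom a \<odot> (a \<odot> inverse a)"
    using a by (metis assoc dom_mem_E idem_central_left idem_closed inverse_closed)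
  finally have ran: "ran a = dom a \<odot> ran a" by (simp only: ran_def)
  have "dom a = inverse a \<odot> (ran a \<odot> a)" using a by (simp add: dom_def)
  also have "\<dots> = ran a \<odot> (inverse a \<odot> a)"
    using a by (simp only: idem_central_left[of "ran a" "inverse a" a] ran_mem_E inverse_closed)
  finally have "dom a = ran a \<odot> dom a" by (simp only: dom_def)
  then show ?thesis using a ran by (metis dom_mem_E idem_comm ran_mem_E)
qed

lemma mult_inverse [simp]: "a \<in> A \<Longrightarrow> a \<odot> inverse a = ran a"
  by (simp add: ran_def)

lemma inverse_mult_self [simp]: "a \<in> A \<Longrightarrow> inverse a \<odot> a = ran a"
  by (metis dom_def dom_eq_ran)

lemma mult_ran_self [simp]: "a \<in> A \<Longrightarrow> a \<odot> ran a = a"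
  by (metis dom_eq_ran mult_dom_self)

lemma ran_mult:
  assumes "a \<in> A" "b \<in> A"
  shows "ran (a \<odot> b) = ran a \<odot> ran b"
proof -
  have "ran (a \<odot> b) = a \<odot> (ran b \<odot> inverse a)" using assms by (simp add: assoc flip: conj_ran)
  also have "\<dots> = ran b \<odot> (a \<odot> inverse a)"
    using assms by (simp only: idem_central_left[of "ran b" a "inverse a"] ran_mem_E inverse_closed)
  finally show ?thesis using assms by (simp add: idem_comm)
qed

lemma mem_Agrp_iff: "a \<in> Agrp A mA e \<longleftrightarrow> a \<in> A \<and> ran a = e"
  unfolding Agrp_def by auto

lemma idem_mult_eq_iff: "e \<in> E \<Longrightarrow> a \<in> A \<Longrightarrow> e \<odot> a = a \<longleftrightarrow> e \<odot> ran a = ran a"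
  by (metis assoc idem_closed ran_idem_mult ran_mem_E ran_mult_self)

definition conjugate :: "'b \<Rightarrow> 'b \<Rightarrow> 'b" where "conjugate c a = c \<odot> a \<odot> inverse c"

lemma conjugate_closed [simp, intro]: "a \<in> A \<Longrightarrow> c \<in> A \<Longrightarrow> conjugate c a \<in> A"
  by (simp add: conjugate_def)

lemma ran_conjugate: "a \<in> A \<Longrightarrow> c \<in> A \<Longrightarrow> ran (conjugate c a) = ran c \<odot> ran a"
  by (simp add: conjugate_def ran_mult idem_comm[of "ran c \<odot> ran a" "ran c"])

lemma idem_conjugate: "e \<in> E \<Longrightarrow> a \<in> A \<Longrightarrow> e \<odot> a = a \<Longrightarrow> conjugate e a = a"
  using idem_central[of e a] by (simp add: conjugate_def)

lemma conjugate_idem: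
  assumes "e \<in> E" "c \<in> A" "ran c \<odot> e = e"
  shows "conjugate c e = e"
  using assms by (metis assoc conjugate_def idem_central idem_closed inverse_closed mult_inverse)

lemma conjugate_conjugate_inverse:
  assumes "a \<in> A" "c \<in> A" "ran c \<odot> a = a"
  shows "conjugate c (conjugate (inverse c) a) = a"
proof -
  have "conjugate c (conjugate (inverse c) a) = c \<odot> inverse c \<odot> a \<odot> (c \<odot> inverse c)"
    using assms(1,2) by (simp only: conjugate_def assoc closed inverse_closed inverse_inverse)
  then show ?thesis using assms idem_central[of "ran c" a] by simp
qed

lemma conjugate_inject:
  assumes "a \<in> A" "b \<in> A" "c \<in> A" "ran c \<odot> a = a" "ran c \<odot> b = b" "conjugate c a = conjugate c b"
  shows "a = b"
  using assms conjugate_conjugate_inverse[of _ "inverse c"] by (metis dom_eq_ran inverse_closed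
    inverse_inverse ran_inverse)

lemma conjugate_restrict:
  assumes "a \<in> A" "c \<in> A" "e \<in> E" "e \<odot> a = a"
  shows "conjugate (c \<odot> e) a = conjugate c a"
proof -
  have "conjugate (c \<odot> e) a = c \<odot> (e \<odot> (a \<odot> (e \<odot> inverse c)))"
    using assms(1-3) by (simp add: conjugate_def inverse_mult assoc)
  also have "\<dots> = c \<odot> (e \<odot> a \<odot> inverse c)"
    using assms(1-3) by (simp add: assoc idem_central_left[of e a])
  finally show ?thesis using assms by (simp add: conjugate_def assoc)
qed

subsection \<open>Ideals and homomorphisms\<close>

abbreviation ideal :: "'b set \<Rightarrow> bool" where "ideal \<equiv> is_ideal A mA"

lemma ideal_sub: "ideal I \<Longrightarrow> a \<in> I \<Longrightarrow> a \<in> A"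
  by (auto simp: is_ideal_def)

lemma ideal_left: "ideal I \<Longrightarrow> a \<in> A \<Longrightarrow> b \<in> I \<Longrightarrow> a \<odot> b \<in> I"
  by (auto simp: is_ideal_def)

lemma ideal_right: "ideal I \<Longrightarrow> a \<in> I \<Longrightarrow> b \<in> A \<Longrightarrow> a \<odot> b \<in> I"
  by (auto simp: is_ideal_def)

lemma ideal_carrier: "ideal A"
  using nonempty by (simp add: is_ideal_def)

lemma ideal_ran_iff:
  assumes "ideal I" "a \<in> A"
  shows "ran a \<in> I \<longleftrightarrow> a \<in> I"
  using ideal_right[OF assms(1), of "ran a" a] ideal_right[OF assms(1), of a "inverse a"] assms(2)
  by auto

lemma ideal_inverse: "ideal I \<Longrightarrow> a \<in> I \<Longrightarrow> inverse a \<in> I"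
  using ideal_ran_iff[of I a] ideal_ran_iff[of I "inverse a"] ideal_sub by simp

lemma ideal_idem_exists:
  assumes "ideal I"
  shows "\<exists>e\<in>I. e \<in> E"
proof -
  obtain a where "a \<in> I" using assms by (auto simp: is_ideal_def)
  then have "ran a \<in> I" "ran a \<in> E" using assms ideal_ran_iff ideal_sub by auto
  then show ?thesis by blast
qed

lemma mem_idems_ideal_iff: "ideal I \<Longrightarrow> e \<in> idems I mA \<longleftrightarrow> e \<in> I \<and> e \<in> E"
  using ideal_sub unfolding idems_def by blast

lemma ideal_inter:
  assumes "ideal I" "ideal J"
  shows "ideal (I \<inter> J)"
proof -
  obtain a b where "a \<in> I" "b \<in> J" using assms by (auto simp: is_ideal_def)
  then have "a \<odot> b \<in> I \<inter> J" using assms ideal_left ideal_right ideal_sub by blast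
  then show ?thesis using assms unfolding is_ideal_def by blast
qed

lemma setprod_ideal:
  assumes "ideal I" "ideal J"
  shows "setprod mA I J = I \<inter> J"
proof (intro equalityI subsetI)
  fix a assume "a \<in> setprod mA I J"
  then show "a \<in> I \<inter> J"
    unfolding setprod_def using assms ideal_left ideal_right ideal_sub by blast
next
  fix a assume "a \<in> I \<inter> J"
  then have "a = a \<odot> ran a" "a \<in> I" "ran a \<in> J"
    using assms ideal_sub ideal_ran_iff by auto
  then show "a \<in> setprod mA I J" unfolding setprod_def by blast
qed

definition hom_on :: "'b set \<Rightarrow> ('b \<Rightarrow> 'b) \<Rightarrow> bool" where
  "hom_on I h \<longleftrightarrow> (\<forall>a\<in>I. h a \<in> A) \<and> (\<forall>a\<in>I. \<forall>b\<in>I. h (a \<odot> b) = h a \<odot> h b)"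

lemma endo_iff_hom_on: "endo A mA h \<longleftrightarrow> hom_on A h"
  by (simp add: endo_def hom_on_def)

lemma hom_on_closed: "hom_on I h \<Longrightarrow> a \<in> I \<Longrightarrow> h a \<in> A"
  and hom_on_mult: "hom_on I h \<Longrightarrow> a \<in> I \<Longrightarrow> b \<in> I \<Longrightarrow> h (a \<odot> b) = h a \<odot> h b"
  by (auto simp: hom_on_def)

lemma hom_on_idem: "hom_on I h \<Longrightarrow> e \<in> I \<Longrightarrow> e \<in> E \<Longrightarrow> h e \<in> E"
  by (metis hom_on_closed hom_on_mult idemI idem_mult_self)

lemma hom_on_inverse:
  assumes I: "ideal I" and h: "hom_on I h" and a: "a \<in> I"
  shows "h (inverse a) = inverse (h a)"
proof -
  have mem: "a \<in> A" "inverse a \<in> I" "inverse a \<odot> a \<in> I" "a \<odot> inverse a \<in> I"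
    using I a ideal_sub ideal_inverse ideal_right inverse_closed by blast+
  have "inverse (h a) = h (inverse a)"
  proof (rule inverse_eqI)
    show "h a \<odot> h (inverse a) \<odot> h a = h a"
      using h a mem mult_inverse_mult[of a]
      by (simp del: mult_inverse inverse_mult_self flip: hom_on_mult[OF h])
    show "h (inverse a) \<odot> h a \<odot> h (inverse a) = h (inverse a)"
      using h a mem inverse_mult_inverse[of a]
      by (simp del: mult_inverse inverse_mult_self flip: hom_on_mult[OF h])
  qed (use h a mem hom_on_closed in auto)
  then show ?thesis by simp
qed

lemma hom_on_ran:
  assumes "ideal I" "hom_on I h" "a \<in> I"
  shows "ran (h a) = h (ran a)"
  using assms hom_on_mult[OF assms(2,3) ideal_inverse[OF assms(1,3)]] ideal_sub
  by (simp add: hom_on_closed hom_on_inverse)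

lemma hom_on_the_inv_into:
  assumes I: "ideal I" and h: "hom_on I h" and bij: "bij_betw h I J"
  shows "hom_on J (the_inv_into I h)"
  unfolding hom_on_def
proof (intro conjI ballI)
  let ?k = "the_inv_into I h"
  have k: "?k b \<in> I" "h (?k b) = b" if "b \<in> J" for b
    using that bij_betwE[OF bij_betw_the_inv_into[OF bij]] f_the_inv_into_f_bij_betw[OF bij] by auto
  show "?k b \<in> A" if "b \<in> J" for b using k that I ideal_sub by blast
  fix b c assume b: "b \<in> J" and c: "c \<in> J"
  have "?k b \<odot> ?k c \<in> I" using b c k I ideal_sub ideal_right by blast
  moreover have "h (?k b \<odot> ?k c) = b \<odot> c" using b c k h by (simp add: hom_on_mult)
  ultimately show "?k (b \<odot> c) = ?k b \<odot> ?k c"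
    using bij by (metis bij_betw_imp_inj_on the_inv_into_f_f)
qed

definition restr :: "('b \<Rightarrow> 'b) \<Rightarrow> 'b \<Rightarrow> 'b \<Rightarrow> 'b" where "restr h k a = h (k \<odot> a)"

context
  fixes I h k
  assumes I: "ideal I" and h: "hom_on I h" and k: "k \<in> I" "k \<in> E"
begin

lemma restr_absorb:
  assumes a: "a \<in> A"
  shows "h k \<odot> restr h k a = restr h k a"
proof -
  have "k \<odot> a \<in> I" using I k a by (simp add: ideal_right)
  then show ?thesis using h k a by (simp add: restr_def flip: hom_on_mult)
qed

lemma restr_endo: "endo A mA (restr h k)"
  unfolding endo_iff_hom_on hom_on_def
proof (intro conjI ballI)
  have mem: "k \<odot> a \<in> I" if "a \<in> A" for a using I k that by (simp add: ideal_right)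
  show "restr h k a \<in> A" if "a \<in> A" for a using h mem that by (simp add: restr_def hom_on_closed)
  fix a b assume a: "a \<in> A" and b: "b \<in> A"
  have "k \<odot> (a \<odot> b) = k \<odot> a \<odot> (k \<odot> b)"
    using k a b by (simp add: assoc idem_central_left[of k a b])
  then show "restr h k (a \<odot> b) = restr h k a \<odot> restr h k b"
    using h mem a b by (simp add: restr_def hom_on_mult)
qed

lemma restr_identity: "is_identity_of (restr h k ` A) mA (h k)"
  unfolding is_identity_of_def
proof (intro conjI ballI)
  show "h k \<in> restr h k ` A" using k by (intro image_eqI[of _ _ k]) (auto simp: restr_def)
  fix b assume "b \<in> restr h k ` A"
  then obtain a where a: "a \<in> A" "b = restr h k a" by blast
  then show "h k \<odot> b = b" by (simp add: restr_absorb)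
  moreover have "b \<in> A" using a restr_endo by (simp add: endo_def)
  ultimately show "b \<odot> h k = b" using idem_central[of "h k" b] h k by (simp add: hom_on_idem)
qed

end

lemma restr_rel_invertible:
  assumes I: "ideal I" and J: "ideal J" and h: "hom_on I h" and bij: "bij_betw h I J"
    and k: "k \<in> I" "k \<in> E"
  shows "rel_invertible A mA (restr h k)"
proof -
  define h' where "h' = the_inv_into I h"
  have h': "hom_on J h'" unfolding h'_def using I h bij by (rule hom_on_the_inv_into)
  have h'_h: "h' (h a) = a" if "a \<in> I" for a
    using that bij by (simp add: h'_def bij_betw_imp_inj_on the_inv_into_f_f)
  have h_h': "h (h' b) = b" if "b \<in> J" for b
    using that bij by (simp add: h'_def f_the_inv_into_f_bij_betw)
  have hk: "h k \<in> J" "h k \<in> E" using bij h k by (auto simp: bij_betwE hom_on_idem)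
  have "restr h' (h k) (restr h k a) = k \<odot> a" if "a \<in> A" for a
    using I k that restr_absorb[OF I h k that] h'_h[of "k \<odot> a"] by (simp add: restr_def ideal_right)
  moreover have "restr h k (restr h' (h k) b) = restr h k k \<odot> b" if "b \<in> A" for b
    using J k hk that restr_absorb[OF J h' hk that] h'_h[of k] h_h'[of "h k \<odot> b"]
    by (simp add: restr_def ideal_right)
  moreover have "restr h k k = h k" "h' (h k) = k" using k h'_h by (simp_all add: restr_def)
  ultimately show ?thesis unfolding rel_invertible_def
    using restr_endo[OF I h k] restr_endo[OF J h' hk] k
      restr_identity[OF I h k] restr_identity[OF J h' hk]
    by (intro conjI exI[of _ "restr h' (h k)"] exI[of _ k]) auto
qed

subsection \<open>Unit multipliers of ideals\<close>

definition group_section :: "'b set \<Rightarrow> ('b \<Rightarrow> 'b) \<Rightarrow> bool" where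
  "group_section T c \<longleftrightarrow>
     (\<forall>e\<in>T. e \<in> E \<longrightarrow> c e \<in> A \<and> ran (c e) = e \<and> (\<forall>f\<in>E. c (e \<odot> f) = c e \<odot> f))"

lemma group_section_closed: "group_section T c \<Longrightarrow> e \<in> T \<Longrightarrow> e \<in> E \<Longrightarrow> c e \<in> A"
  and ran_group_section: "group_section T c \<Longrightarrow> e \<in> T \<Longrightarrow> e \<in> E \<Longrightarrow> ran (c e) = e"
  and group_section_restrict:
    "group_section T c \<Longrightarrow> e \<in> T \<Longrightarrow> e \<in> E \<Longrightarrow> f \<in> E \<Longrightarrow> c (e \<odot> f) = c e \<odot> f"
  by (auto simp: group_section_def)

lemma group_section_inverse: "group_section T c \<Longrightarrow> group_section T (\<lambda>e. inverse (c e))"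
  unfolding group_section_def by (auto simp: inverse_mult intro: idem_central)

lemma conjugate_group_section:
  assumes c: "group_section T c" and e: "e \<in> T" "e \<in> E" and a: "a \<in> A" "e \<odot> a = a"
  shows "conjugate (c (ran a)) a = conjugate (c e) a"
proof -
  have "ran a = e \<odot> ran a" using e a idem_mult_eq_iff by metis
  also have "c (e \<odot> ran a) = c e \<odot> ran a" using c e a by (simp add: group_section_restrict)
  finally show ?thesis using c e a by (simp add: conjugate_restrict group_section_closed)
qed

definition mult_of :: "('b \<Rightarrow> 'b) \<Rightarrow> ('b \<Rightarrow> 'b) \<times> ('b \<Rightarrow> 'b)" where
  "mult_of c = (\<lambda>a. c (ran a) \<odot> a, \<lambda>a. a \<odot> c (ran a))"

lemma mult_of_multiplier:
  assumes T: "ideal T" and c: "group_section T c"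
  shows "is_multiplier T mA (mult_of c)"
  unfolding is_multiplier_def
proof (intro conjI ballI)
  have c_closed: "c (ran a) \<in> A" if "a \<in> T" for a
    using T c that by (meson group_section_closed ideal_ran_iff ideal_sub ran_mem_E)
  show "fst (mult_of c) a \<in> T" "snd (mult_of c) a \<in> T" if "a \<in> T" for a
    using T that c_closed by (simp_all add: mult_of_def ideal_left ideal_right)
  fix a b assume a: "a \<in> T" and b: "b \<in> T"
  have mem: "a \<in> A" "b \<in> A" "c (ran a) \<in> A" "c (ran b) \<in> A"
    using T a b c_closed ideal_sub by auto
  have left: "c (ran (a \<odot> b)) = c (ran a) \<odot> ran b"
    using T c a mem by (simp add: ran_mult group_section_restrict ideal_ran_iff)
  have "c (ran (a \<odot> b)) = c (ran b \<odot> ran a)"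
    using mem by (simp add: ran_mult idem_comm[of "ran a"])
  also have "\<dots> = c (ran b) \<odot> ran a"
    using T c b mem by (simp add: group_section_restrict ideal_ran_iff)
  also have "\<dots> = ran a \<odot> c (ran b)" using mem by (simp add: idem_central[of "ran a" "c (ran b)"])
  finally have right: "c (ran (a \<odot> b)) = ran a \<odot> c (ran b)" .
  show "fst (mult_of c) (a \<odot> b) = fst (mult_of c) a \<odot> b"
    using mem left by (simp add: mult_of_def assoc idem_central_left[of "ran b" a b, symmetric])
  show "snd (mult_of c) (a \<odot> b) = a \<odot> snd (mult_of c) b"
    using mem right by (simp add: mult_of_def assoc idem_central_left[of "ran a" b])
      (simp flip: assoc)
  have "a \<odot> (c (ran b) \<odot> b) = a \<odot> (ran a \<odot> c (ran b)) \<odot> b" using mem by (simp flip: assoc)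
  also have "\<dots> = a \<odot> c (ran a) \<odot> b" using mem left right by (simp add: assoc)
  finally show "a \<odot> fst (mult_of c) b = snd (mult_of c) a \<odot> b" by (simp add: mult_of_def)
qed

lemma mult_of_inverse:
  assumes T: "ideal T" and c: "group_section T c"
  shows "mult_inverse T mA (mult_of c) (mult_of (\<lambda>e. inverse (c e)))"
  unfolding mult_inverse_def
proof (intro conjI ballI)
  show "is_multiplier T mA (mult_of c)" "is_multiplier T mA (mult_of (\<lambda>e. inverse (c e)))"
    using T c group_section_inverse by (auto intro: mult_of_multiplier)
  fix a assume a: "a \<in> T"
  define d where "d = c (ran a)"
  have mem: "a \<in> A" "d \<in> A" and ran_d: "ran d = ran a"
    using T c a group_section_closed ran_group_section ideal_ran_iff ideal_sub by (auto simp: d_def)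
  show "fst (mult_of c) (fst (mult_of (\<lambda>e. inverse (c e))) a) = a"
    "fst (mult_of (\<lambda>e. inverse (c e))) (fst (mult_of c) a) = a"
    "snd (mult_of c) (snd (mult_of (\<lambda>e. inverse (c e))) a) = a"
    "snd (mult_of (\<lambda>e. inverse (c e))) (snd (mult_of c) a) = a"
    using mem ran_d by (simp_all add: mult_of_def ran_mult assoc flip: d_def)
      (simp_all add: ran_d flip: assoc)
qed

lemma multiplier_closed:
    "is_multiplier T mA w \<Longrightarrow> a \<in> T \<Longrightarrow> fst w a \<in> T" "is_multiplier T mA w \<Longrightarrow> a \<in> T \<Longrightarrow> snd w a \<in> T"
  and multiplier_mult:
    "is_multiplier T mA w \<Longrightarrow> a \<in> T \<Longrightarrow> b \<in> T \<Longrightarrow> fst w (a \<odot> b) = fst w a \<odot> b"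
    "is_multiplier T mA w \<Longrightarrow> a \<in> T \<Longrightarrow> b \<in> T \<Longrightarrow> snd w (a \<odot> b) = a \<odot> snd w b"
    "is_multiplier T mA w \<Longrightarrow> a \<in> T \<Longrightarrow> b \<in> T \<Longrightarrow> a \<odot> fst w b = snd w a \<odot> b"
  unfolding is_multiplier_def by blast+

lemma multiplier_fst_idem:
  assumes T: "ideal T" and w: "is_multiplier T mA w" and e: "e \<in> T" "e \<in> E"
  shows "fst w e = snd w e"
proof -
  have mem: "fst w e \<in> A" "snd w e \<in> A" using T w e multiplier_closed ideal_sub by blast+
  note mult = multiplier_mult[OF w e(1) e(1)]
  have "fst w e = e \<odot> fst w e" using mult(1) e mem by (simp add: idem_central[of e "fst w e"])
  also have "\<dots> = e \<odot> snd w e" using mult(3) e mem by (simp add: idem_central[of e "snd w e"])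
  finally show ?thesis using mult(2) e by simp
qed

lemma multiplier_eq:
  assumes T: "ideal T" and w: "is_multiplier T mA w" and a: "a \<in> T"
  shows "fst w a = snd w (ran a) \<odot> a" and "snd w a = a \<odot> snd w (ran a)"
proof -
  have mem: "a \<in> A" "ran a \<in> T" using T a ideal_ran_iff ideal_sub by auto
  have "fst w (ran a \<odot> a) = fst w (ran a) \<odot> a" using w a mem by (intro multiplier_mult)
  then show "fst w a = snd w (ran a) \<odot> a"
    using mem multiplier_fst_idem[OF T w, of "ran a"] by simp
  have "snd w (a \<odot> ran a) = a \<odot> snd w (ran a)" using w a mem by (intro multiplier_mult)
  then show "snd w a = a \<odot> snd w (ran a)" using mem by simp
qed

lemma unit_multiplier_multiplier: "is_unit_multiplier T mA w \<Longrightarrow> is_multiplier T mA w"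
  unfolding is_unit_multiplier_def mult_inverse_def by blast

lemma unit_multiplier_group_section:
  assumes T: "ideal T" and unit: "is_unit_multiplier T mA w"
  shows "group_section T (snd w)"
  unfolding group_section_def
proof (intro conjI ballI impI)
  obtain v where wv: "mult_inverse T mA w v" using unit by (auto simp: is_unit_multiplier_def)
  then have w: "is_multiplier T mA w" and v: "is_multiplier T mA v" by (auto simp: mult_inverse_def)
  fix e assume e: "e \<in> T" "e \<in> E"
  have wT: "snd w e \<in> T" using w e by (simp add: multiplier_closed)
  then show wA: "snd w e \<in> A" using T ideal_sub by blast
  have absorb: "e \<odot> snd w e = snd w e"
    using multiplier_mult(2)[OF w e(1) e(1)] e by (metis idem_mult_self)
  show "ran (snd w e) = e"
  proof -
    define d where "d = snd v (ran (snd w e))"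
    have "ran (snd w e) \<in> T" using T wA wT by (simp add: ideal_ran_iff)
    then have d: "d \<in> A" using T v multiplier_closed ideal_sub unfolding d_def by blast
    have "e = snd v (snd w e)" using wv e by (simp add: mult_inverse_def)
    also have "\<dots> = snd w e \<odot> d" unfolding d_def using multiplier_eq(2)[OF T v wT] .
    finally have "e = ran (snd w e) \<odot> ran d" using e d wA by (metis ran_idem ran_mult)
    then have "ran (snd w e) \<odot> e = e" using d wA by (metis idem_closed idem_mult_left ran_mem_E)
    moreover have "e \<odot> ran (snd w e) = ran (snd w e)"
      using absorb e wA idem_mult_eq_iff by blast
    ultimately show ?thesis using e wA by (metis idem_comm ran_mem_E)
  qed
  fix f assume f: "f \<in> E"
  have "f \<odot> e \<in> T" using T e f by (simp add: ideal_left)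
  then have "snd w (f \<odot> e \<odot> e) = f \<odot> e \<odot> snd w e" using w e by (intro multiplier_mult)
  moreover have "f \<odot> e \<odot> e = e \<odot> f" using e f by (simp add: assoc idem_comm[of f e])
  moreover have "f \<odot> e \<odot> snd w e = snd w e \<odot> f"
    using e f wA absorb idem_central[of f "snd w e"] by (simp add: assoc)
  ultimately show "snd w (e \<odot> f) = snd w e \<odot> f" by simp
qed

lemma mult_inverse_cong:
  assumes eq: "\<And>a. a \<in> T \<Longrightarrow> fst w a = fst w' a \<and> snd w a = snd w' a" and T: "ideal T"
    and w': "mult_inverse T mA w' v"
  shows "mult_inverse T mA w v"
proof -
  have mult: "is_multiplier T mA w'" using w' by (simp add: mult_inverse_def)
  moreover have "a \<odot> b \<in> T" if "a \<in> T" "b \<in> T" for a b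
    using T that ideal_right ideal_sub by blast
  ultimately have "is_multiplier T mA w"
    unfolding is_multiplier_def[of T mA w]
    by (simp add: eq multiplier_closed[OF mult] multiplier_mult[OF mult])
  then show ?thesis using w' eq unfolding mult_inverse_def by (auto simp: multiplier_closed)
qed

lemma unit_multiplierI:
  assumes T: "ideal T" and c: "group_section T (snd w)"
    and acts: "\<And>a. a \<in> T \<Longrightarrow> fst w a = snd w (ran a) \<odot> a \<and> snd w a = a \<odot> snd w (ran a)"
  shows "is_unit_multiplier T mA w"
proof -
  have "mult_inverse T mA w (mult_of (\<lambda>e. inverse (snd w e)))"
    using acts by (intro mult_inverse_cong[OF _ T mult_of_inverse[OF T c]]) (auto simp: mult_of_def)
  then show ?thesis unfolding is_unit_multiplier_def by blast
qed

text \<open>\<open>minv\<close> picks some inverse; it is identified by uniqueness of inverses in a monoid.\<close>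
lemma snd_minv_fst:
  assumes T: "ideal T" and unit: "is_unit_multiplier T mA w" and a: "a \<in> T"
  shows "snd (minv T mA w) (fst w a) = conjugate (snd w (ran a)) a"
proof -
  note eq = multiplier_eq[OF T unit_multiplier_multiplier[OF unit]]
  define c where "c = snd w (ran a)"
  have "ran a \<in> T" "a \<in> A" using T a ideal_ran_iff ideal_sub by auto
  then have c: "c \<in> A" "ran c = ran a" "a \<in> A"
    using unit_multiplier_group_section[OF T unit]
    by (auto simp: c_def group_section_closed ran_group_section)
  define b where "b = conjugate c a"
  have ran_b: "ran b = ran a" using c by (simp add: b_def ran_conjugate)
  then have bT: "b \<in> T" using T a c ideal_ran_iff[of T b] ideal_ran_iff[of T a] by (simp add: b_def)
  have "snd w b = c \<odot> a \<odot> inverse c \<odot> c"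
    using eq(2)[OF bT] ran_b by (simp add: b_def conjugate_def c_def)
  also have "\<dots> = fst w a" using c eq(1)[OF a] by (simp add: assoc c_def)
  finally have "snd w b = fst w a" .
  moreover have "mult_inverse T mA w (minv T mA w)"
    using unit unfolding minv_def is_unit_multiplier_def by (rule someI_ex)
  ultimately show ?thesis using bT by (metis b_def c_def mult_inverse_def)
qed

end

lemma clifford_semigroupI: "semilattice_of_groups A mA \<Longrightarrow> clifford_semigroup A mA"
  unfolding semilattice_of_groups_def by unfold_locales blast+

section \<open>Sieben twisted modules\<close>

locale sieben_module = A: clifford_semigroup A mA + S: inv_semigroup S m
  for A :: "'b set" and mA :: "'b \<Rightarrow> 'b \<Rightarrow> 'b" (infixl "\<odot>" 70)
    and S :: "'a set" and m :: "'a \<Rightarrow> 'a \<Rightarrow> 'a" (infixl "\<cdot>" 70) +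
  fixes \<alpha> :: "'a \<Rightarrow> 'b" and lam :: "'a \<Rightarrow> 'b \<Rightarrow> 'b" and f :: "'a \<Rightarrow> 'a \<Rightarrow> 'b"
  assumes alpha_bij: "bij_betw \<alpha> S.E A.E"
    and alpha_mult: "p \<in> S.E \<Longrightarrow> q \<in> S.E \<Longrightarrow> \<alpha> (p \<cdot> q) = \<alpha> p \<odot> \<alpha> q"
    and lam_rel_invertible: "s \<in> S \<Longrightarrow> rel_invertible A mA (lam s)"
    and f_closed [simp, intro]: "s \<in> S \<Longrightarrow> t \<in> S \<Longrightarrow> f s t \<in> A"
    and ran_f [simp]: "s \<in> S \<Longrightarrow> t \<in> S \<Longrightarrow> A.ran (f s t) = \<alpha> (S.ran (s \<cdot> t))"
    and lam_idem: "p \<in> S.E \<Longrightarrow> a \<in> A \<Longrightarrow> lam p a = \<alpha> p \<odot> a"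
    and lam_alpha: "s \<in> S \<Longrightarrow> p \<in> S.E \<Longrightarrow> lam s (\<alpha> p) = \<alpha> (S.ran (s \<cdot> p))"
    and lam_lam: "s \<in> S \<Longrightarrow> t \<in> S \<Longrightarrow> a \<in> A \<Longrightarrow>
      lam s (lam t a) = A.conjugate (f s t) (lam (s \<cdot> t) a)"
    and f_idem_right: "s \<in> S \<Longrightarrow> p \<in> S.E \<Longrightarrow> f s p = \<alpha> (S.ran (s \<cdot> p))"
    and f_idem_left: "s \<in> S \<Longrightarrow> p \<in> S.E \<Longrightarrow> f p s = \<alpha> (S.ran (p \<cdot> s))"
    and f_cocycle: "s \<in> S \<Longrightarrow> t \<in> S \<Longrightarrow> u \<in> S \<Longrightarrow>
      lam s (f t u) \<odot> f s (t \<cdot> u) = f s t \<odot> f (s \<cdot> t) u"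
begin

lemma alpha_mem_E [simp, intro]: "p \<in> S.E \<Longrightarrow> \<alpha> p \<in> A.E"
  using alpha_bij by (meson bij_betwE)

lemma alpha_closed [simp, intro]: "p \<in> S.E \<Longrightarrow> \<alpha> p \<in> A"
  by (rule A.idem_closed) auto

lemma alpha_eq_iff [simp]: "p \<in> S.E \<Longrightarrow> q \<in> S.E \<Longrightarrow> \<alpha> p = \<alpha> q \<longleftrightarrow> p = q"
  using alpha_bij by (meson bij_betw_imp_inj_on inj_on_eq_iff)

lemma alpha_surj:
  assumes "e \<in> A.E"
  obtains p where "p \<in> S.E" "\<alpha> p = e"
  using assms alpha_bij by (metis bij_betw_imp_surj_on imageE)

lemma lam_endo: "s \<in> S \<Longrightarrow> endo A mA (lam s)"
  using lam_rel_invertible by (simp add: rel_invertible_def)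

lemma lam_closed [simp, intro]: "s \<in> S \<Longrightarrow> a \<in> A \<Longrightarrow> lam s a \<in> A"
  using lam_endo by (simp add: endo_def)

lemma lam_mult: "s \<in> S \<Longrightarrow> a \<in> A \<Longrightarrow> b \<in> A \<Longrightarrow> lam s (a \<odot> b) = lam s a \<odot> lam s b"
  using lam_endo by (simp add: endo_def)

lemma lam_ran: "s \<in> S \<Longrightarrow> a \<in> A \<Longrightarrow> A.ran (lam s a) = lam s (A.ran a)"
  using A.hom_on_ran[OF A.ideal_carrier] lam_endo A.endo_iff_hom_on by blast

lemma alpha_ran_mult: "s \<in> S \<Longrightarrow> t \<in> S \<Longrightarrow> \<alpha> (S.ran s) \<odot> \<alpha> (S.ran (s \<cdot> t)) = \<alpha> (S.ran (s \<cdot> t))"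
  by (simp flip: alpha_mult)

lemma alpha_ran_idem_mult: "s \<in> S \<Longrightarrow> p \<in> S.E \<Longrightarrow> \<alpha> (S.ran (p \<cdot> s)) = \<alpha> p \<odot> \<alpha> (S.ran s)"
  by (simp add: S.ran_idem_mult alpha_mult)

lemma f_absorb: "s \<in> S \<Longrightarrow> t \<in> S \<Longrightarrow> \<alpha> (S.ran s) \<odot> f s t = f s t"
  by (simp add: A.idem_mult_eq_iff[of _ "f s t"] alpha_ran_mult)

lemma lam_absorb:
  assumes "s \<in> S" "a \<in> A"
  shows "\<alpha> (S.ran s) \<odot> lam s a = lam s a"
proof -
  obtain p where p: "p \<in> S.E" "\<alpha> p = A.ran a" using assms alpha_surj A.ran_mem_E by blast
  then have "A.ran (lam s a) = \<alpha> (S.ran (s \<cdot> p))"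
    using assms by (simp add: lam_ran lam_alpha flip: p(2))
  then show ?thesis using assms p by (simp add: A.idem_mult_eq_iff[of _ "lam s a"] alpha_ran_mult)
qed

lemma lam_mult_idem:
  assumes "s \<in> S" "p \<in> S.E" "a \<in> A"
  shows "lam (s \<cdot> p) a = lam s (\<alpha> p \<odot> a)"
proof -
  have "lam s (lam p a) = A.conjugate (\<alpha> (S.ran (s \<cdot> p))) (lam (s \<cdot> p) a)"
    using assms by (simp add: lam_lam f_idem_right)
  also have "\<dots> = lam (s \<cdot> p) a" using assms by (intro A.idem_conjugate lam_absorb) auto
  finally show ?thesis using assms by (simp add: lam_idem)
qed

lemma lam_idem_mult:
  assumes "s \<in> S" "p \<in> S.E" "a \<in> A"
  shows "lam (p \<cdot> s) a = \<alpha> p \<odot> lam s a"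
proof -
  have "lam p (lam s a) = A.conjugate (\<alpha> (S.ran (p \<cdot> s))) (lam (p \<cdot> s) a)"
    using assms by (simp add: lam_lam f_idem_left)
  also have "\<dots> = lam (p \<cdot> s) a" using assms by (intro A.idem_conjugate lam_absorb) auto
  finally show ?thesis using assms by (simp add: lam_idem)
qed

lemma lam_dom: "s \<in> S \<Longrightarrow> a \<in> A \<Longrightarrow> lam s (\<alpha> (S.dom s) \<odot> a) = lam s a"
  by (simp flip: lam_mult_idem)

lemma lam_alpha_dom [simp]: "s \<in> S \<Longrightarrow> lam s (\<alpha> (S.dom s)) = \<alpha> (S.ran s)"
  by (simp add: lam_alpha)

lemma ran_lam: "s \<in> S \<Longrightarrow> a \<in> A \<Longrightarrow> A.ran a = \<alpha> (S.dom s) \<Longrightarrow> A.ran (lam s a) = \<alpha> (S.ran s)"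
  by (simp add: lam_ran)

lemma f_idem_mult:
  assumes "s \<in> S" "t \<in> S" "p \<in> S.E"
  shows "f (p \<cdot> s) t = \<alpha> p \<odot> f s t"
proof -
  have "lam p (f s t) \<odot> f p (s \<cdot> t) = f p s \<odot> f (p \<cdot> s) t"
    using assms by (intro f_cocycle) auto
  moreover have "f p (s \<cdot> t) = A.ran (\<alpha> p \<odot> f s t)"
    using assms by (simp add: f_idem_left alpha_ran_idem_mult A.ran_mult)
  moreover have "f p s \<odot> f (p \<cdot> s) t = f (p \<cdot> s) t"
    using assms f_absorb[of "p \<cdot> s" t] by (simp add: f_idem_left)
  ultimately show ?thesis using assms A.mult_ran_self[of "\<alpha> p \<odot> f s t"] by (simp add: lam_idem)
qed

lemma f_mult_idem:
  assumes "s \<in> S" "t \<in> S" "p \<in> S.E"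
  shows "f (s \<cdot> p) t = f s (p \<cdot> t)"
proof -
  have "lam s (f p t) \<odot> f s (p \<cdot> t) = f s p \<odot> f (s \<cdot> p) t"
    using assms by (intro f_cocycle) auto
  moreover have "lam s (f p t) = A.ran (f s (p \<cdot> t))"
    using assms by (simp add: f_idem_left lam_alpha S.ran_mult_ran)
  moreover have "f s p \<odot> f (s \<cdot> p) t = f (s \<cdot> p) t"
    using assms f_absorb[of "s \<cdot> p" t] by (simp add: f_idem_right)
  ultimately show ?thesis using assms A.ran_mult_self[of "f s (p \<cdot> t)"] by simp
qed

lemma f_dom_mult: "s \<in> S \<Longrightarrow> t \<in> S \<Longrightarrow> f s (S.dom s \<cdot> t) = f s t"
  by (simp flip: f_mult_idem)

lemma lam_inverse_lam:
  assumes "s \<in> S" "a \<in> A" "A.ran a = \<alpha> (S.dom s)"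
  shows "lam (S.inverse s) (lam s a) = A.conjugate (f (S.inverse s) s) a"
proof -
  have "lam (S.dom s) a = a" using assms A.ran_mult_self[of a] by (simp add: lam_idem)
  then show ?thesis using assms(1,2) by (simp add: lam_lam S.dom_def)
qed

lemma ran_f_inverse: "s \<in> S \<Longrightarrow> A.ran (f (S.inverse s) s) = \<alpha> (S.dom s)"
  by (simp flip: S.dom_def)

lemma lam_inject:
  assumes s: "s \<in> S" and a: "a \<in> A" "A.ran a = \<alpha> (S.dom s)" and b: "b \<in> A" "A.ran b = \<alpha> (S.dom s)"
    and eq: "lam s a = lam s b"
  shows "a = b"
proof (rule A.conjugate_inject)
  show "A.ran (f (S.inverse s) s) \<odot> a = a" "A.ran (f (S.inverse s) s) \<odot> b = b"
    using s a b A.ran_mult_self[of a] A.ran_mult_self[of b] by (simp_all only: ran_f_inverse)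
  show "A.conjugate (f (S.inverse s) s) a = A.conjugate (f (S.inverse s) s) b"
    using s a b eq lam_inverse_lam[of s a] lam_inverse_lam[of s b] by simp
qed (use s a b in auto)

lemma lam_surj:
  assumes s: "s \<in> S" and b: "b \<in> A" "A.ran b = \<alpha> (S.ran s)"
  obtains a where "a \<in> A" "A.ran a = \<alpha> (S.dom s)" "lam s a = b"
proof
  define c where "c = f s (S.inverse s)"
  have c: "c \<in> A" "A.ran c = \<alpha> (S.ran s)"
    using s ran_f_inverse[of "S.inverse s"] by (simp_all add: c_def)
  define b' where "b' = A.conjugate (A.inverse c) b"
  have b': "b' \<in> A" "A.ran b' = \<alpha> (S.ran s)"
    using s b c by (simp_all add: b'_def A.ran_conjugate)
  show "lam (S.inverse s) b' \<in> A" "A.ran (lam (S.inverse s) b') = \<alpha> (S.dom s)"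
    using s b' ran_lam[of "S.inverse s" b'] by simp_all
  have "lam s (lam (S.inverse s) b') = A.conjugate c b'"
    using s b' lam_inverse_lam[of "S.inverse s" b'] by (simp add: c_def)
  also have "\<dots> = b"
    unfolding b'_def using b c A.ran_mult_self[of b] by (intro A.conjugate_conjugate_inverse) auto
  finally show "lam s (lam (S.inverse s) b') = b" .
qed

end

lemma sieben_module_iff:
  assumes "clifford_semigroup A mA" and "inv_semigroup S m"
  shows "sieben_module A mA S m \<alpha> lam f \<longleftrightarrow> sieben_tms S m A mA \<alpha> lam f"
proof -
  interpret A: clifford_semigroup A mA by fact
  interpret S: inv_semigroup S m by fact
  have conj_right: "m (m s e) (S.inverse s) = S.ran (m s e)"
    if "s \<in> S" "e \<in> S.E" for s e
    using that by (rule S.conj_idem)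
  have conj_left: "m (m e s) (S.inverse s) = S.ran (m e s)"
    if "s \<in> S" "e \<in> S.E" for s e
    using that by (simp add: S.ran_idem_mult S.assoc) (simp add: S.ran_def)
  have conj_mult: "m (m (m s t) (S.inverse t)) (S.inverse s) = S.ran (m s t)"
    if "s \<in> S" "t \<in> S" for s t
    using that by (simp add: S.ran_def S.inverse_mult S.assoc)
  show ?thesis
  proof
    assume "sieben_module A mA S m \<alpha> lam f"
    then interpret sieben_module A mA S m \<alpha> lam f .
    have "f (m s e) e = \<alpha> (S.ran (m s e))" "f e (m e s) = \<alpha> (S.ran (m e s))"
      if "s \<in> S" "e \<in> S.E" for s e
      using that f_idem_right[of "m s e" e] f_idem_left[of "m e s" e] by (simp_all add: S.assoc)
    then show "sieben_tms S m A mA \<alpha> lam f"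
      unfolding sieben_tms_def tms_def
      by (simp add: conj_right conj_left conj_mult A.mem_Agrp_iff A.conjugate_def
          alpha_bij alpha_mult lam_rel_invertible lam_idem lam_alpha lam_lam
          f_idem_right f_idem_left f_cocycle)
  next
    assume "sieben_tms S m A mA \<alpha> lam f"
    then show "sieben_module A mA S m \<alpha> lam f"
      by unfold_locales (simp_all add: sieben_tms_def tms_def conj_right conj_left conj_mult
          A.mem_Agrp_iff A.conjugate_def)
  qed
qed

section \<open>Twisted partial actions\<close>

locale twisted_partial_action = A: clifford_semigroup A mA + G: group G
  for A :: "'b set" and mA :: "'b \<Rightarrow> 'b \<Rightarrow> 'b" (infixl "\<odot>" 70) and G :: "'g monoid" (structure) +
  fixes D :: "'g \<Rightarrow> 'b set" and \<theta> :: "'g \<Rightarrow> 'b \<Rightarrow> 'b"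
    and w :: "'g \<Rightarrow> 'g \<Rightarrow> ('b \<Rightarrow> 'b) \<times> ('b \<Rightarrow> 'b)"
  assumes ideal_D: "x \<in> carrier G \<Longrightarrow> A.ideal (D x)"
    and theta_bij: "x \<in> carrier G \<Longrightarrow> bij_betw (\<theta> x) (D (inv x)) (D x)"
    and theta_mult: "x \<in> carrier G \<Longrightarrow> a \<in> D (inv x) \<Longrightarrow> b \<in> D (inv x) \<Longrightarrow>
      \<theta> x (a \<odot> b) = \<theta> x a \<odot> \<theta> x b"
    and w_unit: "x \<in> carrier G \<Longrightarrow> y \<in> carrier G \<Longrightarrow>
      is_unit_multiplier (D x \<inter> D (x \<otimes> y)) mA (w x y)"
    and D_one [simp]: "D \<one> = A"
    and theta_one [simp]: "a \<in> A \<Longrightarrow> \<theta> \<one> a = a"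
    and theta_image: "x \<in> carrier G \<Longrightarrow> y \<in> carrier G \<Longrightarrow>
      \<theta> x ` (D (inv x) \<inter> D y) = D x \<inter> D (x \<otimes> y)"
    and theta_theta_minv: "x \<in> carrier G \<Longrightarrow> y \<in> carrier G \<Longrightarrow>
      a \<in> D (inv y) \<Longrightarrow> a \<in> D (inv y \<otimes> inv x) \<Longrightarrow>
      \<theta> x (\<theta> y a) =
        snd (minv (D x \<inter> D (x \<otimes> y)) mA (w x y)) (fst (w x y) (\<theta> (x \<otimes> y) a))"
    and w_one_left: "x \<in> carrier G \<Longrightarrow> a \<in> D x \<Longrightarrow> fst (w \<one> x) a = a \<and> snd (w \<one> x) a = a"
    and w_one_right: "x \<in> carrier G \<Longrightarrow> a \<in> D x \<Longrightarrow> fst (w x \<one>) a = a \<and> snd (w x \<one>) a = a"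
    and w_cocycle: "x \<in> carrier G \<Longrightarrow> y \<in> carrier G \<Longrightarrow> z \<in> carrier G \<Longrightarrow>
      a \<in> D (inv x) \<Longrightarrow> a \<in> D y \<Longrightarrow> a \<in> D (y \<otimes> z) \<Longrightarrow>
      snd (w x (y \<otimes> z)) (\<theta> x (snd (w y z) a)) = snd (w (x \<otimes> y) z) (snd (w x y) (\<theta> x a))"

lemma twisted_partial_action_iff:
  fixes G (structure)
  assumes "clifford_semigroup A mA"
  shows "twisted_partial_action A mA G D \<theta> w \<longleftrightarrow> tpa G A mA D \<theta> w"
proof -
  interpret A: clifford_semigroup A mA by fact
  show ?thesis
  proof
    assume "twisted_partial_action A mA G D \<theta> w"
    then interpret twisted_partial_action A mA G D \<theta> w .
    show "tpa G A mA D \<theta> w"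
      unfolding tpa_def
      by (simp add: A.setprod_ideal A.ideal_inter ideal_D theta_bij theta_mult w_unit theta_image
          theta_theta_minv w_one_left w_one_right w_cocycle G.is_group) blast
  next
    assume tpa: "tpa G A mA D \<theta> w"
    then interpret G: group G by (simp add: tpa_def)
    have ideal: "A.ideal (D x)" if "x \<in> carrier G" for x using tpa that by (simp add: tpa_def)
    show "twisted_partial_action A mA G D \<theta> w"
    proof unfold_locales
      fix x y assume xy: "x \<in> carrier G" "y \<in> carrier G"
      have "\<theta> x ` setprod mA (D (inv x)) (D y) = setprod mA (D x) (D (x \<otimes> y))"
        using tpa xy unfolding tpa_def by blast
      then show "\<theta> x ` (D (inv x) \<inter> D y) = D x \<inter> D (x \<otimes> y)"
        using xy by (simp add: A.setprod_ideal ideal)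
    qed (use tpa ideal in \<open>simp_all add: tpa_def A.setprod_ideal A.ideal_inter\<close>)
  qed
qed

context twisted_partial_action
begin

lemma D_closed: "x \<in> carrier G \<Longrightarrow> a \<in> D x \<Longrightarrow> a \<in> A"
  using ideal_D A.ideal_sub by blast

lemma D_left: "x \<in> carrier G \<Longrightarrow> a \<in> A \<Longrightarrow> b \<in> D x \<Longrightarrow> a \<odot> b \<in> D x"
  using ideal_D A.ideal_left by blast

lemma D_right: "x \<in> carrier G \<Longrightarrow> a \<in> D x \<Longrightarrow> b \<in> A \<Longrightarrow> a \<odot> b \<in> D x"
  using ideal_D A.ideal_right by blast

lemma D_ran_iff: "x \<in> carrier G \<Longrightarrow> a \<in> A \<Longrightarrow> A.ran a \<in> D x \<longleftrightarrow> a \<in> D x"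
  using ideal_D A.ideal_ran_iff by blast

lemma theta_mem: "x \<in> carrier G \<Longrightarrow> a \<in> D (inv x) \<Longrightarrow> \<theta> x a \<in> D x"
  using theta_bij by (meson bij_betwE)

lemma theta_closed: "x \<in> carrier G \<Longrightarrow> a \<in> D (inv x) \<Longrightarrow> \<theta> x a \<in> A"
  using theta_mem D_closed by blast

lemma theta_eq_iff:
  "x \<in> carrier G \<Longrightarrow> a \<in> D (inv x) \<Longrightarrow> b \<in> D (inv x) \<Longrightarrow> \<theta> x a = \<theta> x b \<longleftrightarrow> a = b"
  using theta_bij by (meson bij_betw_imp_inj_on inj_on_eq_iff)

lemma theta_mem_mult_iff:
  assumes "x \<in> carrier G" "y \<in> carrier G" "a \<in> D (inv x)"
  shows "\<theta> x a \<in> D (x \<otimes> y) \<longleftrightarrow> a \<in> D y"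
proof
  assume "\<theta> x a \<in> D (x \<otimes> y)"
  then have "\<theta> x a \<in> \<theta> x ` (D (inv x) \<inter> D y)" using assms theta_image[of x y] theta_mem by blast
  then obtain b where "b \<in> D (inv x)" "b \<in> D y" "\<theta> x a = \<theta> x b" by blast
  then show "a \<in> D y" using assms theta_eq_iff by metis
next
  assume "a \<in> D y"
  then show "\<theta> x a \<in> D (x \<otimes> y)" using assms theta_image[of x y] by blast
qed

lemma theta_hom_on: "x \<in> carrier G \<Longrightarrow> A.hom_on (D (inv x)) (\<theta> x)"
  by (simp add: A.hom_on_def theta_closed theta_mult)

lemma theta_ran: "x \<in> carrier G \<Longrightarrow> a \<in> D (inv x) \<Longrightarrow> A.ran (\<theta> x a) = \<theta> x (A.ran a)"
  by (rule A.hom_on_ran[OF ideal_D theta_hom_on]) auto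

lemma theta_idem: "x \<in> carrier G \<Longrightarrow> e \<in> D (inv x) \<Longrightarrow> e \<in> A.E \<Longrightarrow> \<theta> x e \<in> A.E"
  using theta_hom_on A.hom_on_idem by blast

abbreviation inv_theta :: "'g \<Rightarrow> 'b \<Rightarrow> 'b" where "inv_theta \<equiv> theta_inv G D \<theta>"

lemma inv_theta_theta: "x \<in> carrier G \<Longrightarrow> a \<in> D (inv x) \<Longrightarrow> inv_theta x (\<theta> x a) = a"
  unfolding theta_inv_def using theta_bij by (meson bij_betw_imp_inj_on the_inv_into_f_f)

lemma theta_inv_theta: "x \<in> carrier G \<Longrightarrow> a \<in> D x \<Longrightarrow> \<theta> x (inv_theta x a) = a"
  unfolding theta_inv_def using theta_bij by (meson f_the_inv_into_f_bij_betw)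

lemma inv_theta_mem: "x \<in> carrier G \<Longrightarrow> a \<in> D x \<Longrightarrow> inv_theta x a \<in> D (inv x)"
  unfolding theta_inv_def using theta_bij by (meson bij_betwE bij_betw_the_inv_into)

lemma inv_theta_closed: "x \<in> carrier G \<Longrightarrow> a \<in> D x \<Longrightarrow> inv_theta x a \<in> A"
  using inv_theta_mem D_closed G.inv_closed by meson

lemma inv_theta_idem: "x \<in> carrier G \<Longrightarrow> e \<in> D x \<Longrightarrow> e \<in> A.E \<Longrightarrow> inv_theta x e \<in> A.E"
  using A.hom_on_idem[OF A.hom_on_the_inv_into[OF ideal_D theta_hom_on theta_bij]]
  by (simp add: theta_inv_def)

abbreviation twist :: "'g \<Rightarrow> 'g \<Rightarrow> 'b \<Rightarrow> 'b" where "twist x y \<equiv> snd (w x y)"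

lemma twist_section: "x \<in> carrier G \<Longrightarrow> y \<in> carrier G \<Longrightarrow> A.group_section (D x \<inter> D (x \<otimes> y)) (twist x y)"
  by (intro A.unit_multiplier_group_section A.ideal_inter ideal_D w_unit) auto

lemma w_eq:
  assumes "x \<in> carrier G" "y \<in> carrier G" "a \<in> D x" "a \<in> D (x \<otimes> y)"
  shows "fst (w x y) a = twist x y (A.ran a) \<odot> a" and "snd (w x y) a = a \<odot> twist x y (A.ran a)"
  using assms
    A.multiplier_eq[OF A.ideal_inter[OF ideal_D ideal_D] A.unit_multiplier_multiplier[OF w_unit]]
  by simp_all

lemma twist_closed: "x \<in> carrier G \<Longrightarrow> y \<in> carrier G \<Longrightarrow> e \<in> D x \<Longrightarrow> e \<in> D (x \<otimes> y) \<Longrightarrow> e \<in> A.E \<Longrightarrow>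
      twist x y e \<in> A"
  and ran_twist: "x \<in> carrier G \<Longrightarrow> y \<in> carrier G \<Longrightarrow> e \<in> D x \<Longrightarrow> e \<in> D (x \<otimes> y) \<Longrightarrow> e \<in> A.E \<Longrightarrow>
      A.ran (twist x y e) = e"
  and twist_restrict: "x \<in> carrier G \<Longrightarrow> y \<in> carrier G \<Longrightarrow> e \<in> D x \<Longrightarrow> e \<in> D (x \<otimes> y) \<Longrightarrow> e \<in> A.E \<Longrightarrow>
      k \<in> A.E \<Longrightarrow> twist x y (e \<odot> k) = twist x y e \<odot> k"
  using twist_section[of x y] A.group_section_closed A.ran_group_section A.group_section_restrict
  by blast+

lemma theta_mult_mem:
  assumes "x \<in> carrier G" "y \<in> carrier G" "a \<in> D (inv y)" "a \<in> D (inv y \<otimes> inv x)"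
  shows "\<theta> (x \<otimes> y) a \<in> D x" and "\<theta> (x \<otimes> y) a \<in> D (x \<otimes> y)"
  using assms theta_mem_mult_iff[of "x \<otimes> y" "inv y" a] theta_mem[of "x \<otimes> y" a]
  by (simp_all add: G.inv_mult_group G.m_assoc)

lemma theta_theta:
  assumes "x \<in> carrier G" "y \<in> carrier G" "a \<in> D (inv y)" "a \<in> D (inv y \<otimes> inv x)"
  shows "\<theta> x (\<theta> y a) = A.conjugate (twist x y (A.ran (\<theta> (x \<otimes> y) a))) (\<theta> (x \<otimes> y) a)"
  using assms theta_mult_mem[OF assms]
  by (simp add: theta_theta_minv A.snd_minv_fst w_unit A.ideal_inter ideal_D)

lemma theta_theta_idem:
  assumes "x \<in> carrier G" "y \<in> carrier G" "e \<in> D (inv y)" "e \<in> D (inv y \<otimes> inv x)" "e \<in> A.E"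
  shows "\<theta> x (\<theta> y e) = \<theta> (x \<otimes> y) e"
proof -
  have "\<theta> (x \<otimes> y) e \<in> A.E" using assms by (simp add: theta_idem G.inv_mult_group)
  then show ?thesis
    using assms theta_mult_mem[OF assms(1-4)]
    by (simp add: theta_theta A.conjugate_idem twist_closed ran_twist)
qed

lemma theta_inv:
  assumes "x \<in> carrier G" "e \<in> D x" "e \<in> A.E"
  shows "\<theta> (inv x) e = inv_theta x e"
proof -
  have "\<theta> (inv x) (\<theta> x (inv_theta x e)) = \<theta> (inv x \<otimes> x) (inv_theta x e)"
    using assms
    by (intro theta_theta_idem) (simp_all add: inv_theta_mem inv_theta_idem inv_theta_closed)
  then show ?thesis using assms by (simp add: theta_inv_theta inv_theta_closed)
qed

lemma twist_one:
  assumes "x \<in> carrier G" "e \<in> D x"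
  shows "twist \<one> x e = e" and "twist x \<one> e = e"
  using assms w_one_left w_one_right by simp_all

lemma twist_cocycle:
  assumes x: "x \<in> carrier G" and y: "y \<in> carrier G" and z: "z \<in> carrier G"
    and e: "e \<in> D (inv x)" "e \<in> D y" "e \<in> D (y \<otimes> z)" "e \<in> A.E"
  shows "\<theta> x (twist y z e) \<odot> twist x (y \<otimes> z) (\<theta> x e) = twist x y (\<theta> x e) \<odot> twist (x \<otimes> y) z (\<theta> x e)"
proof -
  have theta_e: "\<theta> x e \<in> A.E" "\<theta> x e \<in> D x" "\<theta> x e \<in> D (x \<otimes> y)" "\<theta> x e \<in> D (x \<otimes> (y \<otimes> z))"
    using x y z e by (simp_all add: theta_idem theta_mem theta_mem_mult_iff)
  have ran_twist_yz: "A.ran (twist y z e) = e" "twist y z e \<in> A"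
    using y z e by (simp_all add: ran_twist twist_closed)
  then have twist_yz: "twist y z e \<in> D (inv x)" "twist y z e \<in> D y" "twist y z e \<in> D (y \<otimes> z)"
    using x y z e D_ran_iff[of _ "twist y z e"] by auto
  have ran_twist_xy: "A.ran (twist x y (\<theta> x e)) = \<theta> x e" "twist x y (\<theta> x e) \<in> A"
    using x y theta_e by (simp_all add: ran_twist twist_closed)
  then have twist_xy: "twist x y (\<theta> x e) \<in> D (x \<otimes> y)" "twist x y (\<theta> x e) \<in> D (x \<otimes> y \<otimes> z)"
    using x y z theta_e D_ran_iff[of _ "twist x y (\<theta> x e)"] by (auto simp: G.m_assoc)
  have "\<theta> x (twist y z e) \<odot> twist x (y \<otimes> z) (\<theta> x e) = twist x (y \<otimes> z) (\<theta> x (twist y z e))"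
    using x y z twist_yz ran_twist_yz w_eq(2)[of x "y \<otimes> z" "\<theta> x (twist y z e)"]
    by (simp add: theta_ran theta_mem theta_mem_mult_iff)
  also have "\<dots> = twist (x \<otimes> y) z (twist x y (\<theta> x e))" using x y z e by (simp add: w_cocycle)
  also have "\<dots> = twist x y (\<theta> x e) \<odot> twist (x \<otimes> y) z (\<theta> x e)"
    using x y z twist_xy ran_twist_xy w_eq(2)[of "x \<otimes> y" z "twist x y (\<theta> x e)"] by simp
  finally show ?thesis .
qed

end

section \<open>The twisted partial action of a Sieben module\<close>

locale E_unitary_sieben_module = sieben_module A mA S m \<alpha> lam f + S: E_unitary_semigroup S m
  for A :: "'b set" and mA :: "'b \<Rightarrow> 'b \<Rightarrow> 'b" (infixl "\<odot>" 70)
    and S :: "'a set" and m :: "'a \<Rightarrow> 'a \<Rightarrow> 'a" (infixl "\<cdot>" 70) and \<alpha> lam f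
begin

abbreviation D :: "'a set \<Rightarrow> 'b set" where "D \<equiv> thD S m A mA \<alpha>"
abbreviation \<theta> :: "'a set \<Rightarrow> 'b \<Rightarrow> 'b" where "\<theta> \<equiv> thTheta S m A mA \<alpha> lam"
abbreviation w :: "'a set \<Rightarrow> 'a set \<Rightarrow> ('b \<Rightarrow> 'b) \<times> ('b \<Rightarrow> 'b)" where "w \<equiv> thW S m A mA \<alpha> f"

lemma mem_D_iff:
  assumes "x \<in> carrier S.G"
  shows "a \<in> D x \<longleftrightarrow> a \<in> A \<and> (\<exists>s\<in>S. x = S.cls s \<and> A.ran a = \<alpha> (S.ran s))"
  unfolding thD_def S.ran_def[symmetric] using S.mem_class_iff[OF assms] A.mem_Agrp_iff by auto

lemma mem_D_clsI: "s \<in> S \<Longrightarrow> a \<in> A \<Longrightarrow> A.ran a = \<alpha> (S.ran s) \<Longrightarrow> a \<in> D (S.cls s)"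
  by (auto simp: mem_D_iff)

lemma mem_D_inv_iff:
  assumes x: "x \<in> carrier S.G"
  shows "a \<in> D (inv\<^bsub>S.G\<^esub> x) \<longleftrightarrow> a \<in> A \<and> (\<exists>s\<in>S. x = S.cls s \<and> A.ran a = \<alpha> (S.dom s))"
proof
  assume "a \<in> D (inv\<^bsub>S.G\<^esub> x)"
  then obtain t where t: "t \<in> S" "inv\<^bsub>S.G\<^esub> x = S.cls t" "a \<in> A" "A.ran a = \<alpha> (S.ran t)"
    using x by (auto simp: mem_D_iff)
  then have "x = S.cls (S.inverse t)" using x S.G.inv_inv S.inv_cls by metis
  then show "a \<in> A \<and> (\<exists>s\<in>S. x = S.cls s \<and> A.ran a = \<alpha> (S.dom s))"
    using t by (intro conjI bexI[of _ "S.inverse t"]) auto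
next
  assume "a \<in> A \<and> (\<exists>s\<in>S. x = S.cls s \<and> A.ran a = \<alpha> (S.dom s))"
  then show "a \<in> D (inv\<^bsub>S.G\<^esub> x)" using mem_D_clsI[of "S.inverse _" a] by auto
qed

lemma theta_cls:
  assumes s: "s \<in> S" and a: "a \<in> A" "A.ran a = \<alpha> (S.dom s)"
  shows "\<theta> (S.cls s) a = lam s a"
proof -
  have "(THE t. t \<in> S.cls s \<and> \<alpha> (S.dom t) = A.ran a) = s"
  proof (rule the_equality)
    fix t assume t: "t \<in> S.cls s \<and> \<alpha> (S.dom t) = A.ran a"
    show "t = s"
      by (rule S.eq_if_cls_dom_eq) (use s a t in \<open>auto simp: S.mem_class_iff\<close>)
  qed (use s a in auto)
  then show ?thesis unfolding thTheta_def S.dom_def A.ran_def by simp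
qed

lemma theta_cls_restrict:
  assumes s: "s \<in> S" and a: "a \<in> A" "\<alpha> (S.dom s) \<odot> a = a"
  shows "\<theta> (S.cls s) a = lam s a"
proof -
  obtain p where p: "p \<in> S.E" "\<alpha> p = A.ran a" using a alpha_surj A.ran_mem_E by blast
  have "A.ran a = \<alpha> (S.dom s) \<odot> A.ran a"
    using a s A.idem_mult_eq_iff[of "\<alpha> (S.dom s)" a] by simp
  also have "\<dots> = \<alpha> (S.dom (s \<cdot> p))" using s p by (simp add: S.dom_mult_idem alpha_mult)
  finally have "\<theta> (S.cls (s \<cdot> p)) a = lam (s \<cdot> p) a" using s p a by (intro theta_cls) auto
  then show ?thesis using s p a by (simp add: lam_mult_idem)
qed

lemma pick_r_cls:
  assumes s: "s \<in> S" and a: "A.ran a = \<alpha> (S.ran s)"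
  shows "pick_r S m A mA \<alpha> (S.cls s) a = s"
  unfolding pick_r_def S.ran_def[symmetric] A.ran_def[symmetric]
proof (rule the_equality)
  fix t assume t: "t \<in> S.cls s \<and> \<alpha> (S.ran t) = A.ran a"
  show "t = s"
    by (rule S.eq_if_cls_ran_eq) (use s a t in \<open>auto simp: S.mem_class_iff\<close>)
qed (use s a in auto)

text \<open>Composable pairs \<open>u \<in> x\<close>, \<open>v \<in> y\<close> parametrise the idempotents of \<open>D x \<inter> D (x y)\<close>; evaluating
  at them turns each axiom for \<open>(\<theta>, w)\<close> into the corresponding identity for \<open>(\<lambda>, f)\<close>.\<close>

lemma w_cls:
  assumes u: "u \<in> S" and v: "v \<in> S" and uv: "S.dom u = S.ran v" and a: "A.ran a = \<alpha> (S.ran u)"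
  shows "fst (w (S.cls u) (S.cls v)) a = f u v \<odot> a" and "snd (w (S.cls u) (S.cls v)) a = a \<odot> f u v"
proof -
  have "pick_r S m A mA \<alpha> (S.cls u) a = u" "pick_r S m A mA \<alpha> (S.cls (u \<cdot> v)) a = u \<cdot> v"
    using u v uv a by (simp_all add: pick_r_cls S.ran_mult_composable)
  moreover have "S.inverse u \<cdot> (u \<cdot> v) = S.dom u \<cdot> v" using u v by (simp add: S.dom_def S.assoc)
  ultimately show "fst (w (S.cls u) (S.cls v)) a = f u v \<odot> a"
    "snd (w (S.cls u) (S.cls v)) a = a \<odot> f u v"
    using u v uv by (simp_all add: thW_def)
qed

lemma w_cls_idem:
  assumes "u \<in> S" "v \<in> S" "S.dom u = S.ran v"
  shows "snd (w (S.cls u) (S.cls v)) (\<alpha> (S.ran u)) = f u v"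
  using assms by (simp add: w_cls f_absorb)

lemma D_mult_obtain:
  assumes x: "x \<in> carrier S.G" and y: "y \<in> carrier S.G" and a: "a \<in> D x" "a \<in> D (x \<otimes>\<^bsub>S.G\<^esub> y)"
  obtains u v where "u \<in> S" "v \<in> S" "x = S.cls u" "y = S.cls v" "S.dom u = S.ran v"
    "A.ran a = \<alpha> (S.ran u)"
proof -
  obtain u where u: "u \<in> S" "x = S.cls u" "A.ran a = \<alpha> (S.ran u)"
    using x a by (auto simp: mem_D_iff)
  obtain t where t: "t \<in> S" "x \<otimes>\<^bsub>S.G\<^esub> y = S.cls t" "A.ran a = \<alpha> (S.ran t)"
    using x y a by (auto simp: mem_D_iff)
  have ran: "S.ran t = S.ran u" using u t by simp
  have "S.cls (S.inverse u \<cdot> t) = inv\<^bsub>S.G\<^esub> x \<otimes>\<^bsub>S.G\<^esub> (x \<otimes>\<^bsub>S.G\<^esub> y)" using u t by simp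
  also have "\<dots> = y" using x y by (simp flip: S.G.m_assoc)
  finally have "y = S.cls (S.inverse u \<cdot> t)" ..
  moreover have "S.dom u = S.ran (S.inverse u \<cdot> S.ran t)"
    using u ran S.mult_dom_self[of "S.inverse u"] by simp
  then have "S.dom u = S.ran (S.inverse u \<cdot> t)"
    using u t by (simp only: S.ran_mult_ran S.inverse_closed)
  ultimately show thesis using u t that by blast
qed

lemma D_inv_obtain:
  assumes x: "x \<in> carrier S.G" and y: "y \<in> carrier S.G" and a: "a \<in> D (inv\<^bsub>S.G\<^esub> x)" "a \<in> D y"
  obtains u v where "u \<in> S" "v \<in> S" "x = S.cls u" "y = S.cls v" "S.dom u = S.ran v"
    "A.ran a = \<alpha> (S.dom u)"
proof -
  obtain u where "u \<in> S" "x = S.cls u" "A.ran a = \<alpha> (S.dom u)"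
    using a unfolding mem_D_inv_iff[OF x] by blast
  moreover obtain v where "v \<in> S" "y = S.cls v" "A.ran a = \<alpha> (S.ran v)"
    using a by (auto simp: mem_D_iff[OF y])
  ultimately show thesis using that by simp
qed

lemma D_inv_mult_obtain:
  assumes x: "x \<in> carrier S.G" and y: "y \<in> carrier S.G"
    and a: "a \<in> D (inv\<^bsub>S.G\<^esub> y)" "a \<in> D (inv\<^bsub>S.G\<^esub> y \<otimes>\<^bsub>S.G\<^esub> inv\<^bsub>S.G\<^esub> x)"
  obtains u v where "u \<in> S" "v \<in> S" "x = S.cls u" "y = S.cls v" "S.dom u = S.ran v"
    "A.ran a = \<alpha> (S.dom v)"
proof -
  obtain u v where uv: "u \<in> S" "v \<in> S" "inv\<^bsub>S.G\<^esub> y = S.cls u" "inv\<^bsub>S.G\<^esub> x = S.cls v"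
    "S.dom u = S.ran v" "A.ran a = \<alpha> (S.ran u)"
    using D_mult_obtain[OF _ _ a] x y by blast
  then have "x = S.cls (S.inverse v)" "y = S.cls (S.inverse u)"
    using x y by (metis S.G.inv_inv S.inv_cls)+
  then show thesis using uv that[of "S.inverse v" "S.inverse u"] by simp
qed

lemma ideal_D:
  assumes x: "x \<in> carrier S.G"
  shows "A.ideal (D x)"
  unfolding is_ideal_def
proof (intro conjI ballI)
  show "D x \<subseteq> A" using x by (auto simp: mem_D_iff)
  obtain s where "s \<in> S" "x = S.cls s" using x by (auto simp: S.carrier_G)
  then show "D x \<noteq> {}" using mem_D_clsI[of s "\<alpha> (S.ran s)"] by auto
  fix a b assume a: "a \<in> A" and "b \<in> D x"
  then obtain s where s: "s \<in> S" "x = S.cls s" "b \<in> A" "A.ran b = \<alpha> (S.ran s)"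
    using x by (auto simp: mem_D_iff)
  obtain p where p: "p \<in> S.E" "\<alpha> p = A.ran a" using a alpha_surj A.ran_mem_E by blast
  have cls: "x = S.cls (p \<cdot> s)" using s p by simp
  have ran: "A.ran (a \<odot> b) = \<alpha> (S.ran (p \<cdot> s))" "A.ran (b \<odot> a) = \<alpha> (S.ran (p \<cdot> s))"
    using s p a A.idem_comm[of "\<alpha> (S.ran s)" "A.ran a"]
    by (simp_all add: alpha_ran_idem_mult A.ran_mult)
  show "a \<odot> b \<in> D x" unfolding cls using s p a ran by (intro mem_D_clsI) simp_all
  show "b \<odot> a \<in> D x" unfolding cls using s p a ran by (intro mem_D_clsI) simp_all
qed

lemma theta_bij:
  assumes x: "x \<in> carrier S.G"
  shows "bij_betw (\<theta> x) (D (inv\<^bsub>S.G\<^esub> x)) (D x)"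
proof (rule bij_betw_imageI)
  show "inj_on (\<theta> x) (D (inv\<^bsub>S.G\<^esub> x))"
  proof (rule inj_onI)
    fix a b assume a: "a \<in> D (inv\<^bsub>S.G\<^esub> x)" and b: "b \<in> D (inv\<^bsub>S.G\<^esub> x)" and eq: "\<theta> x a = \<theta> x b"
    obtain s where s: "s \<in> S" "x = S.cls s" "a \<in> A" "A.ran a = \<alpha> (S.dom s)"
      using a unfolding mem_D_inv_iff[OF x] by blast
    obtain t where t: "t \<in> S" "x = S.cls t" "b \<in> A" "A.ran b = \<alpha> (S.dom t)"
      using b unfolding mem_D_inv_iff[OF x] by blast
    have lam: "lam s a = lam t b" using eq s t by (metis theta_cls)
    then have "\<alpha> (S.ran s) = \<alpha> (S.ran t)" using s t by (metis ran_lam)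
    then have "s = t" using s t by - (rule S.eq_if_cls_ran_eq, simp_all)
    then show "a = b" using s t lam by (intro lam_inject[of s a b]) simp_all
  qed
  show "\<theta> x ` D (inv\<^bsub>S.G\<^esub> x) = D x"
  proof (intro equalityI subsetI)
    fix b assume "b \<in> \<theta> x ` D (inv\<^bsub>S.G\<^esub> x)"
    then obtain a where a: "a \<in> D (inv\<^bsub>S.G\<^esub> x)" "b = \<theta> x a" by blast
    then obtain s where "s \<in> S" "x = S.cls s" "a \<in> A" "A.ran a = \<alpha> (S.dom s)"
      unfolding mem_D_inv_iff[OF x] by blast
    then show "b \<in> D x" using a(2) by (simp add: theta_cls mem_D_clsI ran_lam)
  next
    fix b assume "b \<in> D x"
    then obtain s where s: "s \<in> S" "x = S.cls s" "b \<in> A" "A.ran b = \<alpha> (S.ran s)"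
      by (auto simp: mem_D_iff[OF x])
    then obtain a where a: "a \<in> A" "A.ran a = \<alpha> (S.dom s)" "lam s a = b"
      using lam_surj by blast
    have "a \<in> D (inv\<^bsub>S.G\<^esub> x)" unfolding mem_D_inv_iff[OF x] using s(1,2) a(1,2) by blast
    moreover have "\<theta> x a = b" using s a by (simp add: theta_cls)
    ultimately show "b \<in> \<theta> x ` D (inv\<^bsub>S.G\<^esub> x)" by blast
  qed
qed

lemma theta_mult:
  assumes x: "x \<in> carrier S.G" and a: "a \<in> D (inv\<^bsub>S.G\<^esub> x)" and b: "b \<in> D (inv\<^bsub>S.G\<^esub> x)"
  shows "\<theta> x (a \<odot> b) = \<theta> x a \<odot> \<theta> x b"
proof -
  obtain u where u: "u \<in> S" "x = S.cls u" "a \<in> A" "A.ran a = \<alpha> (S.dom u)"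
    using a unfolding mem_D_inv_iff[OF x] by blast
  obtain v where v: "v \<in> S" "x = S.cls v" "b \<in> A" "A.ran b = \<alpha> (S.dom v)"
    using b unfolding mem_D_inv_iff[OF x] by blast
  \<comment> \<open>\<open>E\<close>-unitarity makes \<open>u\<close> and \<open>v\<close> compatible: \<open>r\<close> is their common restriction on both sides.\<close>
  define r where "r = u \<cdot> S.dom v"
  have r_u: "r = S.ran v \<cdot> u" using u v by (simp add: r_def S.mult_dom_eq_ran_mult)
  have r_v: "r = S.ran u \<cdot> v" using u v by (simp add: r_u S.ran_mult_commute[of u v])
  have r: "r \<in> S" "x = S.cls r" using u v by (simp_all add: r_def)
  have "A.ran (a \<odot> b) = \<alpha> (S.dom r)"
    using u v by (simp add: r_def S.dom_mult_idem alpha_mult A.ran_mult)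
  then have "\<theta> x (a \<odot> b) = lam r a \<odot> lam r b"
    using theta_cls[of r "a \<odot> b"] u v r by (simp add: lam_mult)
  also have "\<dots> = \<alpha> (S.ran v) \<odot> lam u a \<odot> (\<alpha> (S.ran u) \<odot> lam v b)"
    using u v lam_idem_mult[of u "S.ran v" a] lam_idem_mult[of v "S.ran u" b] r_u r_v by simp
  also have "\<dots> = \<alpha> (S.ran u) \<odot> lam u a \<odot> (\<alpha> (S.ran v) \<odot> lam v b)"
    using u v A.idem_central_left[of "\<alpha> (S.ran u)" "lam u a"]
      A.idem_central_left[of "\<alpha> (S.ran v)" "lam u a"]
      A.idem_left_comm[of "\<alpha> (S.ran v)" "\<alpha> (S.ran u)"]
    by (simp add: A.assoc)
  also have "\<dots> = \<theta> x a \<odot> \<theta> x b"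
    using u v theta_cls[of u a] theta_cls[of v b] by (simp add: lam_absorb)
  finally show ?thesis .
qed

lemma w_group_section:
  assumes x: "x \<in> carrier S.G" and y: "y \<in> carrier S.G"
  shows "A.group_section (D x \<inter> D (x \<otimes>\<^bsub>S.G\<^esub> y)) (snd (w x y))"
  unfolding A.group_section_def
proof (intro ballI impI)
  fix e assume "e \<in> D x \<inter> D (x \<otimes>\<^bsub>S.G\<^esub> y)" "e \<in> A.E"
  then obtain u v where uv: "u \<in> S" "v \<in> S" "x = S.cls u" "y = S.cls v" "S.dom u = S.ran v"
    and e: "e = \<alpha> (S.ran u)"
    using D_mult_obtain[OF x y, of e] by auto
  have w_e: "snd (w x y) e = f u v" using uv e by (simp add: w_cls_idem)
  have "snd (w x y) (e \<odot> k) = f u v \<odot> k" if k: "k \<in> A.E" for k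
  proof -
    obtain p where p: "p \<in> S.E" "\<alpha> p = k" using k alpha_surj by blast
    define v' where "v' = S.dom (p \<cdot> u) \<cdot> v"
    have v': "v' \<in> S" "S.cls v' = y" using uv p by (simp_all add: v'_def)
    have "S.dom (p \<cdot> u) = S.dom (p \<cdot> u) \<cdot> S.dom u"
      using uv(1) p S.dom_mult_idem[of "p \<cdot> u" "S.dom u"] by (simp add: S.assoc)
    then have "S.dom (p \<cdot> u) = S.ran v'" using uv p by (simp add: v'_def S.ran_idem_mult)
    moreover have "e \<odot> k = \<alpha> (S.ran (p \<cdot> u))"
      using uv p k by (simp add: e alpha_ran_idem_mult A.idem_comm)
    ultimately have "snd (w x y) (e \<odot> k) = f (p \<cdot> u) v'"
      using uv p v' w_cls_idem[of "p \<cdot> u" v'] by simp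
    also have "\<dots> = f u v \<odot> k"
      using uv p k by (simp add: v'_def f_dom_mult f_idem_mult A.idem_central[of k "f u v"])
    finally show ?thesis .
  qed
  then show "snd (w x y) e \<in> A \<and> A.ran (snd (w x y) e) = e \<and>
      (\<forall>k\<in>A.E. snd (w x y) (e \<odot> k) = snd (w x y) e \<odot> k)"
    using uv e w_e by (simp add: S.ran_mult_composable)
qed

lemma w_unit:
  assumes x: "x \<in> carrier S.G" and y: "y \<in> carrier S.G"
  shows "is_unit_multiplier (D x \<inter> D (x \<otimes>\<^bsub>S.G\<^esub> y)) mA (w x y)"
proof (rule A.unit_multiplierI)
  fix a assume "a \<in> D x \<inter> D (x \<otimes>\<^bsub>S.G\<^esub> y)"
  then obtain u v where "u \<in> S" "v \<in> S" "x = S.cls u" "y = S.cls v" "S.dom u = S.ran v"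
    "A.ran a = \<alpha> (S.ran u)"
    by (auto elim: D_mult_obtain[OF x y])
  then show "fst (w x y) a = snd (w x y) (A.ran a) \<odot> a \<and> snd (w x y) a = a \<odot> snd (w x y) (A.ran a)"
    by (simp add: w_cls f_absorb)
qed (use x y in \<open>simp_all add: w_group_section A.ideal_inter ideal_D\<close>)

lemma theta_image:
  assumes x: "x \<in> carrier S.G" and y: "y \<in> carrier S.G"
  shows "\<theta> x ` (D (inv\<^bsub>S.G\<^esub> x) \<inter> D y) = D x \<inter> D (x \<otimes>\<^bsub>S.G\<^esub> y)"
proof (intro equalityI subsetI)
  fix b assume "b \<in> \<theta> x ` (D (inv\<^bsub>S.G\<^esub> x) \<inter> D y)"
  then obtain a where a: "b = \<theta> x a" "a \<in> D (inv\<^bsub>S.G\<^esub> x)" "a \<in> D y" by blast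
  then obtain u v where uv: "u \<in> S" "v \<in> S" "x = S.cls u" "y = S.cls v" "S.dom u = S.ran v"
    "A.ran a = \<alpha> (S.dom u)"
    using D_inv_obtain[OF x y a(2,3)] by blast
  have "a \<in> A" using a x by (simp add: mem_D_inv_iff)
  then have "b \<in> A" "A.ran b = \<alpha> (S.ran u)" using uv a by (simp_all add: theta_cls ran_lam)
  then show "b \<in> D x \<inter> D (x \<otimes>\<^bsub>S.G\<^esub> y)"
    using uv mem_D_clsI[of u b] mem_D_clsI[of "u \<cdot> v" b] by (simp add: S.ran_mult_composable)
next
  fix b assume "b \<in> D x \<inter> D (x \<otimes>\<^bsub>S.G\<^esub> y)"
  then have b: "b \<in> D x" "b \<in> D (x \<otimes>\<^bsub>S.G\<^esub> y)" by auto
  obtain u v where uv: "u \<in> S" "v \<in> S" "x = S.cls u" "y = S.cls v" "S.dom u = S.ran v"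
    "A.ran b = \<alpha> (S.ran u)"
    using D_mult_obtain[OF x y b] by blast
  have "b \<in> \<theta> x ` D (inv\<^bsub>S.G\<^esub> x)" using b theta_bij[OF x] by (simp add: bij_betw_imp_surj_on)
  then obtain a where a: "b = \<theta> x a" "a \<in> D (inv\<^bsub>S.G\<^esub> x)" by blast
  then obtain s where s: "s \<in> S" "x = S.cls s" "a \<in> A" "A.ran a = \<alpha> (S.dom s)"
    unfolding mem_D_inv_iff[OF x] by blast
  then have "S.ran s = S.ran u" using uv a(1) ran_lam[of s a] by (simp add: theta_cls)
  then have "s = u" using uv s by - (rule S.eq_if_cls_ran_eq, simp_all)
  then have "a \<in> D y" using uv s mem_D_clsI[of v a] by simp
  then show "b \<in> \<theta> x ` (D (inv\<^bsub>S.G\<^esub> x) \<inter> D y)" using a by blast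
qed

lemma D_one: "D \<one>\<^bsub>S.G\<^esub> = A"
proof (intro equalityI subsetI)
  fix a assume a: "a \<in> A"
  then obtain p where "p \<in> S.E" "\<alpha> p = A.ran a" using alpha_surj A.ran_mem_E by blast
  then show "a \<in> D \<one>\<^bsub>S.G\<^esub>" using a mem_D_clsI[of p a] by (simp add: S.one_eq_cls[of p])
qed (simp add: mem_D_iff)

lemma theta_one:
  assumes a: "a \<in> A"
  shows "\<theta> \<one>\<^bsub>S.G\<^esub> a = a"
proof -
  obtain p where "p \<in> S.E" "\<alpha> p = A.ran a" using a alpha_surj A.ran_mem_E by blast
  then show ?thesis using a theta_cls[of p a] by (simp add: S.one_eq_cls[of p] lam_idem)
qed

lemma theta_theta_minv:
  assumes x: "x \<in> carrier S.G" and y: "y \<in> carrier S.G"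
    and a: "a \<in> D (inv\<^bsub>S.G\<^esub> y)" "a \<in> D (inv\<^bsub>S.G\<^esub> y \<otimes>\<^bsub>S.G\<^esub> inv\<^bsub>S.G\<^esub> x)"
  shows "\<theta> x (\<theta> y a) = snd (minv (D x \<inter> D (x \<otimes>\<^bsub>S.G\<^esub> y)) mA (w x y))
    (fst (w x y) (\<theta> (x \<otimes>\<^bsub>S.G\<^esub> y) a))"
proof -
  obtain u v where uv: "u \<in> S" "v \<in> S" "x = S.cls u" "y = S.cls v" "S.dom u = S.ran v"
    "A.ran a = \<alpha> (S.dom v)"
    using D_inv_mult_obtain[OF x y a] by blast
  have aA: "a \<in> A" using y a by (simp add: mem_D_iff)
  define b where "b = lam (u \<cdot> v) a"
  have b: "b \<in> A" "A.ran b = \<alpha> (S.ran u)"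
    using uv aA by (simp_all add: b_def ran_lam S.dom_mult_composable S.ran_mult_composable)
  have theta_xy: "\<theta> (x \<otimes>\<^bsub>S.G\<^esub> y) a = b"
    using uv aA by (simp add: b_def theta_cls S.dom_mult_composable)
  have b_mem: "b \<in> D x \<inter> D (x \<otimes>\<^bsub>S.G\<^esub> y)"
    using uv b mem_D_clsI[of u b] mem_D_clsI[of "u \<cdot> v" b] by (simp add: S.ran_mult_composable)
  have "\<theta> x (\<theta> y a) = lam u (lam v a)" using uv aA by (simp add: theta_cls ran_lam)
  also have "\<dots> = A.conjugate (f u v) b" using uv aA by (simp add: lam_lam b_def)
  also have "f u v = snd (w x y) (A.ran b)" using uv b by (simp add: w_cls_idem)
  also have "A.conjugate (snd (w x y) (A.ran b)) b
      = snd (minv (D x \<inter> D (x \<otimes>\<^bsub>S.G\<^esub> y)) mA (w x y)) (fst (w x y) b)"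
    using x y b_mem by (intro A.snd_minv_fst[symmetric] A.ideal_inter ideal_D w_unit) auto
  finally show ?thesis by (simp add: theta_xy)
qed

lemma w_one:
  assumes x: "x \<in> carrier S.G" and a: "a \<in> D x"
  shows "fst (w \<one>\<^bsub>S.G\<^esub> x) a = a" "snd (w \<one>\<^bsub>S.G\<^esub> x) a = a"
    "fst (w x \<one>\<^bsub>S.G\<^esub>) a = a" "snd (w x \<one>\<^bsub>S.G\<^esub>) a = a"
proof -
  obtain s where s: "s \<in> S" "x = S.cls s" "a \<in> A" "A.ran a = \<alpha> (S.ran s)"
    using x a by (auto simp: mem_D_iff)
  have f: "f (S.ran s) s = A.ran a" "f s (S.dom s) = A.ran a"
    using s by (simp_all add: f_idem_left f_idem_right)
  show "fst (w \<one>\<^bsub>S.G\<^esub> x) a = a" "snd (w \<one>\<^bsub>S.G\<^esub> x) a = a"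
    using s f(1) w_cls[of "S.ran s" s a] A.ran_mult_self[of a] A.mult_ran_self[of a]
    by (simp_all add: S.one_eq_cls[of "S.ran s"])
  show "fst (w x \<one>\<^bsub>S.G\<^esub>) a = a" "snd (w x \<one>\<^bsub>S.G\<^esub>) a = a"
    using s f(2) w_cls[of s "S.dom s" a] A.ran_mult_self[of a] A.mult_ran_self[of a]
    by (simp_all add: S.one_eq_cls[of "S.dom s"])
qed

lemma w_cocycle:
  assumes x: "x \<in> carrier S.G" and y: "y \<in> carrier S.G" and z: "z \<in> carrier S.G"
    and a: "a \<in> D (inv\<^bsub>S.G\<^esub> x)" "a \<in> D y" "a \<in> D (y \<otimes>\<^bsub>S.G\<^esub> z)"
  shows "snd (w x (y \<otimes>\<^bsub>S.G\<^esub> z)) (\<theta> x (snd (w y z) a)) =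
    snd (w (x \<otimes>\<^bsub>S.G\<^esub> y) z) (snd (w x y) (\<theta> x a))"
proof -
  obtain v t where vt: "v \<in> S" "t \<in> S" "y = S.cls v" "z = S.cls t" "S.dom v = S.ran t"
    "A.ran a = \<alpha> (S.ran v)"
    using D_mult_obtain[OF y z a(2,3)] by blast
  obtain u where u: "u \<in> S" "x = S.cls u" "a \<in> A" "A.ran a = \<alpha> (S.dom u)"
    using a unfolding mem_D_inv_iff[OF x] by blast
  have uv: "S.dom u = S.ran v" using u vt by simp
  define b where "b = a \<odot> f v t"
  have b: "b \<in> A" "A.ran b = \<alpha> (S.dom u)"
    using u vt by (simp_all add: b_def A.ran_mult S.ran_mult_composable)
  have "snd (w x (y \<otimes>\<^bsub>S.G\<^esub> z)) (\<theta> x (snd (w y z) a)) = lam u b \<odot> f u (v \<cdot> t)"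
    using u vt uv b by (simp add: w_cls theta_cls ran_lam S.ran_mult_composable flip: b_def)
  also have "\<dots> = lam u a \<odot> (lam u (f v t) \<odot> f u (v \<cdot> t))"
    using u vt by (simp add: b_def lam_mult A.assoc)
  also have "\<dots> = lam u a \<odot> f u v \<odot> f (u \<cdot> v) t" using u vt by (simp add: f_cocycle A.assoc)
  also have "\<dots> = snd (w (x \<otimes>\<^bsub>S.G\<^esub> y) z) (snd (w x y) (\<theta> x a))"
    using u vt uv
    by (simp add: w_cls theta_cls ran_lam A.ran_mult S.ran_mult_composable S.dom_mult_composable)
  finally show ?thesis .
qed

lemma twisted_partial_action: "twisted_partial_action A mA S.G D \<theta> w"
  by unfold_locales
    (simp_all add: ideal_D theta_bij theta_mult w_unit D_one theta_one theta_image theta_theta_minv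
      w_one w_cocycle)

interpretation \<Theta>: twisted_partial_action A mA S.G D \<theta> w
  by (rule twisted_partial_action)

definition to_cross :: "'a \<Rightarrow> 'b \<times> 'a set" where "to_cross s = (\<alpha> (S.ran s), S.cls s)"

lemma inv_theta_alpha_ran:
  assumes "s \<in> S"
  shows "\<Theta>.inv_theta (S.cls s) (\<alpha> (S.ran s)) = \<alpha> (S.dom s)"
  using assms \<Theta>.inv_theta_theta[of "S.cls s" "\<alpha> (S.dom s)"]
    mem_D_clsI[of "S.inverse s" "\<alpha> (S.dom s)"]
  by (simp add: theta_cls)

lemma lmLam_to_cross:
  assumes "s \<in> S" "a \<in> A"
  shows "lmLam S.G mA D \<theta> (to_cross s) a = lam s a"
  using assms theta_cls_restrict[of s "\<alpha> (S.dom s) \<odot> a"]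
  by (simp add: lmLam_def to_cross_def inv_theta_alpha_ran lam_dom)

lemma lmLam_to_cross_alpha_ran:
  "s \<in> S \<Longrightarrow> t \<in> S \<Longrightarrow> lmLam S.G mA D \<theta> (to_cross s) (\<alpha> (S.ran t)) = \<alpha> (S.ran (s \<cdot> t))"
  by (simp add: lmLam_to_cross lam_alpha S.ran_mult_ran)

lemma to_cross_image: "to_cross ` S = cross_car S.G mA D"
proof (intro equalityI subsetI)
  fix q assume "q \<in> to_cross ` S"
  then obtain s where s: "s \<in> S" "q = to_cross s" by blast
  then have "\<alpha> (S.ran s) \<in> D (S.cls s)" using mem_D_clsI[of s "\<alpha> (S.ran s)"] by simp
  then show "q \<in> cross_car S.G mA D"
    using s by (simp add: to_cross_def cross_car_def A.mem_idems_ideal_iff ideal_D)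
next
  fix q assume "q \<in> cross_car S.G mA D"
  then obtain e x where q: "q = (e, x)" "x \<in> carrier S.G" "e \<in> D x" "e \<in> A.E"
    by (auto simp: cross_car_def A.mem_idems_ideal_iff ideal_D)
  then show "q \<in> to_cross ` S" by (auto simp: mem_D_iff to_cross_def)
qed

lemma to_cross_iso: "sg_iso to_cross S m (cross_car S.G mA D) (cross_mult S.G mA D \<theta>)"
  unfolding sg_iso_def
proof (intro conjI ballI)
  have "inj_on to_cross S"
    by (rule inj_onI, rule S.eq_if_cls_ran_eq) (auto simp: to_cross_def)
  then show "bij_betw to_cross S (cross_car S.G mA D)" by (simp add: bij_betw_def to_cross_image)
  fix s t assume st: "s \<in> S" "t \<in> S"
  then have "lmLam S.G mA D \<theta> (to_cross s) (fst (to_cross t)) = \<alpha> (S.ran (s \<cdot> t))"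
    by (simp add: to_cross_def[of t] lmLam_to_cross_alpha_ran)
  then show "to_cross (s \<cdot> t) = cross_mult S.G mA D \<theta> (to_cross s) (to_cross t)"
    using st by (simp add: to_cross_def cross_mult_def lmLam_def)
qed

lemma lmF_to_cross:
  assumes s: "s \<in> S" and t: "t \<in> S"
  shows "lmF S.G mA D \<theta> w (to_cross s) (to_cross t) = f s t"
proof -
  define u v where "u = s \<cdot> S.ran t" and "v = S.dom s \<cdot> t"
  have uv: "u \<in> S" "v \<in> S" "S.dom u = S.ran v" "S.ran u = S.ran (s \<cdot> t)"
    "S.cls u = S.cls s" "S.cls v = S.cls t"
    using s t by (simp_all add: u_def v_def S.dom_mult_idem S.ran_idem_mult S.ran_mult_ran)
  have "lmF S.G mA D \<theta> w (to_cross s) (to_cross t)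
      = snd (w (S.cls s) (S.cls t)) (lmLam S.G mA D \<theta> (to_cross s) (\<alpha> (S.ran t)))"
    by (simp add: lmF_def lmLam_def to_cross_def)
  also have "\<dots> = f u v" using s t uv w_cls_idem[of u v] by (simp add: lmLam_to_cross_alpha_ran)
  also have "\<dots> = f s (S.ran t \<cdot> (S.dom s \<cdot> t))" using s t by (simp add: u_def v_def f_mult_idem)
  also have "\<dots> = f s (S.dom s \<cdot> t)" using s t by (simp add: S.idem_left_comm[of "S.ran t"])
  also have "\<dots> = f s t" using s t by (simp add: f_dom_mult)
  finally show ?thesis .
qed

lemma to_cross_comp_eq:
  "tms_comp_eq S m A \<alpha> lam f lmAlpha (lmLam S.G mA D \<theta>) (lmF S.G mA D \<theta> w) to_cross"
  unfolding tms_comp_eq_def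
  by (simp add: lmLam_to_cross lmF_to_cross) (simp add: lmAlpha_def to_cross_def)

end

section \<open>The Sieben module of a twisted partial action\<close>

context twisted_partial_action
begin

abbreviation cross :: "('b \<times> 'g) set" where "cross \<equiv> cross_car G mA D"
abbreviation star :: "'b \<times> 'g \<Rightarrow> 'b \<times> 'g \<Rightarrow> 'b \<times> 'g" (infixl "\<star>" 70) where
  "star \<equiv> cross_mult G mA D \<theta>"
abbreviation lam :: "'b \<times> 'g \<Rightarrow> 'b \<Rightarrow> 'b" where "lam \<equiv> lmLam G mA D \<theta>"
abbreviation f :: "'b \<times> 'g \<Rightarrow> 'b \<times> 'g \<Rightarrow> 'b" where "f \<equiv> lmF G mA D \<theta> w"

definition src :: "'b \<times> 'g \<Rightarrow> 'b" where "src p = inv_theta (snd p) (fst p)"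

lemma pair_mem_cross_iff: "(e, x) \<in> cross \<longleftrightarrow> x \<in> carrier G \<and> e \<in> D x \<and> e \<in> A.E"
  unfolding cross_car_def by (auto simp: A.mem_idems_ideal_iff ideal_D)

lemma snd_cross [simp, intro]: "p \<in> cross \<Longrightarrow> snd p \<in> carrier G"
  and fst_cross_D: "p \<in> cross \<Longrightarrow> fst p \<in> D (snd p)"
  and fst_cross_E [simp, intro]: "p \<in> cross \<Longrightarrow> fst p \<in> A.E"
  using pair_mem_cross_iff[of "fst p" "snd p"] by simp_all

lemma lam_eq: "lam p a = \<theta> (snd p) (src p \<odot> a)"
  by (simp add: lmLam_def src_def)

lemma star_eq: "p \<star> q = (lam p (fst q), snd p \<otimes> snd q)"
  by (simp add: cross_mult_def lmLam_def)

lemma fst_star: "fst (p \<star> q) = lam p (fst q)" and snd_star [simp]: "snd (p \<star> q) = snd p \<otimes> snd q"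
  by (simp_all add: star_eq)

lemma f_eq: "f p q = twist (snd p) (snd q) (fst (p \<star> q))"
  by (simp add: lmF_def lmLam_def fst_star)

lemma src_idem [simp, intro]: "p \<in> cross \<Longrightarrow> src p \<in> A.E"
  and src_mem: "p \<in> cross \<Longrightarrow> src p \<in> D (inv (snd p))"
  and theta_src: "p \<in> cross \<Longrightarrow> \<theta> (snd p) (src p) = fst p"
  by (simp_all add: src_def fst_cross_D inv_theta_idem inv_theta_mem theta_inv_theta)

lemma src_closed [simp, intro]: "p \<in> cross \<Longrightarrow> src p \<in> A"
  by (rule A.idem_closed) auto

lemma lam_restr: "lam p = A.restr (\<theta> (snd p)) (src p)"
  by (simp add: fun_eq_iff lam_eq A.restr_def)

lemma lam_endo: "p \<in> cross \<Longrightarrow> endo A mA (lam p)"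
  unfolding lam_restr by (rule A.restr_endo[OF ideal_D theta_hom_on]) (auto simp: src_mem)

lemma lam_rel_invertible: "p \<in> cross \<Longrightarrow> rel_invertible A mA (lam p)"
  unfolding lam_restr
  by (rule A.restr_rel_invertible[OF ideal_D ideal_D theta_hom_on theta_bij]) (auto simp: src_mem)

lemma lam_absorb: "p \<in> cross \<Longrightarrow> a \<in> A \<Longrightarrow> fst p \<odot> lam p a = lam p a"
  using A.restr_absorb[OF ideal_D theta_hom_on, of "snd p" "src p" a]
  by (simp add: lam_restr src_mem theta_src)

lemma lam_closed [simp, intro]: "p \<in> cross \<Longrightarrow> a \<in> A \<Longrightarrow> lam p a \<in> A"
  and lam_mult: "p \<in> cross \<Longrightarrow> a \<in> A \<Longrightarrow> b \<in> A \<Longrightarrow> lam p (a \<odot> b) = lam p a \<odot> lam p b"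
  using lam_endo by (auto simp: endo_def)

lemma lam_mem_E [simp, intro]: "p \<in> cross \<Longrightarrow> e \<in> A.E \<Longrightarrow> lam p e \<in> A.E"
  using A.hom_on_idem[of A] lam_endo A.endo_iff_hom_on by blast

lemma lam_mem: "p \<in> cross \<Longrightarrow> a \<in> A \<Longrightarrow> lam p a \<in> D (snd p)"
  by (simp add: lam_eq theta_mem D_right src_mem)

lemma lam_mem_mult: "p \<in> cross \<Longrightarrow> y \<in> carrier G \<Longrightarrow> a \<in> D y \<Longrightarrow> lam p a \<in> D (snd p \<otimes> y)"
  using D_closed[of y a] by (simp add: lam_eq theta_mem_mult_iff D_left D_right src_mem)

lemma lam_src: "p \<in> cross \<Longrightarrow> lam p (src p) = fst p"
  by (simp add: lam_eq theta_src)

lemma star_closed [simp, intro]: "p \<in> cross \<Longrightarrow> q \<in> cross \<Longrightarrow> p \<star> q \<in> cross"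
  by (simp add: star_eq pair_mem_cross_iff lam_mem_mult fst_cross_D)

lemma fst_star_mem: "p \<in> cross \<Longrightarrow> q \<in> cross \<Longrightarrow> fst (p \<star> q) \<in> D (snd p)"
  by (simp add: fst_star lam_mem)

lemma f_closed: "p \<in> cross \<Longrightarrow> q \<in> cross \<Longrightarrow> f p q \<in> A"
  and ran_f: "p \<in> cross \<Longrightarrow> q \<in> cross \<Longrightarrow> A.ran (f p q) = fst (p \<star> q)"
  and f_restrict: "p \<in> cross \<Longrightarrow> q \<in> cross \<Longrightarrow> e \<in> A.E \<Longrightarrow> fst (p \<star> q) \<odot> e = e \<Longrightarrow>
      f p q \<odot> e = twist (snd p) (snd q) e"
  using fst_star_mem[of p q] fst_cross_D[of "p \<star> q"]
  by (auto simp: f_eq twist_closed ran_twist simp flip: twist_restrict)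

subsection \<open>The composition law\<close>

lemma src_star:
  assumes p: "p \<in> cross" and q: "q \<in> cross"
  shows "\<theta> (snd q) (src (p \<star> q)) = src p \<odot> fst q"
    and "src (p \<star> q) \<in> D (inv (snd q))"
    and "src (p \<star> q) \<in> D (inv (snd q) \<otimes> inv (snd p))"
    and "src (p \<star> q) \<odot> src q = src (p \<star> q)"
proof -
  define x y where "x = snd p" and "y = snd q"
  have xy: "x \<in> carrier G" "y \<in> carrier G" using p q by (simp_all add: x_def y_def)
  define h where "h = src p \<odot> fst q"
  have h: "h \<in> A.E" "h \<in> D (inv x)" "h \<in> D y"
    using p q xy src_mem[OF p] fst_cross_D[OF q] by (simp_all add: h_def D_left D_right x_def y_def)
  define k where "k = inv_theta y h"
  have k: "k \<in> A.E" "k \<in> D (inv y)" "\<theta> y k = h"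
    using xy h by (simp_all add: k_def inv_theta_idem inv_theta_mem theta_inv_theta)
  have "y \<otimes> (inv y \<otimes> inv x) = inv x" using xy by (simp flip: G.m_assoc)
  then have kx: "k \<in> D (inv y \<otimes> inv x)"
    using theta_mem_mult_iff[of y "inv y \<otimes> inv x" k] xy h k by simp
  have "fst (p \<star> q) = \<theta> x (\<theta> y k)" using k by (simp add: fst_star lam_eq h_def x_def)
  also have "\<dots> = \<theta> (x \<otimes> y) k" using xy k(1,2) kx by (simp add: theta_theta_idem)
  finally have "src (p \<star> q) = inv_theta (x \<otimes> y) (\<theta> (x \<otimes> y) k)"
    by (simp add: src_def x_def y_def)
  also have "\<dots> = k" using xy kx by (simp add: inv_theta_theta G.inv_mult_group)
  finally have src: "src (p \<star> q) = k" .
  show "\<theta> (snd q) (src (p \<star> q)) = src p \<odot> fst q" "src (p \<star> q) \<in> D (inv (snd q))"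
    "src (p \<star> q) \<in> D (inv (snd q) \<otimes> inv (snd p))"
    using k kx by (simp_all add: src h_def x_def y_def)
  have "\<theta> y (k \<odot> src q) = h \<odot> fst q"
    using xy q k src_mem[OF q] theta_src[OF q] by (simp add: theta_mult y_def)
  also have "\<dots> = \<theta> y k" using p q k by (simp add: h_def A.assoc)
  finally show "src (p \<star> q) \<odot> src q = src (p \<star> q)"
    using xy q k theta_eq_iff[of y "k \<odot> src q" k] by (simp add: src D_right)
qed

lemma lam_lam_eq_theta_theta:
  assumes p: "p \<in> cross" and q: "q \<in> cross" and a: "a \<in> A"
  shows "lam p (lam q a) = \<theta> (snd p) (\<theta> (snd q) (src (p \<star> q) \<odot> a))"
proof -
  have "\<theta> (snd q) (src (p \<star> q) \<odot> a) = \<theta> (snd q) (src (p \<star> q) \<odot> (src q \<odot> a))"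
    using p q a src_star(4)[OF p q] by (simp flip: A.assoc)
  also have "\<dots> = src p \<odot> fst q \<odot> lam q a"
    using p q a src_star(1,2)[OF p q] by (simp add: theta_mult D_right src_mem lam_eq)
  also have "\<dots> = src p \<odot> lam q a" using p q a by (simp add: A.assoc lam_absorb)
  finally show ?thesis by (simp add: lam_eq[of p])
qed

lemma lam_lam:
  assumes p: "p \<in> cross" and q: "q \<in> cross" and a: "a \<in> A"
  shows "lam p (lam q a) = A.conjugate (f p q) (lam (p \<star> q) a)"
proof -
  define x y b where "x = snd p" and "y = snd q" and "b = lam (p \<star> q) a"
  have xy: "x \<in> carrier G" "y \<in> carrier G" using p q by (simp_all add: x_def y_def)
  have "lam p (lam q a) = A.conjugate (twist x y (A.ran b)) b"
    using p q a xy src_star(2,3)[OF p q]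
    by (simp add: lam_lam_eq_theta_theta theta_theta D_right b_def x_def y_def lam_eq[of "p \<star> q"])
  also have "\<dots> = A.conjugate (twist x y (fst (p \<star> q))) b"
    using p q a xy fst_star_mem[OF p q] fst_cross_D[of "p \<star> q"]
    by (intro A.conjugate_group_section[OF twist_section])
      (simp_all add: b_def lam_absorb x_def y_def)
  finally show ?thesis by (simp add: f_eq b_def x_def y_def)
qed

lemma lam_lam_idem:
  assumes p: "p \<in> cross" and q: "q \<in> cross" and e: "e \<in> A.E"
  shows "lam p (lam q e) = lam (p \<star> q) e"
proof -
  have "A.ran (f p q) \<odot> lam (p \<star> q) e = lam (p \<star> q) e"
    using p q e by (simp add: ran_f lam_absorb)
  then have "A.conjugate (f p q) (lam (p \<star> q) e) = lam (p \<star> q) e"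
    using p q e by (intro A.conjugate_idem) (auto simp: f_closed)
  then show ?thesis using p q e by (simp add: lam_lam)
qed

lemma lam_f:
  assumes p: "p \<in> cross" and q: "q \<in> cross" and r: "r \<in> cross"
  shows "lam p (f q r) = \<theta> (snd p) (twist (snd q) (snd r) (src p \<odot> fst (q \<star> r)))"
proof -
  have "src p \<odot> f q r = f q r \<odot> src p" using p q r by (intro A.idem_central) (auto simp: f_closed)
  also have "\<dots> = twist (snd q) (snd r) (fst (q \<star> r) \<odot> src p)"
    using p q r fst_star_mem[OF q r] fst_cross_D[of "q \<star> r"] by (simp add: f_eq twist_restrict)
  also have "fst (q \<star> r) \<odot> src p = src p \<odot> fst (q \<star> r)" using p q r by (intro A.idem_comm) auto
  finally show ?thesis by (simp add: lam_eq)
qed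

lemma f_cocycle:
  assumes p: "p \<in> cross" and q: "q \<in> cross" and r: "r \<in> cross"
  shows "lam p (f q r) \<odot> f p (q \<star> r) = f p q \<odot> f (p \<star> q) r"
proof -
  define x y z where "x = snd p" and "y = snd q" and "z = snd r"
  have xyz: "x \<in> carrier G" "y \<in> carrier G" "z \<in> carrier G"
    using p q r by (simp_all add: x_def y_def z_def)
  define i where "i = src p \<odot> fst (q \<star> r)"
  have i: "i \<in> D (inv x)" "i \<in> D y" "i \<in> D (y \<otimes> z)" "i \<in> A.E"
    using p q r xyz src_mem[OF p] fst_star_mem[OF q r] fst_cross_D[of "q \<star> r"]
    by (simp_all add: i_def D_left D_right x_def y_def z_def)
  define t where "t = \<theta> x i"
  have t_star: "t = fst (p \<star> (q \<star> r))" by (simp add: t_def i_def fst_star[of p] lam_eq x_def)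
  also have "\<dots> = fst (p \<star> q \<star> r)" using p q r by (simp add: fst_star lam_lam_idem)
  finally have t_assoc: "t = fst (p \<star> q \<star> r)" .
  have f_pqr: "f (p \<star> q) r = twist (x \<otimes> y) z t" by (simp add: f_eq t_assoc x_def y_def z_def)
  have t: "t \<in> A.E" "fst (p \<star> q) \<odot> t = t"
    using p q r by (simp_all add: t_assoc) (simp add: fst_star[of "p \<star> q"] lam_absorb)
  have "lam p (f q r) \<odot> f p (q \<star> r) = \<theta> x (twist y z i) \<odot> twist x (y \<otimes> z) t"
    using p q r by (simp add: lam_f f_eq[of p "q \<star> r"] x_def y_def z_def flip: i_def t_star)
  also have "\<dots> = twist x y t \<odot> twist (x \<otimes> y) z t"
    unfolding t_def using xyz i by (rule twist_cocycle)
  also have "\<dots> = f p q \<odot> t \<odot> f (p \<star> q) r"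
    using f_restrict[OF p q t] by (simp add: f_pqr x_def y_def)
  also have "\<dots> = f p q \<odot> (A.ran (f (p \<star> q) r) \<odot> f (p \<star> q) r)"
    using p q r t by (simp add: A.assoc f_closed ran_f t_assoc del: A.ran_mult_self)
  also have "\<dots> = f p q \<odot> f (p \<star> q) r" using p q r by (simp add: f_closed)
  finally show ?thesis .
qed

subsection \<open>The semigroup \<open>E(A) *\<^sub>\<theta> G\<close>\<close>

lemma lam_one: "e \<in> A.E \<Longrightarrow> a \<in> A \<Longrightarrow> lam (e, \<one>) a = e \<odot> a"
  using inv_theta_theta[of \<one> e] by (simp add: lam_eq src_def)

lemma idem_one_mem: "e \<in> A.E \<Longrightarrow> (e, \<one>) \<in> cross"
  by (auto simp: pair_mem_cross_iff)

lemma idems_cross: "idems cross (\<star>) = (\<lambda>e. (e, \<one>)) ` A.E"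
proof (intro equalityI subsetI)
  fix p assume "p \<in> idems cross (\<star>)"
  then have p: "p \<in> cross" "p \<star> p = p" by (auto simp: idems_def)
  then have "snd p \<otimes> snd p = snd p" by (metis snd_star)
  then have "p = (fst p, \<one>)" using p by (simp add: prod_eq_iff G.r_cancel_one')
  then show "p \<in> (\<lambda>e. (e, \<one>)) ` A.E" using p by blast
next
  fix p assume "p \<in> (\<lambda>e. (e, \<one>)) ` A.E"
  then obtain e where "p = (e, \<one>)" "e \<in> A.E" by blast
  then have "p \<in> cross" "p \<star> p = p" by (simp_all add: idem_one_mem star_eq lam_one)
  then show "p \<in> idems cross (\<star>)" unfolding idems_def by blast
qed

lemma snd_idems_cross: "e \<in> idems cross (\<star>) \<Longrightarrow> snd e = \<one>"
  by (auto simp: idems_cross)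

definition cross_inverse :: "'b \<times> 'g \<Rightarrow> 'b \<times> 'g" where "cross_inverse p = (src p, inv (snd p))"

lemma cross_inverse_closed: "p \<in> cross \<Longrightarrow> cross_inverse p \<in> cross"
  by (simp add: cross_inverse_def pair_mem_cross_iff src_mem)

lemma star_cross_inverse: "p \<in> cross \<Longrightarrow> p \<star> cross_inverse p = (fst p, \<one>)"
  by (simp add: cross_inverse_def star_eq lam_src)

lemma cross_inverse_star:
  assumes p: "p \<in> cross"
  shows "cross_inverse p \<star> p = (src p, \<one>)"
proof -
  have x: "snd p \<in> carrier G" "fst p \<in> D (snd p)" "fst p \<in> A.E" using p by (auto simp: fst_cross_D)
  have "inv_theta (inv (snd p)) (\<theta> (inv (snd p)) (fst p)) = fst p"
    using x by (simp add: inv_theta_theta)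
  then have "inv_theta (inv (snd p)) (src p) = fst p" using x by (simp add: theta_inv src_def)
  then have "lam (cross_inverse p) (fst p) = src p"
    using x by (simp add: lam_eq cross_inverse_def theta_inv src_def)
  then show ?thesis using x by (simp add: star_eq) (simp add: cross_inverse_def)
qed

lemma is_inverse_of_cross_inverse:
  assumes p: "p \<in> cross"
  shows "is_inverse_of cross (\<star>) p (cross_inverse p)"
proof -
  have "p \<star> cross_inverse p \<star> p = p"
    using p by (simp add: star_cross_inverse) (simp add: star_eq lam_one prod_eq_iff)
  moreover have "cross_inverse p \<star> p \<star> cross_inverse p = cross_inverse p"
    using p by (simp add: cross_inverse_star) (simp add: cross_inverse_def star_eq lam_one)
  ultimately show ?thesis using p by (simp add: is_inverse_of_def cross_inverse_closed)
qed

lemma star_assoc: "p \<in> cross \<Longrightarrow> q \<in> cross \<Longrightarrow> r \<in> cross \<Longrightarrow> p \<star> q \<star> r = p \<star> (q \<star> r)"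
  by (simp add: prod_eq_iff G.m_assoc fst_star lam_lam_idem)

lemma cross_inverse_semigroup: "inverse_semigroup cross (\<star>)"
proof (rule inverse_semigroupI)
  show "cross \<noteq> {}" using idem_one_mem A.idem_exists by blast
  show "sg_on cross (\<star>)" by (simp add: sg_on_def star_assoc)
  show "\<exists>q. is_inverse_of cross (\<star>) p q" if "p \<in> cross" for p
    using is_inverse_of_cross_inverse that by blast
  show "p \<star> q = q \<star> p" if "p \<in> idems cross (\<star>)" "q \<in> idems cross (\<star>)" for p q
    using that by (auto simp: idems_cross star_eq lam_one A.idem_comm)
qed

lemma cross_E_unitary: "E_unitary cross (\<star>)"
  unfolding E_unitary_def
proof (intro ballI impI)
  fix e p assume e: "e \<in> idems cross (\<star>)" and p: "p \<in> cross" and "nat_le cross (\<star>) e p"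
  then obtain k where k: "k \<in> idems cross (\<star>)" "e = k \<star> p" by (auto simp: nat_le_def)
  then have "snd p = \<one>" using e p snd_idems_cross[of e] snd_idems_cross[of k] by simp
  then have "p = (fst p, \<one>)" by (simp add: prod_eq_iff)
  then show "p \<in> idems cross (\<star>)" unfolding idems_cross using p by blast
qed

sublocale C: E_unitary_semigroup cross "(\<star>)"
  by unfold_locales (fact cross_inverse_semigroup cross_E_unitary)+

lemma inverse_cross: "p \<in> cross \<Longrightarrow> C.inverse p = cross_inverse p"
  using is_inverse_of_cross_inverse[of p] by (intro C.inverse_eqI) (auto simp: is_inverse_of_def)

lemma ran_cross: "p \<in> cross \<Longrightarrow> C.ran p = (fst p, \<one>)"
  by (simp add: C.ran_def inverse_cross star_cross_inverse)

lemma dom_cross: "p \<in> cross \<Longrightarrow> C.dom p = (src p, \<one>)"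
  by (simp add: C.dom_def inverse_cross cross_inverse_star)

lemma lmAlpha_ran [simp]: "p \<in> cross \<Longrightarrow> lmAlpha (C.ran p) = fst p"
  and lmAlpha_dom [simp]: "p \<in> cross \<Longrightarrow> lmAlpha (C.dom p) = src p"
  by (simp_all add: lmAlpha_def ran_cross dom_cross)

lemma f_idem:
  assumes p: "p \<in> cross" and e: "e \<in> C.E"
  shows "f p e = fst (p \<star> e)" and "f e p = fst (e \<star> p)"
proof -
  have e_mem: "e \<in> cross" "snd e = \<one>" using e by (auto simp: snd_idems_cross)
  show "f p e = fst (p \<star> e)" using p e_mem fst_star_mem[of p e] by (simp add: f_eq twist_one)
  show "f e p = fst (e \<star> p)" using p e_mem fst_cross_D[of "e \<star> p"] by (simp add: f_eq twist_one)
qed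

sublocale \<Lambda>: E_unitary_sieben_module A mA cross "(\<star>)" lmAlpha lam f
proof unfold_locales
  show "bij_betw lmAlpha C.E A.E"
    unfolding idems_cross by (rule bij_betw_imageI) (auto simp: lmAlpha_def inj_on_def image_image)
  show "lmAlpha (p \<star> q) = lmAlpha p \<odot> lmAlpha q" if "p \<in> C.E" "q \<in> C.E" for p q
    using that by (auto simp: idems_cross lmAlpha_def fst_star lam_one)
  show "lam p a = lmAlpha p \<odot> a" if "p \<in> C.E" "a \<in> A" for p a
    using that by (auto simp: idems_cross lmAlpha_def lam_one)
  show "lam p (lmAlpha e) = lmAlpha (C.ran (p \<star> e))" if "p \<in> cross" "e \<in> C.E" for p e
    using that by (simp add: fst_star) (simp add: lmAlpha_def)
qed (simp_all add: lam_rel_invertible f_closed ran_f lam_lam f_idem f_cocycle)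

subsection \<open>The group \<open>G\<close> as the maximum group image\<close>

definition to_maxgrp :: "'g \<Rightarrow> ('b \<times> 'g) set" where "to_maxgrp x = {p \<in> cross. snd p = x}"

lemma cls_cross:
  assumes p: "p \<in> cross"
  shows "C.cls p = to_maxgrp (snd p)"
proof (intro equalityI subsetI)
  fix q assume "q \<in> C.cls p"
  then obtain e where q: "q \<in> cross" and e: "e \<in> C.E" "e \<star> p = e \<star> q" by (auto simp: C.mem_cls_iff)
  then have "snd e \<otimes> snd p = snd e \<otimes> snd q" by (metis snd_star)
  then have "snd q = snd p" using p q e by (simp add: snd_idems_cross)
  then show "q \<in> to_maxgrp (snd p)" using q by (simp add: to_maxgrp_def)
next
  fix q assume "q \<in> to_maxgrp (snd p)"
  then have q: "q \<in> cross" "snd q = snd p" by (auto simp: to_maxgrp_def)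
  define e where "e = (fst p \<odot> fst q, \<one>)"
  have "fst p \<odot> fst q \<odot> fst p = fst p \<odot> fst q \<odot> fst q"
    using p q by (simp add: A.assoc A.idem_comm[of "fst q" "fst p"])
  then have "e \<star> p = e \<star> q" using p q by (simp add: e_def star_eq lam_one)
  moreover have "e \<in> C.E" using p q by (auto simp: idems_cross e_def)
  ultimately show "q \<in> C.cls p" unfolding C.mem_cls_iff using q by blast
qed

lemma cross_over:
  assumes "x \<in> carrier G"
  obtains p where "p \<in> cross" "snd p = x"
proof -
  obtain e where "e \<in> D x" "e \<in> A.E" using A.ideal_idem_exists[OF ideal_D[OF assms]] by blast
  then show thesis using that[of "(e, x)"] assms by (simp add: pair_mem_cross_iff)
qed

lemma to_maxgrp_carrier: "x \<in> carrier G \<Longrightarrow> to_maxgrp x \<in> carrier C.G"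
  by (metis C.cls_carrier cls_cross cross_over)

lemma to_maxgrp_mult:
  assumes "x \<in> carrier G" "y \<in> carrier G"
  shows "to_maxgrp (x \<otimes> y) = to_maxgrp x \<otimes>\<^bsub>C.G\<^esub> to_maxgrp y"
proof -
  obtain p q where "p \<in> cross" "snd p = x" "q \<in> cross" "snd q = y"
    using assms cross_over by metis
  then show ?thesis using C.cls_mult_cls[of p q] by (simp add: cls_cross)
qed

lemma to_maxgrp_inject: "x \<in> carrier G \<Longrightarrow> to_maxgrp x = to_maxgrp y \<Longrightarrow> x = y"
  by (rule cross_over[of x]) (auto simp: to_maxgrp_def)

lemma to_maxgrp_iso: "to_maxgrp \<in> iso G C.G"
  unfolding iso_def mem_Collect_eq
proof
  show "to_maxgrp \<in> hom G C.G" by (auto simp: hom_def to_maxgrp_carrier to_maxgrp_mult)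
  have "carrier C.G \<subseteq> to_maxgrp ` carrier G"
    unfolding C.carrier_G by (auto simp: cls_cross)
  then show "bij_betw to_maxgrp (carrier G) (carrier C.G)"
    by (intro bij_betw_imageI inj_onI) (auto simp: to_maxgrp_carrier intro: to_maxgrp_inject)
qed

lemma D_to_maxgrp:
  assumes x: "x \<in> carrier G"
  shows "\<Lambda>.D (to_maxgrp x) = D x"
proof -
  have "a \<in> \<Lambda>.D (to_maxgrp x) \<longleftrightarrow> a \<in> A \<and> (A.ran a, x) \<in> cross" for a
  proof -
    have "a \<in> \<Lambda>.D (to_maxgrp x) \<longleftrightarrow>
        a \<in> A \<and> (\<exists>p\<in>cross. to_maxgrp x = C.cls p \<and> A.ran a = lmAlpha (C.ran p))"
      using x by (simp add: \<Lambda>.mem_D_iff to_maxgrp_carrier)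
    also have "\<dots> \<longleftrightarrow> a \<in> A \<and> (\<exists>p\<in>cross. snd p = x \<and> A.ran a = fst p)"
      using x to_maxgrp_inject by (auto simp: cls_cross)
    finally show ?thesis by force
  qed
  then show ?thesis using x D_closed[OF x] by (auto simp: pair_mem_cross_iff D_ran_iff)
qed

lemma theta_to_maxgrp:
  assumes x: "x \<in> carrier G" and a: "a \<in> D (inv x)"
  shows "\<Lambda>.\<theta> (to_maxgrp x) a = \<theta> x a"
proof -
  have aA: "a \<in> A" "A.ran a \<in> D (inv x)"
    using x a D_closed[of "inv x" a] by (simp_all add: D_ran_iff)
  define p where "p = (\<theta> x (A.ran a), x)"
  have p: "p \<in> cross" using x aA by (simp add: p_def pair_mem_cross_iff theta_mem theta_idem)
  have src: "src p = A.ran a" using x aA by (simp add: src_def p_def inv_theta_theta)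
  have "\<Lambda>.\<theta> (to_maxgrp x) a = lam p a"
    using p src aA \<Lambda>.theta_cls[of p a] by (simp add: cls_cross) (simp add: p_def)
  then show ?thesis using aA by (simp add: lam_eq src) (simp add: p_def)
qed

lemma w_to_maxgrp:
  assumes x: "x \<in> carrier G" and y: "y \<in> carrier G" and a: "a \<in> D x" "a \<in> D (x \<otimes> y)"
  shows "fst (\<Lambda>.w (to_maxgrp x) (to_maxgrp y)) a = fst (w x y) a"
    and "snd (\<Lambda>.w (to_maxgrp x) (to_maxgrp y)) a = snd (w x y) a"
proof -
  have ran: "A.ran a \<in> D x" "A.ran a \<in> D (x \<otimes> y)" "A.ran a \<in> A.E"
    using x y a D_closed[of x a] by (simp_all add: D_ran_iff)
  define p where "p = (A.ran a, x)"
  have p: "p \<in> cross" "snd p = x" "fst p = A.ran a"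
    using x ran by (simp_all add: p_def pair_mem_cross_iff)
  define q where "q = (src p, y)"
  have "src p \<in> D y"
    using x y p ran src_mem[of p] theta_src[of p] theta_mem_mult_iff[of x y "src p"] by simp
  then have q: "q \<in> cross" "snd q = y" "fst q = src p"
    using y p by (simp_all add: q_def pair_mem_cross_iff)
  have "C.dom p = C.ran q" using p q by (simp add: dom_cross ran_cross)
  moreover have "f p q = twist x y (A.ran a)" using p q by (simp add: f_eq fst_star lam_src)
  ultimately show "fst (\<Lambda>.w (to_maxgrp x) (to_maxgrp y)) a = fst (w x y) a"
    "snd (\<Lambda>.w (to_maxgrp x) (to_maxgrp y)) a = snd (w x y) a"
    using p q x y a \<Lambda>.w_cls[of p q a] by (simp_all add: cls_cross w_eq)
qed

lemma to_maxgrp_comp_eq: "tpa_comp_eq G mA D \<theta> w \<Lambda>.D \<Lambda>.\<theta> \<Lambda>.w to_maxgrp"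
  unfolding tpa_comp_eq_def
  by (auto simp: D_to_maxgrp theta_to_maxgrp w_to_maxgrp A.setprod_ideal ideal_D)

end

section \<open>Equivalence\<close>

locale sieben_module_equiv = sieben_module A mA S m \<alpha> lam f + L': sieben_module A mA S m \<alpha>' lam' f'
  for A :: "'b set" and mA :: "'b \<Rightarrow> 'b \<Rightarrow> 'b" (infixl "\<odot>" 70)
    and S :: "'a set" and m :: "'a \<Rightarrow> 'a \<Rightarrow> 'a" (infixl "\<cdot>" 70) and \<alpha> lam f \<alpha>' lam' f' +
  fixes g :: "'a \<Rightarrow> 'b"
  assumes alpha'_eq [simp]: "p \<in> S.E \<Longrightarrow> \<alpha>' p = \<alpha> p"
    and g_closed [simp, intro]: "s \<in> S \<Longrightarrow> g s \<in> A"
    and ran_g [simp]: "s \<in> S \<Longrightarrow> A.ran (g s) = \<alpha> (S.ran s)"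
    and lam'_eq: "s \<in> S \<Longrightarrow> a \<in> A \<Longrightarrow> lam' s a = A.conjugate (g s) (lam s a)"
    and f'_mult_g: "s \<in> S \<Longrightarrow> t \<in> S \<Longrightarrow> f' s t \<odot> g (s \<cdot> t) = g s \<odot> lam s (g t) \<odot> f s t"
begin

lemma alpha_ran_mult_g: "s \<in> S \<Longrightarrow> \<alpha> (S.ran s) \<odot> g s = g s"
  using A.ran_mult_self[of "g s"] by simp

lemma g_idem:
  assumes p: "p \<in> S.E"
  shows "g p = \<alpha> p"
proof -
  have absorb: "\<alpha> p \<odot> g p = g p" "g p \<odot> \<alpha> p = g p"
    using p alpha_ran_mult_g[of p] A.mult_ran_self[of "g p"] by simp_all
  have "\<alpha> p \<odot> g p = g p \<odot> (\<alpha> p \<odot> g p) \<odot> \<alpha> p"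
    using f'_mult_g[of p p] p by (simp add: f_idem_right L'.f_idem_right lam_idem)
  then have "g p \<odot> g p = g p" using absorb p by (simp add: A.assoc)
  then have "g p \<in> A.E" using p by (intro A.idemI) auto
  then show ?thesis using p by (metis A.ran_idem S.idem_closed S.ran_idem ran_g)
qed

lemma g_idem_mult:
  assumes p: "p \<in> S.E" and s: "s \<in> S"
  shows "g (p \<cdot> s) = \<alpha> p \<odot> g s"
proof -
  have "g (p \<cdot> s) = \<alpha> (S.ran (p \<cdot> s)) \<odot> g (p \<cdot> s)" using p s by (simp add: alpha_ran_mult_g)
  also have "\<dots> = \<alpha> p \<odot> g s \<odot> \<alpha> (S.ran (p \<cdot> s))"
    using f'_mult_g[of p s] p s by (simp add: f_idem_left L'.f_idem_left lam_idem g_idem)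
  also have "\<alpha> (S.ran (p \<cdot> s)) = A.ran (\<alpha> p \<odot> g s)"
    using p s by (simp add: A.ran_mult alpha_ran_idem_mult)
  also have "\<alpha> p \<odot> g s \<odot> A.ran (\<alpha> p \<odot> g s) = \<alpha> p \<odot> g s" using p s by simp
  finally show ?thesis .
qed

lemma lam'_mult_g:
  assumes s: "s \<in> S" and a: "a \<in> A"
  shows "lam' s a \<odot> g s = g s \<odot> lam s a"
proof -
  have "lam' s a \<odot> g s = g s \<odot> (lam s a \<odot> \<alpha> (S.ran s))"
    using s a by (simp add: lam'_eq A.conjugate_def A.assoc)
  then show ?thesis
    using s a A.idem_central[of "\<alpha> (S.ran s)" "lam s a"] by (simp add: lam_absorb)
qed

lemma twisted_cocycle_mult:
  assumes s: "s \<in> S" and t: "t \<in> S" and a: "a \<in> A"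
  shows "lam' s a \<odot> f' s t \<odot> g (s \<cdot> t) = g s \<odot> lam s (a \<odot> g t) \<odot> f s t"
proof -
  have "lam' s a \<odot> f' s t \<odot> g (s \<cdot> t) = lam' s a \<odot> (g s \<odot> lam s (g t) \<odot> f s t)"
    using s t a by (simp add: A.assoc f'_mult_g L'.lam_closed L'.f_closed)
  also have "\<dots> = lam' s a \<odot> g s \<odot> lam s (g t) \<odot> f s t"
    using s t a by (simp add: A.assoc L'.lam_closed)
  also have "\<dots> = g s \<odot> lam s (a \<odot> g t) \<odot> f s t"
    using s t a by (simp add: lam'_mult_g lam_mult A.assoc)
  finally show ?thesis .
qed

end

lemma ex_sieben_module_equiv:
  assumes "sieben_module A mA S m \<alpha> lam f" and "sieben_module A mA S m \<alpha>' lam' f'"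
    and equiv: "tms_equiv S m A mA \<alpha> lam f \<alpha>' lam' f'"
  shows "\<exists>g. sieben_module_equiv A mA S m \<alpha> lam f \<alpha>' lam' f' g"
proof -
  interpret sieben_module A mA S m \<alpha> lam f by fact
  interpret L': sieben_module A mA S m \<alpha>' lam' f' by fact
  obtain g where g: "\<forall>s\<in>S. g s \<in> Agrp A mA (\<alpha> (S.ran s)) \<and>
      (\<forall>a\<in>A. lam' s a = A.conjugate (g s) (lam s a)) \<and>
      (\<forall>t\<in>S. mA (f' s t) (g (m s t)) = mA (mA (g s) (lam s (g t))) (f s t))"
    using equiv unfolding tms_equiv_def A.conjugate_def S.ran_def by blast
  have "sieben_module_equiv A mA S m \<alpha> lam f \<alpha>' lam' f' g"
    by unfold_locales (use equiv g in \<open>simp_all add: tms_equiv_def A.mem_Agrp_iff\<close>)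
  then show ?thesis by blast
qed

locale E_unitary_sieben_module_equiv =
  E_unitary_sieben_module A mA S m \<alpha> lam f + L': E_unitary_sieben_module A mA S m \<alpha>' lam' f' +
  sieben_module_equiv A mA S m \<alpha> lam f \<alpha>' lam' f' g
  for A :: "'b set" and mA :: "'b \<Rightarrow> 'b \<Rightarrow> 'b" (infixl "\<odot>" 70)
    and S :: "'a set" and m :: "'a \<Rightarrow> 'a \<Rightarrow> 'a" (infixl "\<cdot>" 70) and \<alpha> lam f \<alpha>' lam' f' g
begin

definition eps :: "'a set \<Rightarrow> ('b \<Rightarrow> 'b) \<times> ('b \<Rightarrow> 'b)" where
  "eps x = (\<lambda>a. g (pick_r S m A mA \<alpha> x a) \<odot> a, \<lambda>a. a \<odot> g (pick_r S m A mA \<alpha> x a))"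

lemma eps_cls:
  assumes "s \<in> S" "A.ran a = \<alpha> (S.ran s)"
  shows "fst (eps (S.cls s)) a = g s \<odot> a" and "snd (eps (S.cls s)) a = a \<odot> g s"
  using assms by (simp_all add: eps_def pick_r_cls)

lemma eps_group_section:
  assumes x: "x \<in> carrier S.G"
  shows "A.group_section (D x) (snd (eps x))"
  unfolding A.group_section_def
proof (intro ballI impI)
  fix e assume "e \<in> D x" "e \<in> A.E"
  then obtain s where s: "s \<in> S" "x = S.cls s" and e: "e = \<alpha> (S.ran s)"
    using x by (auto simp: mem_D_iff)
  have "snd (eps x) (e \<odot> k) = g s \<odot> k" if k: "k \<in> A.E" for k
  proof -
    obtain p where p: "p \<in> S.E" "\<alpha> p = k" using k alpha_surj by blast
    have "e \<odot> k = \<alpha> (S.ran (p \<cdot> s))" using s e k p by (simp add: alpha_ran_idem_mult A.idem_comm)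
    then have "snd (eps x) (e \<odot> k) = g (p \<cdot> s)"
      using s p eps_cls(2)[of "p \<cdot> s" "e \<odot> k"] alpha_ran_mult_g[of "p \<cdot> s"] by simp
    also have "\<dots> = g s \<odot> k" using s p k by (simp add: g_idem_mult A.idem_central[of k "g s"])
    finally show ?thesis .
  qed
  moreover have "snd (eps x) e = g s" using s e by (simp add: eps_cls alpha_ran_mult_g)
  ultimately show "snd (eps x) e \<in> A \<and> A.ran (snd (eps x) e) = e \<and>
      (\<forall>k\<in>A.E. snd (eps x) (e \<odot> k) = snd (eps x) e \<odot> k)"
    using s e by simp
qed

lemma eps_unit:
  assumes x: "x \<in> carrier S.G"
  shows "is_unit_multiplier (D x) mA (eps x)"
proof (rule A.unit_multiplierI)
  fix a assume "a \<in> D x"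
  then obtain s where "s \<in> S" "x = S.cls s" "A.ran a = \<alpha> (S.ran s)"
    using x by (auto simp: mem_D_iff)
  then show "fst (eps x) a = snd (eps x) (A.ran a) \<odot> a \<and>
      snd (eps x) a = a \<odot> snd (eps x) (A.ran a)"
    by (simp add: eps_cls alpha_ran_mult_g)
qed (use x in \<open>simp_all add: eps_group_section ideal_D\<close>)

lemma D'_eq: "x \<in> carrier S.G \<Longrightarrow> L'.D x = D x"
  by (auto simp: set_eq_iff mem_D_iff L'.mem_D_iff)

lemma theta'_cls: "s \<in> S \<Longrightarrow> a \<in> A \<Longrightarrow> A.ran a = \<alpha> (S.dom s) \<Longrightarrow> L'.\<theta> (S.cls s) a = lam' s a"
  by (simp add: L'.theta_cls)

lemma theta'_minv:
  assumes x: "x \<in> carrier S.G" and a: "a \<in> D (inv\<^bsub>S.G\<^esub> x)"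
  shows "L'.\<theta> x a = snd (minv (D x) mA (eps x)) (fst (eps x) (\<theta> x a))"
proof -
  obtain s where s: "s \<in> S" "x = S.cls s" "a \<in> A" "A.ran a = \<alpha> (S.dom s)"
    using a unfolding mem_D_inv_iff[OF x] by blast
  define b where "b = lam s a"
  have b: "b \<in> A" "A.ran b = \<alpha> (S.ran s)" using s by (simp_all add: b_def ran_lam)
  have "L'.\<theta> x a = A.conjugate (g s) b" using s by (simp add: theta'_cls lam'_eq b_def)
  also have "g s = snd (eps x) (A.ran b)" using s b by (simp add: eps_cls alpha_ran_mult_g)
  also have "A.conjugate (snd (eps x) (A.ran b)) b
      = snd (minv (D x) mA (eps x)) (fst (eps x) b)"
    using x s b by (intro A.snd_minv_fst[symmetric] ideal_D eps_unit) (auto intro: mem_D_clsI)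
  finally show ?thesis using s by (simp add: theta_cls b_def)
qed

lemma eps_cocycle:
  assumes x: "x \<in> carrier S.G" and y: "y \<in> carrier S.G" and a: "a \<in> D (inv\<^bsub>S.G\<^esub> x)" "a \<in> D y"
  shows "snd (eps (x \<otimes>\<^bsub>S.G\<^esub> y)) (snd (L'.w x y) (L'.\<theta> x a)) =
    snd (w x y) (fst (eps x) (\<theta> x (snd (eps y) a)))"
proof -
  obtain u v where uv: "u \<in> S" "v \<in> S" "x = S.cls u" "y = S.cls v" "S.dom u = S.ran v"
    "A.ran a = \<alpha> (S.dom u)"
    using D_inv_obtain[OF x y a] by blast
  have aA: "a \<in> A" using y a by (simp add: mem_D_iff)
  have lam': "lam' u a \<in> A" "A.ran (lam' u a) = \<alpha> (S.ran u)"
    using uv aA L'.ran_lam[of u a] by (simp_all add: L'.lam_closed)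
  have f': "f' u v \<in> A" "A.ran (f' u v) = \<alpha> (S.ran u)"
    using uv by (simp_all add: S.ran_mult_composable)
  have "snd (eps (x \<otimes>\<^bsub>S.G\<^esub> y)) (snd (L'.w x y) (L'.\<theta> x a)) = lam' u a \<odot> f' u v \<odot> g (u \<cdot> v)"
    using uv aA lam' f' eps_cls(2)[of "u \<cdot> v" "lam' u a \<odot> f' u v"]
    by (simp add: theta'_cls L'.w_cls A.ran_mult S.ran_mult_composable)
  also have "\<dots> = g u \<odot> lam u (a \<odot> g v) \<odot> f u v" using uv aA by (simp add: twisted_cocycle_mult)
  also have "\<dots> = snd (w x y) (fst (eps x) (\<theta> x (snd (eps y) a)))"
    using uv aA by (simp add: eps_cls theta_cls w_cls ran_lam A.ran_mult)
  finally show ?thesis .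
qed

lemma tpa_equiv: "tpa_equiv S.G A mA D \<theta> w L'.D L'.\<theta> L'.w"
  unfolding tpa_equiv_def
proof (intro conjI ballI exI[of _ eps])
  fix x y a assume "x \<in> carrier S.G" "y \<in> carrier S.G" "a \<in> setprod mA (D (inv\<^bsub>S.G\<^esub> x)) (D y)"
  then show "snd (eps (x \<otimes>\<^bsub>S.G\<^esub> y)) (snd (L'.w x y) (L'.\<theta> x a)) =
      snd (w x y) (fst (eps x) (\<theta> x (snd (eps y) a)))"
    by (intro eps_cocycle) (simp_all add: A.setprod_ideal ideal_D)
qed (simp_all add: D'_eq eps_unit theta'_minv)

end

lemma ex_E_unitary_sieben_module_equiv:
  assumes "E_unitary_sieben_module A mA S m \<alpha> lam f"
    and "E_unitary_sieben_module A mA S m \<alpha>' lam' f'"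
    and "tms_equiv S m A mA \<alpha> lam f \<alpha>' lam' f'"
  shows "\<exists>g. E_unitary_sieben_module_equiv A mA S m \<alpha> lam f \<alpha>' lam' f' g"
  unfolding E_unitary_sieben_module_equiv_def
  using assms ex_sieben_module_equiv E_unitary_sieben_module.axioms(1) by metis

locale twisted_partial_action_equiv =
  twisted_partial_action A mA G D \<theta> w + T': twisted_partial_action A mA G D' \<theta>' w'
  for A :: "'b set" and mA :: "'b \<Rightarrow> 'b \<Rightarrow> 'b" (infixl "\<odot>" 70)
    and G :: "'g monoid" (structure) and D \<theta> w D' \<theta>' w' +
  fixes \<epsilon> :: "'g \<Rightarrow> ('b \<Rightarrow> 'b) \<times> ('b \<Rightarrow> 'b)"
  assumes D'_eq [simp]: "x \<in> carrier G \<Longrightarrow> D' x = D x"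
    and eps_unit: "x \<in> carrier G \<Longrightarrow> is_unit_multiplier (D x) mA (\<epsilon> x)"
    and theta'_minv: "x \<in> carrier G \<Longrightarrow> a \<in> D (inv x) \<Longrightarrow>
      \<theta>' x a = snd (minv (D x) mA (\<epsilon> x)) (fst (\<epsilon> x) (\<theta> x a))"
    and eps_cocycle: "x \<in> carrier G \<Longrightarrow> y \<in> carrier G \<Longrightarrow> a \<in> D (inv x) \<Longrightarrow> a \<in> D y \<Longrightarrow>
      snd (\<epsilon> (x \<otimes> y)) (snd (w' x y) (\<theta>' x a)) = snd (w x y) (fst (\<epsilon> x) (\<theta> x (snd (\<epsilon> y) a)))"
begin

abbreviation g :: "'g \<Rightarrow> 'b \<Rightarrow> 'b" where "g x \<equiv> snd (\<epsilon> x)"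

lemma g_section: "x \<in> carrier G \<Longrightarrow> A.group_section (D x) (g x)"
  by (intro A.unit_multiplier_group_section ideal_D eps_unit)

lemma g_closed: "x \<in> carrier G \<Longrightarrow> e \<in> D x \<Longrightarrow> e \<in> A.E \<Longrightarrow> g x e \<in> A"
  and ran_g: "x \<in> carrier G \<Longrightarrow> e \<in> D x \<Longrightarrow> e \<in> A.E \<Longrightarrow> A.ran (g x e) = e"
  and g_restrict: "x \<in> carrier G \<Longrightarrow> e \<in> D x \<Longrightarrow> e \<in> A.E \<Longrightarrow> k \<in> A.E \<Longrightarrow> g x (e \<odot> k) = g x e \<odot> k"
  using g_section A.group_section_closed A.ran_group_section A.group_section_restrict by blast+

lemma eps_eq:
  assumes "x \<in> carrier G" "a \<in> D x"
  shows "fst (\<epsilon> x) a = g x (A.ran a) \<odot> a" and "snd (\<epsilon> x) a = a \<odot> g x (A.ran a)"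
  using assms A.multiplier_eq[OF ideal_D A.unit_multiplier_multiplier[OF eps_unit]] by blast+

lemma theta'_eq:
  "x \<in> carrier G \<Longrightarrow> a \<in> D (inv x) \<Longrightarrow> \<theta>' x a = A.conjugate (g x (A.ran (\<theta> x a))) (\<theta> x a)"
  by (simp add: theta'_minv A.snd_minv_fst[OF ideal_D eps_unit] theta_mem)

lemma theta'_idem: "x \<in> carrier G \<Longrightarrow> e \<in> D (inv x) \<Longrightarrow> e \<in> A.E \<Longrightarrow> \<theta>' x e = \<theta> x e"
  by (simp add: theta'_eq theta_idem theta_mem A.conjugate_idem g_closed ran_g)

lemma inv_theta'_idem:
  assumes "x \<in> carrier G" "e \<in> D x" "e \<in> A.E"
  shows "T'.inv_theta x e = inv_theta x e"
  using assms T'.inv_theta_theta[of x "inv_theta x e"]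
  by (simp add: theta'_idem inv_theta_mem inv_theta_idem theta_inv_theta)

lemma cross'_eq: "T'.cross = cross"
  by (auto simp: pair_mem_cross_iff T'.pair_mem_cross_iff)

lemma src'_eq: "p \<in> cross \<Longrightarrow> T'.src p = src p"
  by (simp add: T'.src_def src_def inv_theta'_idem fst_cross_D)

lemma lam'_eq:
  assumes p: "p \<in> cross" and a: "a \<in> A"
  shows "T'.lam p a = A.conjugate (g (snd p) (fst p)) (lam p a)"
proof -
  have "T'.lam p a = A.conjugate (g (snd p) (A.ran (lam p a))) (lam p a)"
    using p a by (simp add: T'.lam_eq lam_eq src'_eq theta'_eq D_right src_mem)
  also have "\<dots> = A.conjugate (g (snd p) (fst p)) (lam p a)"
    using p a by (intro A.conjugate_group_section[OF g_section]) (auto simp: fst_cross_D lam_absorb)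
  finally show ?thesis .
qed

lemma fst_star'_eq: "p \<in> cross \<Longrightarrow> q \<in> cross \<Longrightarrow> fst (T'.star p q) = fst (p \<star> q)"
  by (simp add: T'.fst_star fst_star T'.lam_eq lam_eq src'_eq theta'_idem D_right src_mem)

lemma star'_eq: "p \<in> cross \<Longrightarrow> q \<in> cross \<Longrightarrow> T'.star p q = p \<star> q"
  by (simp add: prod_eq_iff fst_star'_eq)

lemma g_cocycle:
  assumes x: "x \<in> carrier G" and y: "y \<in> carrier G"
    and e: "e \<in> D (inv x)" "e \<in> D y" "e \<in> A.E"
  shows "T'.twist x y (\<theta> x e) \<odot> g (x \<otimes> y) (\<theta> x e) = g x (\<theta> x e) \<odot> \<theta> x (g y e) \<odot> twist x y (\<theta> x e)"
proof -
  define r where "r = \<theta> x e"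
  have r: "r \<in> A.E" "r \<in> D x" "r \<in> D (x \<otimes> y)"
    using x y e by (simp_all add: r_def theta_idem theta_mem theta_mem_mult_iff)
  have twist': "T'.twist x y r \<in> A" "A.ran (T'.twist x y r) = r"
    using x y r T'.twist_closed[of x y r] T'.ran_twist[of x y r] by simp_all
  then have "T'.twist x y r \<in> D (x \<otimes> y)" using x y r D_ran_iff[of "x \<otimes> y" "T'.twist x y r"] by simp
  then have left: "snd (\<epsilon> (x \<otimes> y)) (T'.twist x y r) = T'.twist x y r \<odot> g (x \<otimes> y) r"
    using x y twist' eps_eq(2)[of "x \<otimes> y" "T'.twist x y r"] by simp
  have gy: "g y e \<in> A" "A.ran (g y e) = e" using y e by (simp_all add: g_closed ran_g)
  then have gy_mem: "g y e \<in> D (inv x)" "g y e \<in> D y"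
    using x y e D_ran_iff[of _ "g y e"] by auto
  define b where "b = \<theta> x (g y e)"
  have b: "b \<in> A" "b \<in> D x" "b \<in> D (x \<otimes> y)" "A.ran b = r"
    using x y gy gy_mem
    by (simp_all add: b_def theta_closed theta_mem theta_mem_mult_iff theta_ran r_def)
  have "snd (w x y) (g x r \<odot> b) = g x r \<odot> b \<odot> twist x y r"
    using x y r b w_eq(2)[of x y "g x r \<odot> b"] by (simp add: D_left g_closed ran_g A.ran_mult)
  then show ?thesis
    using eps_cocycle[OF x y e(1,2)] left x b e eps_eq(1)[of x b]
    by (simp add: theta'_idem flip: r_def b_def)
qed

lemma f'_mult_g:
  assumes p: "p \<in> cross" and q: "q \<in> cross"
  shows "T'.f p q \<odot> g (snd p \<otimes> snd q) (fst (p \<star> q))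
    = g (snd p) (fst p) \<odot> lam p (g (snd q) (fst q)) \<odot> f p q"
proof -
  define x y r where "x = snd p" and "y = snd q" and "r = fst (p \<star> q)"
  have xy: "x \<in> carrier G" "y \<in> carrier G" using p q by (simp_all add: x_def y_def)
  define h where "h = src p \<odot> fst q"
  have h: "h \<in> A.E" "h \<in> D (inv x)" "h \<in> D y"
    using p q xy src_mem[OF p] fst_cross_D[OF q] by (simp_all add: h_def D_left D_right x_def y_def)
  have r: "r = \<theta> x h" by (simp add: r_def fst_star lam_eq h_def x_def)
  have lam: "lam p (g y (fst q)) = \<theta> x (g y h)"
  proof -
    have "src p \<odot> g y (fst q) = g y (fst q) \<odot> src p"
      using p q fst_cross_D[OF q] by (intro A.idem_central) (auto simp: g_closed y_def)
    also have "\<dots> = g y h"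
      using p q xy fst_cross_D[OF q]
      by (simp add: h_def A.idem_comm[of "src p" "fst q"] g_restrict y_def)
    finally show ?thesis by (simp add: lam_eq x_def)
  qed
  have "g x r \<odot> \<theta> x (g y h) = g x (fst p) \<odot> \<theta> x (g y h)"
  proof -
    have "A.ran (\<theta> x (g y h)) = r" "\<theta> x (g y h) \<in> A"
      using xy h D_ran_iff[of "inv x" "g y h"]
      by (simp_all add: r theta_ran theta_closed g_closed ran_g)
    moreover have "fst p \<odot> r = r" "r \<in> A.E" using p q by (simp_all add: r_def fst_star lam_absorb)
    moreover have "g x (fst p \<odot> r) = g x (fst p) \<odot> r" "g x (fst p) \<in> A"
      using p fst_cross_D[OF p] \<open>r \<in> A.E\<close> by (simp_all add: g_restrict g_closed x_def)
    ultimately show ?thesis using A.ran_mult_self[of "\<theta> x (g y h)"] by (simp add: A.assoc)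
  qed
  then show ?thesis
    using g_cocycle[OF xy h(2,3,1)] lam p q
    by (simp add: f_eq T'.f_eq fst_star'_eq flip: r r_def x_def y_def)
qed

lemma tms_equiv: "tms_equiv cross star A mA lmAlpha lam f lmAlpha T'.lam T'.f"
  unfolding tms_equiv_def
  by (intro conjI ballI exI[of _ "\<lambda>p. g (snd p) (fst p)"])
    (simp_all add: A.mem_Agrp_iff g_closed ran_g fst_cross_D lam'_eq A.conjugate_def f'_mult_g
      flip: C.ran_def)

end

lemma ex_twisted_partial_action_equiv:
  fixes G (structure)
  assumes "twisted_partial_action A mA G D \<theta> w" and "twisted_partial_action A mA G D' \<theta>' w'"
    and equiv: "tpa_equiv G A mA D \<theta> w D' \<theta>' w'"
  shows "\<exists>\<epsilon>. twisted_partial_action_equiv A mA G D \<theta> w D' \<theta>' w' \<epsilon>"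
proof -
  interpret twisted_partial_action A mA G D \<theta> w by fact
  interpret T': twisted_partial_action A mA G D' \<theta>' w' by fact
  have D': "D' x = D x" if "x \<in> carrier G" for x using equiv that by (simp add: tpa_equiv_def)
  obtain \<epsilon> where unit: "\<And>x. x \<in> carrier G \<Longrightarrow> is_unit_multiplier (D x) mA (\<epsilon> x)"
    and theta': "\<And>x a. x \<in> carrier G \<Longrightarrow> a \<in> D (inv x) \<Longrightarrow>
      \<theta>' x a = snd (minv (D x) mA (\<epsilon> x)) (fst (\<epsilon> x) (\<theta> x a))"
    and cocycle: "\<And>x y a. x \<in> carrier G \<Longrightarrow> y \<in> carrier G \<Longrightarrow> a \<in> setprod mA (D (inv x)) (D y) \<Longrightarrow>
      snd (\<epsilon> (x \<otimes> y)) (snd (w' x y) (\<theta>' x a)) = snd (w x y) (fst (\<epsilon> x) (\<theta> x (snd (\<epsilon> y) a)))"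
    using equiv unfolding tpa_equiv_def by blast
  have "twisted_partial_action_equiv A mA G D \<theta> w D' \<theta>' w' \<epsilon>"
  proof unfold_locales
    fix x y a assume "x \<in> carrier G" "y \<in> carrier G" "a \<in> D (inv x)" "a \<in> D y"
    then show "snd (\<epsilon> (x \<otimes> y)) (snd (w' x y) (\<theta>' x a)) =
        snd (w x y) (fst (\<epsilon> x) (\<theta> x (snd (\<epsilon> y) a)))"
      by (intro cocycle) (simp_all add: A.setprod_ideal ideal_D)
  qed (fact D' unit theta')+
  then show ?thesis by blast
qed

section \<open>The correspondence\<close>

lemma E_unitary_sieben_module_iff:
  assumes "clifford_semigroup A mA"
  shows "E_unitary_sieben_module A mA S m \<alpha> lam f \<longleftrightarrow>
    inverse_semigroup S m \<and> E_unitary S m \<and> sieben_tms S m A mA \<alpha> lam f"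
  unfolding E_unitary_sieben_module_def E_unitary_semigroup_def E_unitary_semigroup_axioms_def
  using sieben_module_iff[OF assms] sieben_module.axioms(2) inv_semigroup_def by metis

theorem theorem9p3:
  fixes A :: "'b set" and mA :: "'b \<Rightarrow> 'b \<Rightarrow> 'b"
  assumes "semilattice_of_groups A mA"
  shows
    \<comment> \<open>Lambda \<mapsto> Theta^Lambda lands in twisted partial actions, and Lambda = Lambda^(Theta^Lambda) \<circ> \<nu>\<close>
    "(\<forall>(S :: 'a set) m \<alpha> lam f.
        inverse_semigroup S m \<and> E_unitary S m \<and> sieben_tms S m A mA \<alpha> lam f \<longrightarrow>
          tpa (maxgrp S m) A mA (thD S m A mA \<alpha>) (thTheta S m A mA \<alpha> lam) (thW S m A mA \<alpha> f) \<and>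
          (\<exists>\<nu>. sg_iso \<nu> S m
                 (cross_car (maxgrp S m) mA (thD S m A mA \<alpha>))
                 (cross_mult (maxgrp S m) mA (thD S m A mA \<alpha>) (thTheta S m A mA \<alpha> lam)) \<and>
               tms_comp_eq S m A \<alpha> lam f
                 lmAlpha
                 (lmLam (maxgrp S m) mA (thD S m A mA \<alpha>) (thTheta S m A mA \<alpha> lam))
                 (lmF (maxgrp S m) mA (thD S m A mA \<alpha>) (thTheta S m A mA \<alpha> lam) (thW S m A mA \<alpha> f))
                 \<nu>)) \<and>
     \<comment> \<open>Theta \<mapsto> Lambda^Theta lands in Sieben structures over E-unitary inverse semigroups,
         and Theta = Theta^(Lambda^Theta) \<circ> \<nu>\<close>
     (\<forall>(G :: 'g monoid) D \<theta> w.
        tpa G A mA D \<theta> w \<longrightarrow>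
          inverse_semigroup (cross_car G mA D) (cross_mult G mA D \<theta>) \<and>
          E_unitary (cross_car G mA D) (cross_mult G mA D \<theta>) \<and>
          sieben_tms (cross_car G mA D) (cross_mult G mA D \<theta>) A mA
             lmAlpha (lmLam G mA D \<theta>) (lmF G mA D \<theta> w) \<and>
          (\<exists>\<nu>. \<nu> \<in> iso G (maxgrp (cross_car G mA D) (cross_mult G mA D \<theta>)) \<and>
               tpa_comp_eq G mA D \<theta> w
                 (thD (cross_car G mA D) (cross_mult G mA D \<theta>) A mA lmAlpha)
                 (thTheta (cross_car G mA D) (cross_mult G mA D \<theta>) A mA lmAlpha (lmLam G mA D \<theta>))
                 (thW (cross_car G mA D) (cross_mult G mA D \<theta>) A mA lmAlpha (lmF G mA D \<theta> w))
                 \<nu>)) \<and>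
     \<comment> \<open>equivalent twisted partial actions give equivalent Sieben twisted modules
         (over the same semigroup E(A) *_\<theta> G = E(A) *_\<theta>' G)\<close>
     (\<forall>(G :: 'g monoid) D \<theta> w D' \<theta>' w'.
        tpa G A mA D \<theta> w \<and> tpa G A mA D' \<theta>' w' \<and> tpa_equiv G A mA D \<theta> w D' \<theta>' w' \<longrightarrow>
          cross_car G mA D' = cross_car G mA D \<and>
          (\<forall>p\<in>cross_car G mA D. \<forall>q\<in>cross_car G mA D.
             cross_mult G mA D' \<theta>' p q = cross_mult G mA D \<theta> p q) \<and>
          tms_equiv (cross_car G mA D) (cross_mult G mA D \<theta>) A mA
             lmAlpha (lmLam G mA D \<theta>) (lmF G mA D \<theta> w)
             lmAlpha (lmLam G mA D' \<theta>') (lmF G mA D' \<theta>' w')) \<and>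
     \<comment> \<open>equivalent Sieben twisted modules give equivalent twisted partial actions\<close>
     (\<forall>(S :: 'a set) m \<alpha> lam f \<alpha>' lam' f'.
        inverse_semigroup S m \<and> E_unitary S m \<and>
        sieben_tms S m A mA \<alpha> lam f \<and> sieben_tms S m A mA \<alpha>' lam' f' \<and>
        tms_equiv S m A mA \<alpha> lam f \<alpha>' lam' f' \<longrightarrow>
          tpa_equiv (maxgrp S m) A mA
             (thD S m A mA \<alpha>) (thTheta S m A mA \<alpha> lam) (thW S m A mA \<alpha> f)
             (thD S m A mA \<alpha>') (thTheta S m A mA \<alpha>' lam') (thW S m A mA \<alpha>' f'))"
proof -
  have clifford: "clifford_semigroup A mA" using assms by (rule clifford_semigroupI)
  note module_iff = E_unitary_sieben_module_iff[OF clifford]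
    and action_iff = twisted_partial_action_iff[OF clifford]
  show ?thesis
  proof ((intro conjI; intro allI impI), goal_cases)
    case (1 S m \<alpha> lam f)
    then interpret E_unitary_sieben_module A mA S m \<alpha> lam f by (simp add: module_iff)
    show ?case using twisted_partial_action to_cross_iso to_cross_comp_eq action_iff by blast
  next
    case (2 G D \<theta> w)
    then interpret twisted_partial_action A mA G D \<theta> w by (simp add: action_iff)
    show ?case
      using \<Lambda>.E_unitary_sieben_module_axioms to_maxgrp_iso to_maxgrp_comp_eq module_iff by blast
  next
    case (3 G D \<theta> w D' \<theta>' w')
    then obtain \<epsilon> where "twisted_partial_action_equiv A mA G D \<theta> w D' \<theta>' w' \<epsilon>"
      using ex_twisted_partial_action_equiv action_iff by blast
    then interpret twisted_partial_action_equiv A mA G D \<theta> w D' \<theta>' w' \<epsilon> .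
    show ?case using cross'_eq star'_eq tms_equiv by blast
  next
    case (4 S m \<alpha> lam f \<alpha>' lam' f')
    then obtain g where "E_unitary_sieben_module_equiv A mA S m \<alpha> lam f \<alpha>' lam' f' g"
      using ex_E_unitary_sieben_module_equiv module_iff by blast
    then interpret E_unitary_sieben_module_equiv A mA S m \<alpha> lam f \<alpha>' lam' f' g .
    show ?case by (rule tpa_equiv)
  qed
qed

end
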